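(* Let $\ell>0$ and let $\lambda$ be a frequency for which there is some $\beta>0$ such that $\frac{1}{\lambda_{n+1}-\lambda_n}=O(e^{\beta\lambda_n})$. Then the $\lambda$-Riesz germ $D$ of every $f\in H_{\infty,\ell}^{\lambda}[\mathrm{Re}>0]$ is $(\lambda,\ell)$-Riesz summable on $[\mathrm{Re}>0]$. In particular: $\mathcal{D}_{\infty,\ell}(\lambda)$ satisfies Montel's theorem; $\mathcal{D}_{\infty,\ell}(\lambda)$ is a Banach space; and $\mathcal{D}_{\infty,\ell}(\lambda)=H_{\infty,\ell}^{\lambda}[\mathrm{Re}>0]$ holds isometrically and coefficient preserving.
   Context: A frequency is a strictly increasing sequence $\lambda=(\lambda_n)_{n\ge 1}$ of non-negative real numbers with $\lambda_n\to\infty$. A $\lambda$-Dirichlet series is a formal series $D=\sum a_n e^{-\lambda_n s}$ with complex coefficients $a_n$. Write $[\mathrm{Re}>\sigma]=\{s\in\mathbb{C}:\mathrm{Re}\,s>\sigma\}$. For $k\ge0$, $D$ is $(\lambda,k)$-Riesz summable at $s$ if $\lim_{x\to\infty}\sum_{\lambda_n<x}a_ne^{-\lambda_ns}\big(1-\frac{\lambda_n}{x}\big)^k$ exists, and on a set if this holds at each of its points; the limit, as a function of $s$, is the limit function. $D$ is a $\lambda$-Riesz germ of a holomorphic function $f:[\mathrm{Re}>0]\to\mathbb{C}$ if for some $m\ge 0$ and some $\sigma\ge 0$ one has $f(s)=\lim_{x\to\infty}\sum_{\lambda_n<x}a_ne^{-\lambda_ns}\big(1-\frac{\lambda_n}{x}\big)^m$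 for all $s\in[\mathrm{Re}>\sigma]$. A $\lambda$-Riesz germ, if it exists, is unique, and one writes $a_n(f):=a_n$. For $\ell\ge 0$, $H_{\infty,\ell}^{\lambda}[\mathrm{Re}>0]$ is the linear space of all holomorphic $f:[\mathrm{Re}>0]\to\mathbb{C}$ which have a $\lambda$-Riesz germ and satisfy $\|f\|_{\infty,\ell}=\sup_{\mathrm{Re}\,s>0}\frac{|f(s)|}{(1+|s|)^{\ell}}<\infty$. $\mathcal{D}_{\infty,\ell}(\lambda)$ is the space of all $\lambda$-Dirichlet series $D$ that are $(\lambda,\ell)$-Riesz summable on all of $[\mathrm{Re}>0]$ and whose limit function $f$ belongs to $H_{\infty,\ell}^{\lambda}[\mathrm{Re}>0]$, normed by $\|D\|_{\infty,\ell}=\|f\|_{\infty,\ell}$. "$\mathcal{D}_{\infty,\ell}(\lambda)$ satisfies Montel's theorem" means: for every bounded sequence $(D_N)$ in $\mathcal{D}_{\infty,\ell}(\lambda)$ there are a subsequence $(D_{N_j})$ and $D\in\mathcal{D}_{\infty,\ell}(\lambda)$ such that for every $u>0$ the translates of the $D_{N_j}$ about $u$ converge in $\mathcal{D}_{\infty,\ell}(\lambda)$ to the translate of $D$ about $u$, where the translate of $\sum a_ne^{-\lambda_ns}$ about $u$ is $\sum a_ne^{-\lambda_nu}e^{-\lambda_ns}$. "$\mathcal{D}_{\infty,\ell}(\lambda)=H_{\infty,\ell}^{\lambda}[\mathrm{Re}>0]$ isometrically and coefficient preserving" means that sending $D$ to its limit function $f$ is an isometric linear bijection with $a_n(f)=a_n$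 for all $n$. *)

theory Defs
  imports "HOL-Complex_Analysis.Complex_Analysis" "HOL-Library.Landau_Symbols"
begin

text \<open>
  Frequencies and Dirichlet series are indexed from \<open>0\<close> rather than from \<open>1\<close>. A formal
  \<open>lam\<close>-Dirichlet series is identified with its coefficient sequence \<open>a :: nat \<Rightarrow> complex\<close>.
\<close>

definition frequency :: "(nat \<Rightarrow> real) \<Rightarrow> bool" where
  "frequency lam \<longleftrightarrow>
     strict_mono lam \<and> (\<forall>n. 0 \<le> lam n) \<and> filterlim lam at_top sequentially"

definition halfplane :: "real \<Rightarrow> complex set" where
  "halfplane \<sigma> = {s. Re s > \<sigma>}"

text \<open>
  For \<open>lam n < x\<close> with \<open>lam n \<ge> 0\<close> the base \<open>1 - lam n / x\<close> is positive, so \<open>powr\<close> is the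
  ordinary real power (in particular it is \<open>1\<close> for \<open>k = 0\<close>). The index set is finite for a
  frequency.
\<close>

definition riesz_mean ::
  "(nat \<Rightarrow> real) \<Rightarrow> real \<Rightarrow> (nat \<Rightarrow> complex) \<Rightarrow> complex \<Rightarrow> real \<Rightarrow> complex" where
  "riesz_mean lam k a s x =
     (\<Sum>n | lam n < x. a n * exp (- (of_real (lam n) * s)) * of_real ((1 - lam n / x) powr k))"

definition riesz_summable_at ::
  "(nat \<Rightarrow> real) \<Rightarrow> real \<Rightarrow> (nat \<Rightarrow> complex) \<Rightarrow> complex \<Rightarrow> bool" where
  "riesz_summable_at lam k a s \<longleftrightarrow> (\<exists>L. (riesz_mean lam k a s \<longlongrightarrow> L) at_top)"

definition riesz_summable_on ::
  "(nat \<Rightarrow> real) \<Rightarrow> real \<Rightarrow> (nat \<Rightarrow> complex) \<Rightarrow> complex set \<Rightarrow> bool" where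
  "riesz_summable_on lam k a S \<longleftrightarrow> (\<forall>s\<in>S. riesz_summable_at lam k a s)"

text \<open>
  A function on the open right half-plane is represented by its extension by \<open>0\<close> to all of
  \<open>complex\<close>, so that equality of functions is equality on the half-plane.
\<close>

definition riesz_limit ::
  "(nat \<Rightarrow> real) \<Rightarrow> real \<Rightarrow> (nat \<Rightarrow> complex) \<Rightarrow> complex \<Rightarrow> complex" where
  "riesz_limit lam k a s = (if s \<in> halfplane 0 then Lim at_top (riesz_mean lam k a s) else 0)"

definition riesz_germ :: "(nat \<Rightarrow> real) \<Rightarrow> (nat \<Rightarrow> complex) \<Rightarrow> (complex \<Rightarrow> complex) \<Rightarrow> bool" where
  "riesz_germ lam a f \<longleftrightarrow>
     (\<exists>m\<ge>0. \<exists>\<sigma>\<ge>0. \<forall>s\<in>halfplane \<sigma>. (riesz_mean lam m a s \<longlongrightarrow> f s) at_top)"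

definition riesz_coeff :: "(nat \<Rightarrow> real) \<Rightarrow> (complex \<Rightarrow> complex) \<Rightarrow> nat \<Rightarrow> complex" where
  "riesz_coeff lam f = (THE a. riesz_germ lam a f)"

definition H_norm :: "real \<Rightarrow> (complex \<Rightarrow> complex) \<Rightarrow> real" where
  "H_norm l f = (SUP s\<in>halfplane 0. norm (f s) / (1 + norm s) powr l)"

definition H_space :: "(nat \<Rightarrow> real) \<Rightarrow> real \<Rightarrow> (complex \<Rightarrow> complex) set" where
  "H_space lam l =
     {f. f holomorphic_on halfplane 0 \<and> (\<forall>s. s \<notin> halfplane 0 \<longrightarrow> f s = 0) \<and>
         (\<exists>a. riesz_germ lam a f) \<and>
         bdd_above ((\<lambda>s. norm (f s) / (1 + norm s) powr l) ` halfplane 0)}"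

definition D_space :: "(nat \<Rightarrow> real) \<Rightarrow> real \<Rightarrow> (nat \<Rightarrow> complex) set" where
  "D_space lam l =
     {a. riesz_summable_on lam l a (halfplane 0) \<and> riesz_limit lam l a \<in> H_space lam l}"

definition D_norm :: "(nat \<Rightarrow> real) \<Rightarrow> real \<Rightarrow> (nat \<Rightarrow> complex) \<Rightarrow> real" where
  "D_norm lam l a = H_norm l (riesz_limit lam l a)"

definition translate ::
  "(nat \<Rightarrow> real) \<Rightarrow> real \<Rightarrow> (nat \<Rightarrow> complex) \<Rightarrow> nat \<Rightarrow> complex" where
  "translate lam u a n = a n * of_real (exp (- (lam n * u)))"

text \<open>
  Normed spaces of complex-valued functions (here: of sequences, or of functions on the half-plane)
  under the pointwise operations.
\<close>

definition converges_in ::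
  "('i \<Rightarrow> complex) set \<Rightarrow> (('i \<Rightarrow> complex) \<Rightarrow> real) \<Rightarrow> (nat \<Rightarrow> 'i \<Rightarrow> complex) \<Rightarrow> ('i \<Rightarrow> complex) \<Rightarrow> bool"
  where
  "converges_in V nrm X a \<longleftrightarrow>
     (\<forall>j. X j \<in> V) \<and> a \<in> V \<and> (\<lambda>j. nrm (\<lambda>i. X j i - a i)) \<longlonglongrightarrow> 0"

definition complex_normed_space :: "('i \<Rightarrow> complex) set \<Rightarrow> (('i \<Rightarrow> complex) \<Rightarrow> real) \<Rightarrow> bool" where
  "complex_normed_space V nrm \<longleftrightarrow>
     (\<lambda>i. 0) \<in> V \<and>
     (\<forall>a\<in>V. \<forall>b\<in>V. (\<lambda>i. a i + b i) \<in> V) \<and>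
     (\<forall>c. \<forall>a\<in>V. (\<lambda>i. c * a i) \<in> V) \<and>
     (\<forall>a\<in>V. 0 \<le> nrm a) \<and>
     (\<forall>a\<in>V. nrm a = 0 \<longleftrightarrow> a = (\<lambda>i. 0)) \<and>
     (\<forall>c. \<forall>a\<in>V. nrm (\<lambda>i. c * a i) = norm c * nrm a) \<and>
     (\<forall>a\<in>V. \<forall>b\<in>V. nrm (\<lambda>i. a i + b i) \<le> nrm a + nrm b)"

definition complex_banach_space :: "('i \<Rightarrow> complex) set \<Rightarrow> (('i \<Rightarrow> complex) \<Rightarrow> real) \<Rightarrow> bool" where
  "complex_banach_space V nrm \<longleftrightarrow>
     complex_normed_space V nrm \<and>
     (\<forall>X. (\<forall>j. X j \<in> V) \<and>
          (\<forall>e>0. \<exists>M. \<forall>j\<ge>M. \<forall>k\<ge>M. nrm (\<lambda>i. X j i - X k i) < e) \<longrightarrow>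
          (\<exists>a. converges_in V nrm X a))"

definition isometric_linear_bijection ::
  "('i \<Rightarrow> complex) set \<Rightarrow> (('i \<Rightarrow> complex) \<Rightarrow> real) \<Rightarrow>
   ('j \<Rightarrow> complex) set \<Rightarrow> (('j \<Rightarrow> complex) \<Rightarrow> real) \<Rightarrow>
   (('i \<Rightarrow> complex) \<Rightarrow> 'j \<Rightarrow> complex) \<Rightarrow> bool" where
  "isometric_linear_bijection V nV W nW T \<longleftrightarrow>
     bij_betw T V W \<and>
     (\<forall>a\<in>V. \<forall>b\<in>V. T (\<lambda>i. a i + b i) = (\<lambda>j. T a j + T b j)) \<and>
     (\<forall>c. \<forall>a\<in>V. T (\<lambda>i. c * a i) = (\<lambda>j. c * T a j)) \<and>
     (\<forall>a\<in>V. nW (T a) = nV a)"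

definition satisfies_montel :: "(nat \<Rightarrow> real) \<Rightarrow> real \<Rightarrow> bool" where
  "satisfies_montel lam l \<longleftrightarrow>
     (\<forall>X. (\<forall>N. X N \<in> D_space lam l) \<and> (\<exists>C. \<forall>N. D_norm lam l (X N) \<le> C) \<longrightarrow>
       (\<exists>r :: nat \<Rightarrow> nat. strict_mono r \<and>
         (\<exists>a\<in>D_space lam l. \<forall>u>0.
            converges_in (D_space lam l) (D_norm lam l)
              (\<lambda>j. translate lam u (X (r j))) (translate lam u a))))"

end

theory Submission
  imports Defs "HOL-Real_Asymp.Real_Asymp"
begin

text \<open>
  The gap condition makes \<open>exp (\<beta> * lam n)\<close> grow at least linearly and, by taking \<open>k\<close>-th finite
  differences of a Riesz mean inside a gap, turns bounds on Riesz means into exponential bounds on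
  the coefficients. So every Riesz germ converges absolutely in some half-plane, with constants that
  depend only on \<open>lam\<close>, \<open>l\<close> and the norm of the limit function.

  Fix \<open>s\<close> with \<open>Re s > 0\<close>. Perron's formula writes the Riesz mean of order \<open>l\<close> as the integral of
  \<open>f (s + z) exp (x z) z powr (-1 - l)\<close> over a vertical line far to the right. Since \<open>l > 0\<close>, truncation
  at height \<open>T = exp (C x)\<close> costs only \<open>O(1)\<close>; moving the contour to \<open>Re z < 0\<close>, with a keyhole at
  distance \<open>1 / x\<close> around the branch point \<open>0\<close>, the growth \<open>O(\<bar>z\<bar> powr l)\<close> of \<open>f\<close> leaves an integrand
  \<open>O(exp (- v x) / \<bar>z\<bar>)\<close>, and the logarithm \<open>ln T = C x\<close> is absorbed by \<open>exp (- v x)\<close>. Hence the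
  Riesz means are locally bounded on \<open>Re s > 0\<close>, and since they converge far to the right, a normal
  family argument gives convergence to \<open>f\<close> everywhere.

  For Montel's theorem, a subsequence converges coefficientwise and locally uniformly; the differences
  tend to \<open>0\<close> uniformly far to the right, and a three lines argument for \<open>f s / (1 + s) powr l\<close> carries
  this over to \<open>Re s \<ge> u\<close> in the weighted norm.
\<close>

section \<open>Integrals over line segments\<close>

text \<open>The obstacle is that order \<open>l\<close> is the borderline: on a vertical line where
  nothing but the growth of \<open>f\<close> is known, \<open>\<bar>z\<bar> powr l\<close> cancels
  the decay of the kernel down to \<open>1 / \<bar>z\<bar>\<close>, which is not integrable. Far to
  the right \<open>f\<close> is bounded and the tail of the kernel decays like
  \<open>T powr (- l)\<close>; this is where \<open>l > 0\<close> enters, and why an exponentially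
  large \<open>T\<close> beats the factor \<open>exp (\<sigma> * x)\<close>. The estimate must not
  exceed \<open>x powr l\<close>, because a Riesz mean is the unnormalised sum divided by
  \<open>x powr l\<close>; passing the branch point at distance \<open>1 / x\<close> produces
  precisely this power. The point \<open>s\<close> is absorbed into the coefficients
  \<open>a n * exp (- lam n * s)\<close> and into a translate of \<open>f\<close>. For orders
  strictly above \<open>l\<close> the borderline difficulty is absent, and the line
  \<open>Re z = 1\<close> already gives bounds in terms of the orders and the norm; these supply the
  uniformity in Montel's theorem. Completeness is then deduced from Montel's theorem.\<close>

lemma contour_integral_primitive_linepath:
  assumes "\<And>z. z \<in> S \<Longrightarrow> (g has_field_derivative f z) (at z)" "closed_segment a b \<subseteq> S"
  shows "(f has_contour_integral (g b - g a)) (linepath a b)"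
proof -
  have "(f has_contour_integral (g (pathfinish (linepath a b)) - g (pathstart (linepath a b)))) (linepath a b)"
    by (rule contour_integral_primitive[of S g f])
      (use assms in \<open>auto intro: has_field_derivative_at_within\<close>)
  then show ?thesis by simp
qed

text \<open>Asking for an antiderivative \<open>G\<close> of the majorant, rather than for the value
  of its integral, spares every later application a separate integration.\<close>

lemma vertical_integral_bound:
  fixes h :: "complex \<Rightarrow> complex"
  assumes "a \<le> b"
    and int: "h contour_integrable_on linepath (Complex c a) (Complex c b)"
    and bnd: "\<And>t. a \<le> t \<Longrightarrow> t \<le> b \<Longrightarrow> norm (h (Complex c t)) \<le> g t"
    and G: "\<And>t. a \<le> t \<Longrightarrow> t \<le> b \<Longrightarrow> (G has_real_derivative g t) (at t)"
  shows "norm (contour_integral (linepath (Complex c a) (Complex c b)) h) \<le> G b - G a"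
proof (cases "a = b")
  case True
  then show ?thesis by simp
next
  case False
  with assms have ab: "a < b" by simp
  define I where "I = contour_integral (linepath (Complex c a) (Complex c b)) h"
  have "(h has_contour_integral I) (linepath (Complex c a) (Complex c b))"
    using int I_def has_contour_integral_integral by blast
  then have 1: "((\<lambda>x. h (Complex c x)) has_integral (-\<i> * I)) {a..b}"
    by (subst (asm) has_contour_integral_linepath_same_Re_iff[of _ c _ a b]) (use ab in auto)
  have 2: "(g has_integral (G b - G a)) {a..b}"
    by (rule fundamental_theorem_of_calculus)
      (use assms in \<open>auto intro: has_field_derivative_at_within simp: has_real_derivative_iff_has_vector_derivative[symmetric]\<close>)
  have "norm (integral {a..b} (\<lambda>x. h (Complex c x))) \<le> integral {a..b} g"
    by (rule integral_norm_bound_integral) (use 1 2 bnd in \<open>auto intro: has_integral_integrable\<close>)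
  then have "norm (-\<i> * I) \<le> G b - G a"
    using 1 2 by (metis integral_unique)
  then show ?thesis by (simp add: I_def norm_mult)
qed

lemma vertical_integral_bound_sym:
  fixes h :: "complex \<Rightarrow> complex"
  assumes "0 \<le> a" "a \<le> b"
    and int: "h contour_integrable_on linepath (Complex c a) (Complex c b)"
             "h contour_integrable_on linepath (Complex c (-b)) (Complex c (-a))"
    and bnd: "\<And>t. a \<le> \<bar>t\<bar> \<Longrightarrow> \<bar>t\<bar> \<le> b \<Longrightarrow> norm (h (Complex c t)) \<le> g \<bar>t\<bar>"
    and G: "\<And>t. a \<le> t \<Longrightarrow> t \<le> b \<Longrightarrow> (G has_real_derivative g t) (at t)"
  shows "norm (contour_integral (linepath (Complex c a) (Complex c b)) h) \<le> G b - G a"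
    and "norm (contour_integral (linepath (Complex c (-b)) (Complex c (-a))) h) \<le> G b - G a"
proof -
  have "norm (h (Complex c t)) \<le> g t" if "a \<le> t" "t \<le> b" for t
    using bnd[of t] that \<open>0 \<le> a\<close> by simp
  then show "norm (contour_integral (linepath (Complex c a) (Complex c b)) h) \<le> G b - G a"
    by (intro vertical_integral_bound[where g = g]) (use assms in auto)
  have "((\<lambda>t. - G (- t)) has_real_derivative g (- t)) (at t)" if "-b \<le> t" "t \<le> -a" for t
  proof -
    have "(G has_real_derivative g (- t)) (at (- t))"
      using G[of "-t"] that by simp
    then have "((\<lambda>t. G (- t)) has_real_derivative g (- t) * (- 1)) (at t)"
      by (rule DERIV_chain2) (auto intro!: derivative_eq_intros)
    from DERIV_minus[OF this] show ?thesis by simp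
  qed
  moreover have "norm (h (Complex c t)) \<le> g (- t)" if "-b \<le> t" "t \<le> -a" for t
    using bnd[of t] that assms(1) by simp
  ultimately have "norm (contour_integral (linepath (Complex c (-b)) (Complex c (-a))) h)
     \<le> (\<lambda>t. - G (- t)) (-a) - (\<lambda>t. - G (- t)) (-b)"
    by (intro vertical_integral_bound[where g = "\<lambda>t. g (- t)"]) (use assms in auto)
  then show "norm (contour_integral (linepath (Complex c (-b)) (Complex c (-a))) h) \<le> G b - G a"
    by simp
qed

lemma contour_integral_linepath_scale:
  fixes r a b :: complex
  assumes "h contour_integrable_on linepath (r * a) (r * b)"
  shows "contour_integral (linepath (r * a) (r * b)) h
       = r * contour_integral (linepath a b) (\<lambda>z. h (r * z))"
proof -
  have lp: "linepath (r * a) (r * b) t = r * linepath a b t" for t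
    by (simp add: linepath_def algebra_simps)
  obtain i where i: "(h has_contour_integral i) (linepath (r * a) (r * b))"
    using assms contour_integrable_on_def by blast
  then have *: "((\<lambda>t. h (r * linepath a b t) * (r * b - r * a)) has_integral i) {0..1}"
    by (simp add: has_contour_integral_linepath lp)
  show ?thesis
  proof (cases "r = 0")
    case True
    then show ?thesis by simp
  next
    case False
    have "((\<lambda>t. (1 / r) * (h (r * linepath a b t) * (r * b - r * a))) has_integral ((1/r) * i)) {0..1}"
      using * by (rule has_integral_mult_right)
    then have "((\<lambda>t. h (r * linepath a b t) * (b - a)) has_integral ((1/r) * i)) {0..1}"
      by (rule has_integral_eq[rotated]) (use False in \<open>simp add: field_simps\<close>)
    then have "((\<lambda>z. h (r * z)) has_contour_integral ((1/r)*i)) (linepath a b)"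
      by (simp add: has_contour_integral_linepath)
    then show ?thesis
      using False i contour_integral_unique by fastforce
  qed
qed

lemma closed_segment_same_Re_subset:
  "closed_segment (Complex c a) (Complex c b) \<subseteq> {z. Re z = c \<and> min a b \<le> Im z \<and> Im z \<le> max a b}"
  by (auto simp: closed_segment_same_Re closed_segment_eq_real_ivl split: if_splits)

lemma closed_segment_same_Im_subset:
  "closed_segment (Complex a t) (Complex b t) \<subseteq> {z. Im z = t \<and> min a b \<le> Re z \<and> Re z \<le> max a b}"
  by (auto simp: closed_segment_same_Im closed_segment_eq_real_ivl split: if_splits)

section \<open>The Perron kernel\<close>

text \<open>The inverse Laplace transform of \<open>z powr (- 1 - k)\<close> is
  \<open>y powr k / Gamma (k + 1)\<close> for \<open>y > 0\<close> and \<open>0\<close> for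
  \<open>y < 0\<close>, which is how the Riesz weights \<open>(x - lam n) powr k\<close> arise. With
  the principal branch, the kernel is holomorphic off the nonpositive reals.\<close>

definition perron_fun :: "real \<Rightarrow> real \<Rightarrow> complex \<Rightarrow> complex" where
  "perron_fun k y z = exp (of_real y * z) * z powr of_real (- 1 - k)"

definition perron_int :: "real \<Rightarrow> real \<Rightarrow> real \<Rightarrow> real \<Rightarrow> complex" where
  "perron_int k y c T =
     contour_integral (linepath (Complex c (- T)) (Complex c T)) (perron_fun k y)"

lemma perron_fun_holomorphic:
  assumes "S \<inter> \<real>\<^sub>\<le>\<^sub>0 = {}"
  shows "perron_fun k y holomorphic_on S"
  unfolding perron_fun_def using assms by (auto intro!: holomorphic_intros)

lemma Re_pos_nonpos_Reals: "Re z > 0 \<Longrightarrow> z \<notin> \<real>\<^sub>\<le>\<^sub>0"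
  by (auto simp: complex_nonpos_Reals_iff)

lemma norm_perron_fun:
  "norm (perron_fun k y z) = exp (y * Re z) * norm z powr (- 1 - k)"
proof -
  have "complex_of_real (- 1 - k) \<in> \<real>" by (rule Reals_of_real)
  from norm_powr_real_powr'[OF this, of z] show ?thesis
    unfolding perron_fun_def by (simp add: norm_mult)
qed

text \<open>A single primitive on the right half-plane turns each contour shift there into a
  cancellation of values of \<open>g\<close>, with no closed paths or winding numbers.\<close>

lemma perron_fun_primitive:
  obtains g where "\<And>z. Re z > 0 \<Longrightarrow> (g has_field_derivative perron_fun k y z) (at z)"
proof -
  define S where "S = {z::complex. Re z > 0}"
  have S: "open S" "convex S"
    by (simp_all add: S_def open_halfspace_Re_gt convex_halfspace_Re_gt)
  have "perron_fun k y holomorphic_on S"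
    by (rule perron_fun_holomorphic) (auto simp: S_def dest: Re_pos_nonpos_Reals)
  from holomorphic_convex_primitive'[OF S(2,1) this] obtain g
    where "\<And>x. x \<in> S \<Longrightarrow> (g has_field_derivative perron_fun k y x) (at x within S)"
    by blast
  then show ?thesis
    by (intro that[of g]) (metis S(1) S_def at_within_open mem_Collect_eq)
qed

lemma perron_fun_integral_primitive:
  assumes "\<And>z. Re z > 0 \<Longrightarrow> (g has_field_derivative perron_fun k y z) (at z)"
    and "Re a > 0" "Re b > 0"
  shows "(perron_fun k y has_contour_integral (g b - g a)) (linepath a b)"
proof -
  have "closed_segment a b \<subseteq> {z. Re z > 0}"
    by (rule closed_segment_subset) (use assms in \<open>auto simp: convex_halfspace_Re_gt\<close>)
  from contour_integral_primitive_linepath[OF _ this] assms(1) show ?thesis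
    by blast
qed

lemma perron_fun_integrable [intro]:
  assumes "Re a > 0" "Re b > 0"
  shows "perron_fun k y contour_integrable_on (linepath a b)"
proof -
  obtain g where "\<And>z. Re z > 0 \<Longrightarrow> (g has_field_derivative perron_fun k y z) (at z)"
    using perron_fun_primitive by blast
  from perron_fun_integral_primitive[OF this assms] show ?thesis
    by (auto simp: contour_integrable_on_def)
qed

lemma DERIV_powr_antiderivative:
  fixes c t k B :: real
  assumes "c + t > 0" "k \<noteq> 0"
  shows "((\<lambda>t. - B / k * (c + t) powr (- k)) has_real_derivative B * (c + t) powr (- 1 - k)) (at t)"
proof -
  have "((\<lambda>t. (c + t) powr (- k)) has_real_derivative - k * (c + t) powr (- k - 1)) (at t)"
    using DERIV_fun_powr[of "\<lambda>t. c + t" 1 t "- k"] assms by (auto intro!: derivative_eq_intros)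
  from DERIV_cmult[OF this, of "- B / k"]
  have "((\<lambda>t. - B / k * (c + t) powr (- k)) has_real_derivative B * (c + t) powr (- k - 1)) (at t)"
    using assms by simp
  moreover have "- k - 1 = - 1 - k" by simp
  ultimately show ?thesis by metis
qed

text \<open>On \<open>Re z = c\<close> the kernel is at most
  \<open>exp (c * y) * \<bar>t\<bar> powr (- 1 - k)\<close>, integrable at infinity since
  \<open>k > 0\<close>; each of the two tails contributes \<open>T powr (- k) / k\<close>.\<close>

lemma perron_int_tail:
  assumes "k > 0" "c > 0" "0 < T" "T \<le> T'"
  shows "norm (perron_int k y c T' - perron_int k y c T) \<le> 2 / k * exp (c * y) * T powr (- k)"
proof -
  obtain g where g: "\<And>z. Re z > 0 \<Longrightarrow> (g has_field_derivative perron_fun k y z) (at z)"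
    using perron_fun_primitive by blast
  define G where "G = (\<lambda>t. - exp (c * y) / k * t powr (- k))"
  define gg where "gg = (\<lambda>t. exp (c * y) * t powr (- 1 - k))"
  have CI: "contour_integral (linepath (Complex c a) (Complex c b)) (perron_fun k y) = g (Complex c b) - g (Complex c a)" for a b
    by (rule contour_integral_unique, rule perron_fun_integral_primitive) (use g assms in auto)
  have der: "(G has_real_derivative gg t) (at t)" if "T \<le> t" for t
    unfolding G_def gg_def using that assms DERIV_powr_antiderivative[of 0 t k "exp (c * y)"] by simp
  have bnd: "norm (perron_fun k y (Complex c t)) \<le> gg \<bar>t\<bar>" if "T \<le> \<bar>t\<bar>" for t
  proof -
    have "norm (Complex c t) powr (-1-k) \<le> \<bar>t\<bar> powr (-1-k)"
      by (rule powr_mono2') (use that assms abs_Im_le_cmod[of "Complex c t"] in auto)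
    then show ?thesis
      by (simp add: norm_perron_fun gg_def mult.commute)
  qed
  have a: "norm (contour_integral (linepath (Complex c T) (Complex c T')) (perron_fun k y)) \<le> G T' - G T"
       "norm (contour_integral (linepath (Complex c (-T')) (Complex c (-T))) (perron_fun k y)) \<le> G T' - G T"
    by (rule vertical_integral_bound_sym[where g = gg]; use assms der bnd in auto)+
  have "perron_int k y c T' - perron_int k y c T =
     contour_integral (linepath (Complex c T) (Complex c T')) (perron_fun k y)
     + contour_integral (linepath (Complex c (-T')) (Complex c (-T))) (perron_fun k y)"
    unfolding perron_int_def CI by simp
  then have "norm (perron_int k y c T' - perron_int k y c T) \<le> (G T' - G T) + (G T' - G T)"
    using a norm_triangle_mono by metis
  also have "\<dots> \<le> -2 * G T"
    unfolding G_def using assms by (simp add: field_simps)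
  finally show ?thesis unfolding G_def by (simp add: field_simps)
qed

text \<open>The bound is uniform in \<open>T\<close>, and its factor \<open>c powr (- k)\<close> is
  what permits moving the abscissa to infinity. It comes from
  \<open>norm z \<ge> (c + \<bar>t\<bar>) / 2\<close>, which treats small and large heights
  alike.\<close>

lemma perron_int_bound:
  assumes "k > 0" "c > 0" "0 \<le> T"
  shows "norm (perron_int k y c T) \<le> 2 * 2 powr (1 + k) / k * exp (c * y) * c powr (- k)"
proof -
  obtain g where g: "\<And>z. Re z > 0 \<Longrightarrow> (g has_field_derivative perron_fun k y z) (at z)"
    using perron_fun_primitive by blast
  define B where "B = 2 powr (1 + k) * exp (c * y)"
  define G where "G = (\<lambda>t. - B / k * (c + t) powr (- k))"
  define gg where "gg = (\<lambda>t. B * (c + t) powr (- 1 - k))"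
  have CI: "contour_integral (linepath (Complex c a) (Complex c b)) (perron_fun k y) = g (Complex c b) - g (Complex c a)" for a b
    by (rule contour_integral_unique, rule perron_fun_integral_primitive) (use g assms in auto)
  have der: "(G has_real_derivative gg t) (at t)" if "0 \<le> t" for t
    unfolding G_def gg_def using that assms by (intro DERIV_powr_antiderivative) auto
  have bnd: "norm (perron_fun k y (Complex c t)) \<le> gg \<bar>t\<bar>" for t
  proof -
    have "(c + \<bar>t\<bar>) / 2 \<le> norm (Complex c t)"
      using assms abs_Im_le_cmod[of "Complex c t"] abs_Re_le_cmod[of "Complex c t"] by auto
    then have "norm (Complex c t) powr (-1-k) \<le> ((c + \<bar>t\<bar>) / 2) powr (-1-k)"
      by (intro powr_mono2') (use assms in auto)
    also have "\<dots> = 2 powr (1+k) * (c + \<bar>t\<bar>) powr (-1-k)"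
      using assms by (simp add: powr_divide powr_minus_divide[symmetric] field_simps powr_diff powr_minus powr_add)
    finally show ?thesis
      by (simp add: norm_perron_fun gg_def mult.commute B_def mult.left_commute)
  qed
  have a: "norm (contour_integral (linepath (Complex c 0) (Complex c T)) (perron_fun k y)) \<le> G T - G 0"
       "norm (contour_integral (linepath (Complex c (-T)) (Complex c (-0))) (perron_fun k y)) \<le> G T - G 0"
    by (rule vertical_integral_bound_sym[where g = gg]; use assms der bnd in auto)+
  have "perron_int k y c T =
     contour_integral (linepath (Complex c 0) (Complex c T)) (perron_fun k y)
     + contour_integral (linepath (Complex c (-T)) (Complex c (-0))) (perron_fun k y)"
    unfolding perron_int_def CI by simp
  then have "norm (perron_int k y c T) \<le> (G T - G 0) + (G T - G 0)"
    using a norm_triangle_mono by metis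
  also have "\<dots> \<le> - 2 * G 0"
  proof -
    have "0 \<le> B / k * (c + T) powr (- k)"
      using assms by (simp add: B_def)
    then show ?thesis by (simp add: G_def)
  qed
  also have "\<dots> = 2 * B / k * c powr (- k)"
    unfolding G_def by simp
  finally show ?thesis unfolding B_def by (simp add: mult.assoc)
qed

lemma perron_int_limit:
  assumes "k > 0" "c > 0"
  obtains j where "((\<lambda>T. perron_int k y c T) \<longlongrightarrow> j) at_top"
    "\<And>T. T > 0 \<Longrightarrow> norm (perron_int k y c T - j) \<le> 2 / k * exp (c * y) * T powr (- k)"
proof -
  define E where "E = (\<lambda>T. 2 / k * exp (c * y) * T powr (- k))"
  have E0: "(E \<longlongrightarrow> 0) at_top"
    unfolding E_def
    by (rule tendsto_mult_right_zero, rule tendsto_neg_powr, use assms in simp, rule filterlim_ident)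
  have E0': "(\<lambda>n. E (real (Suc n))) \<longlonglongrightarrow> 0"
    by (rule filterlim_compose[OF E0 filterlim_compose[OF filterlim_real_sequentially filterlim_Suc]])
  have Cau: "Cauchy (\<lambda>n. perron_int k y c (real (Suc n)))"
  proof (rule metric_CauchyI)
    fix e :: real assume "e > 0"
    from LIMSEQ_D[OF E0' this] obtain N where N: "\<And>n. n \<ge> N \<Longrightarrow> norm (E (real (Suc n))) < e" by auto
    have "dist (perron_int k y c (real (Suc m))) (perron_int k y c (real (Suc n))) < e" if "N \<le> n" "n \<le> m" for m n
    proof -
      have "norm (perron_int k y c (real (Suc m)) - perron_int k y c (real (Suc n))) \<le> E (real (Suc n))"
        unfolding E_def using that by (intro perron_int_tail) (use assms in auto)
      also have "\<dots> \<le> norm (E (real (Suc n)))" by simp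
      also have "\<dots> < e" using N that by simp
      finally show ?thesis by (simp add: dist_norm)
    qed
    then show "\<exists>M. \<forall>m\<ge>M. \<forall>n\<ge>M. dist (perron_int k y c (real (Suc m))) (perron_int k y c (real (Suc n))) < e"
      by (metis dist_commute linorder_le_cases)
  qed
  then obtain j where j: "(\<lambda>n. perron_int k y c (real (Suc n))) \<longlonglongrightarrow> j"
    using Cauchy_convergent convergent_def by blast
  have bd: "norm (perron_int k y c T - j) \<le> E T" if "T > 0" for T
  proof -
    have "(\<lambda>n. norm (perron_int k y c T - perron_int k y c (real (Suc n)))) \<longlonglongrightarrow> norm (perron_int k y c T - j)"
      using j by (intro tendsto_intros)
    moreover have "\<forall>\<^sub>F n in sequentially. norm (perron_int k y c T - perron_int k y c (real (Suc n))) \<le> E T"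
    proof -
      have "\<forall>\<^sub>F n in sequentially. T \<le> real (Suc n)"
        by (rule eventually_sequentiallyI[of "nat \<lceil>T\<rceil>"]) linarith
      then show ?thesis
      proof eventually_elim
        case (elim n)
        show ?case
          unfolding E_def using perron_int_tail[OF assms that elim, of y]
          by (simp only: norm_minus_commute)
      qed
    qed
    ultimately show ?thesis by (rule tendsto_upperbound) simp
  qed
  have "((\<lambda>T. perron_int k y c T - j) \<longlongrightarrow> 0) at_top"
    by (rule Lim_null_comparison[OF eventually_mono[OF eventually_gt_at_top[of 0] bd] E0])
  then have "((\<lambda>T. perron_int k y c T) \<longlongrightarrow> j) at_top"
    by (simp add: LIM_zero_iff)
  then show ?thesis using that bd unfolding E_def by blast
qed

text \<open>The two truncated integrals differ by the horizontal sides at heights \<open>T\<close>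
  and \<open>- T\<close>, of fixed length, where the kernel is
  \<open>O(T powr (- 1 - k))\<close>.\<close>

lemma perron_int_change_abscissa:
  assumes "k > 0" "c > 0" "c' > 0"
  shows "((\<lambda>T. perron_int k y c' T - perron_int k y c T) \<longlongrightarrow> 0) at_top"
proof -
  obtain g where g: "\<And>z. Re z > 0 \<Longrightarrow> (g has_field_derivative perron_fun k y z) (at z)"
    using perron_fun_primitive by blast
  have CI: "contour_integral (linepath a b) (perron_fun k y) = g b - g a" if "Re a > 0" "Re b > 0" for a b
    by (rule contour_integral_unique, rule perron_fun_integral_primitive) (use g that in auto)
  define B where "B = (\<lambda>T. exp (\<bar>y\<bar> * (c + c')) * T powr (- 1 - k) * \<bar>c' - c\<bar>)"
  have bd: "norm (contour_integral (linepath (Complex c t) (Complex c' t)) (perron_fun k y)) \<le> B T"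
    if "\<bar>t\<bar> = T" "T > 0" for t T
  proof -
    have "norm (contour_integral (linepath (Complex c t) (Complex c' t)) (perron_fun k y))
      \<le> (exp (\<bar>y\<bar> * (c + c')) * T powr (- 1 - k)) * norm (Complex c' t - Complex c t)"
    proof (rule contour_integral_bound_linepath)
      fix z assume "z \<in> closed_segment (Complex c t) (Complex c' t)"
      then have z: "Im z = t" "min c c' \<le> Re z" "Re z \<le> max c c'"
        using closed_segment_same_Im_subset by blast+
      have "y * Re z \<le> \<bar>y\<bar> * (c + c')"
        using z assms by (intro mult_mono) auto
      moreover have "norm z powr (- 1 - k) \<le> T powr (- 1 - k)"
        using abs_Im_le_cmod[of z] z that assms by (intro powr_mono2') auto
      ultimately show "norm (perron_fun k y z) \<le> exp (\<bar>y\<bar> * (c + c')) * T powr (- 1 - k)"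
        unfolding norm_perron_fun by (intro mult_mono) auto
    qed (use assms in auto)
    also have "norm (Complex c' t - Complex c t) = \<bar>c' - c\<bar>"
      by (simp add: cmod_def)
    finally show ?thesis by (simp add: B_def)
  qed
  have eq: "perron_int k y c' T - perron_int k y c T =
      contour_integral (linepath (Complex c T) (Complex c' T)) (perron_fun k y)
      - contour_integral (linepath (Complex c (- T)) (Complex c' (- T))) (perron_fun k y)" for T
    unfolding perron_int_def by (simp add: CI assms)
  have le: "norm (perron_int k y c' T - perron_int k y c T) \<le> B T + B T" if "T > 0" for T
    unfolding eq by (rule order_trans[OF norm_triangle_ineq4 add_mono]; rule bd) (use that in auto)
  have P: "((\<lambda>T. T powr (- 1 - k)) \<longlongrightarrow> 0) at_top"
    by (rule tendsto_neg_powr, use assms in simp, rule filterlim_ident)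
  have "(B \<longlongrightarrow> 0) at_top"
    unfolding B_def by (rule tendsto_mult_left_zero, rule tendsto_mult_right_zero, rule P)
  then have "((\<lambda>T. B T + B T) \<longlongrightarrow> 0) at_top"
    using tendsto_add[of B 0 at_top B 0] by simp
  then show ?thesis
    by (rule Lim_null_comparison[OF eventually_mono[OF eventually_gt_at_top[of 0] le], rotated])
qed

definition perron_lim :: "real \<Rightarrow> real \<Rightarrow> complex" where
  "perron_lim k y = Lim at_top (perron_int k y 1)"

lemma perron_int_perron_lim:
  assumes "k > 0" "c > 0"
  shows "(perron_int k y c \<longlongrightarrow> perron_lim k y) at_top"
    and "T > 0 \<Longrightarrow> norm (perron_int k y c T - perron_lim k y) \<le> 2 / k * exp (c * y) * T powr (- k)"
proof -
  obtain j1 where j1: "(perron_int k y 1 \<longlongrightarrow> j1) at_top"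
    using perron_int_limit[OF assms(1), of 1 y] by auto
  then have [simp]: "perron_lim k y = j1"
    unfolding perron_lim_def by (intro tendsto_Lim) auto
  obtain j where j: "(perron_int k y c \<longlongrightarrow> j) at_top"
    "\<And>T. T > 0 \<Longrightarrow> norm (perron_int k y c T - j) \<le> 2 / k * exp (c * y) * T powr (- k)"
    using perron_int_limit[OF assms, of y] by blast
  have "((\<lambda>T. perron_int k y c T - perron_int k y 1 T) \<longlongrightarrow> 0) at_top"
    by (rule perron_int_change_abscissa) (use assms in auto)
  moreover have "((\<lambda>T. perron_int k y c T - perron_int k y 1 T) \<longlongrightarrow> j - j1) at_top"
    by (intro tendsto_diff j j1)
  ultimately have "j = j1"
    using tendsto_unique[OF trivial_limit_at_top_linorder] by fastforce
  then show "(perron_int k y c \<longlongrightarrow> perron_lim k y) at_top"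
    and "T > 0 \<Longrightarrow> norm (perron_int k y c T - perron_lim k y) \<le> 2 / k * exp (c * y) * T powr (- k)"
    using j by auto
qed

text \<open>For \<open>y \<le> 0\<close> the factor \<open>exp (c * y)\<close> stays bounded as the
  abscissa \<open>c\<close> tends to infinity, where \<open>c powr (- k)\<close> vanishes.\<close>

lemma perron_lim_nonpos:
  assumes "k > 0" "y \<le> 0"
  shows "perron_lim k y = 0"
proof -
  define C where "C = 2 * 2 powr (1 + k) / k"
  have "norm (perron_lim k y) \<le> C * c powr (- k)" if "c > 0" for c
  proof (rule tendsto_upperbound)
    show "((\<lambda>T. norm (perron_int k y c T)) \<longlongrightarrow> norm (perron_lim k y)) at_top"
      by (intro tendsto_norm perron_int_perron_lim assms that)
    have "norm (perron_int k y c T) \<le> C * c powr (- k)" if "T \<ge> 0" for T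
    proof -
      have "norm (perron_int k y c T) \<le> C * exp (c * y) * c powr (- k)"
        unfolding C_def by (rule perron_int_bound) (use assms that \<open>c > 0\<close> in auto)
      also have "\<dots> \<le> C * 1 * c powr (- k)"
        using assms \<open>c > 0\<close> unfolding C_def
        by (intro mult_right_mono mult_left_mono) (auto simp: mult_le_0_iff)
      finally show ?thesis by simp
    qed
    then show "\<forall>\<^sub>F T in at_top. norm (perron_int k y c T) \<le> C * c powr (- k)"
      by (rule eventually_mono[OF eventually_ge_at_top[of 0]])
  qed simp
  moreover have "((\<lambda>c. C * c powr (- k)) \<longlongrightarrow> 0) at_top"
    by (rule tendsto_mult_right_zero, rule tendsto_neg_powr, use assms in simp, rule filterlim_ident)
  ultimately have "norm (perron_lim k y) \<le> 0"
    by (intro tendsto_lowerbound[of "\<lambda>c. C * c powr (- k)" 0 at_top]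
          eventually_mono[OF eventually_gt_at_top[of 0]]) auto
  then show ?thesis by simp
qed

lemma perron_fun_scale:
  assumes "y > 0" "z \<noteq> 0"
  shows "perron_fun k 1 (of_real y * z) = of_real (y powr (- 1 - k)) * perron_fun k y z"
proof -
  have "(of_real y * z) powr of_real a = of_real (y powr a) * z powr of_real a" for a
  proof -
    have "of_real (y powr a) = exp (of_real a * of_real (ln y) :: complex)"
      using assms by (simp add: powr_def exp_of_real[symmetric])
    then show ?thesis
      using assms by (simp add: powr_def Ln_times_of_real Ln_of_real exp_add[symmetric] ring_distribs)
  qed
  from this[of "- 1 - k"] show ?thesis
    unfolding perron_fun_def by simp
qed

text \<open>The substitution \<open>z \<mapsto> y * z\<close> relates the kernel at \<open>y\<close>
  on \<open>Re z = 1\<close> to the kernel at \<open>1\<close> on \<open>Re z = y\<close>; the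
  change of abscissa does not affect the limit.\<close>

lemma perron_lim_pos:
  assumes "k > 0" "y > 0"
  shows "perron_lim k y = perron_lim k 1 * of_real (y powr k)"
proof -
  have eq: "perron_int k 1 y (y * T) = of_real (y powr (- k)) * perron_int k y 1 T" for T
  proof -
    have sc: "Complex y (y * t) = of_real y * Complex 1 t" for t by (simp add: complex_eq_iff)
    have cong: "contour_integral (linepath (Complex 1 (- T)) (Complex 1 T)) (\<lambda>z. perron_fun k 1 (of_real y * z))
        = contour_integral (linepath (Complex 1 (- T)) (Complex 1 T)) (\<lambda>z. of_real (y powr (- 1 - k)) * perron_fun k y z)"
    proof (rule contour_integral_cong)
      fix z assume "z \<in> path_image (linepath (Complex 1 (- T)) (Complex 1 T))"
      then have "Re z = 1" using closed_segment_same_Re_subset by fastforce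
      then have "z \<noteq> 0" by auto
      then show "perron_fun k 1 (of_real y * z) = of_real (y powr (- 1 - k)) * perron_fun k y z"
        using assms perron_fun_scale by blast
    qed simp
    have "perron_int k 1 y (y * T) = of_real y * contour_integral (linepath (Complex 1 (- T)) (Complex 1 T)) (\<lambda>z. perron_fun k 1 (of_real y * z))"
      unfolding perron_int_def mult_minus_right[symmetric] sc
      by (rule contour_integral_linepath_scale) (use assms in auto)
    also have "\<dots> = of_real y * (of_real (y powr (- 1 - k)) * perron_int k y 1 T)"
      unfolding cong perron_int_def by (subst contour_integral_lmul) auto
    also have "\<dots> = of_real (y * y powr (- 1 - k)) * perron_int k y 1 T"
      by simp
    also have "y * y powr (- 1 - k) = y powr (- k)"
      using assms by (simp add: powr_diff powr_minus field_simps)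
    finally show ?thesis .
  qed
  have "((\<lambda>T. perron_int k 1 y (y * T)) \<longlongrightarrow> perron_lim k 1) at_top"
    by (rule filterlim_compose[OF perron_int_perron_lim(1)])
       (use assms in \<open>auto intro!: filterlim_tendsto_pos_mult_at_top filterlim_ident\<close>)
  moreover have "((\<lambda>T. perron_int k 1 y (y * T)) \<longlongrightarrow> of_real (y powr (- k)) * perron_lim k y) at_top"
    unfolding eq by (intro tendsto_mult tendsto_const perron_int_perron_lim) (use assms in auto)
  ultimately have "perron_lim k 1 = of_real (y powr (- k)) * perron_lim k y"
    using tendsto_unique[OF trivial_limit_at_top_linorder] by fastforce
  then show ?thesis
    using assms by (simp add: powr_minus field_simps)
qed

lemma perron_lim_eq:
  assumes "k > 0"
  shows "perron_lim k y = perron_lim k 1 * of_real (max y 0 powr k)"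
  using perron_lim_nonpos[OF assms, of y] perron_lim_pos[OF assms, of y]
  by (cases "y > 0") auto

text \<open>
  The value is \<open>2 * pi * \<i> / Gamma (k + 1)\<close>, but only its nonvanishing matters. If it were \<open>0\<close>, integrating
  the kernel against \<open>exp (- 2 * y)\<close> over \<open>y > 0\<close> and exchanging the integrals would make the integral
  of \<open>z powr (-1 - k) / (z - 2)\<close> over \<open>Re z = 1\<close> vanish, contradicting Cauchy's formula at \<open>2\<close>.
\<close>

lemma perron_lim_1_nonzero:
  assumes k: "k > 0"
  shows "perron_lim k 1 \<noteq> 0"
proof
  assume "perron_lim k 1 = 0"
  then have zero: "perron_lim k y = 0" for y
    using perron_lim_eq[OF k, of y] by simp
  define q where "q = (\<lambda>z::complex. z powr of_real (- 1 - k) / (z - 2))"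
  have nq: "norm (q z) = norm z powr (- 1 - k) / norm (z - 2)" for z
    using norm_powr_real_powr'[OF Reals_of_real, of z "-1-k"] unfolding q_def norm_divide by simp
  \<comment> \<open>The left side is the modulus of the residue term at \<open>2\<close>; the right
    side collects the tails of the kernel, the truncation in \<open>y\<close> and the far sides of a
    rectangle, and tends to \<open>0\<close>.\<close>
  have bound: "2 * pi * 2 powr (- 1 - k) \<le> 2 / k * T powr (- k) * (2 * ln T) + 2 * T * exp (- (2 * ln T)) + 8 * T powr (- 1 - k)"
    if T: "T \<ge> 2" for T
  proof -
    \<comment> \<open>The cutoff in \<open>y\<close> must make \<open>2 * T * exp (- Y)\<close>
      vanish, against the length \<open>2 * T\<close> of the segment, and also
      \<open>Y * T powr (- k)\<close>; any multiple of \<open>ln T\<close> with factor above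
      \<open>1\<close> does both.\<close>
    define Y where "Y = 2 * ln T"
    have Y: "Y > 0" using T by (simp add: Y_def)
    define g where "g = linepath 0 (complex_of_real Y)"
    define h where "h = linepath (Complex 1 (- T)) (Complex 1 T)"
    define F where "F = (\<lambda>y z::complex. exp (y * (z - 2)) * z powr of_real (- 1 - k))"
    have h_img: "Re z = 1" if "z \<in> path_image h" for z
      using that closed_segment_same_Re_subset by (fastforce simp: h_def)
    have h_img': "z \<notin> \<real>\<^sub>\<le>\<^sub>0 \<and> z \<noteq> 2 \<and> 1 \<le> norm z \<and> 1 \<le> norm (z - 2)" if "z \<in> path_image h" for z
      using h_img[OF that] abs_Re_le_cmod[of z] abs_Re_le_cmod[of "z - 2"]
      by (auto simp: complex_nonpos_Reals_iff)
    have cq: "continuous_on (path_image h) q"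
      unfolding q_def by (intro continuous_intros) (use h_img' complex_nonpos_Reals_iff in fastforce)+
    have q_int: "q contour_integrable_on h"
      using cq unfolding h_def by (intro contour_integrable_continuous_linepath) auto
    have qe_int: "(\<lambda>z. exp (of_real Y * (z - 2)) * q z) contour_integrable_on h"
      using cq unfolding h_def
      by (intro contour_integrable_continuous_linepath continuous_intros) auto
    have swap: "contour_integral g (\<lambda>y. contour_integral h (F y)) = contour_integral h (\<lambda>z. contour_integral g (\<lambda>y. F y z))"
    proof (rule contour_integral_swap)
      have "continuous_on (path_image g \<times> path_image h) (\<lambda>p. exp (fst p * (snd p - 2)) * snd p powr of_real (- 1 - k))"
        by (intro continuous_intros) (use h_img' complex_nonpos_Reals_iff in fastforce)+
      then show "continuous_on (path_image g \<times> path_image h) (\<lambda>(y, z). F y z)"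
        by (simp add: F_def case_prod_unfold)
    qed (auto simp: g_def h_def)
    have "(\<lambda>z. contour_integral g (\<lambda>y. F y z)) z = exp (of_real Y * (z - 2)) * q z - q z"
      if "z \<in> path_image h" for z
    proof -
      have nz: "z - 2 \<noteq> 0" using h_img'[OF that] by simp
      define P where "P = (\<lambda>y. exp (y * (z - 2)) / (z - 2) * z powr of_real (- 1 - k))"
      have "((\<lambda>y. F y z) has_contour_integral (P (of_real Y) - P 0)) (linepath 0 (of_real Y))"
        by (rule contour_integral_primitive_linepath[of UNIV])
           (use nz in \<open>auto simp: P_def F_def intro!: derivative_eq_intros\<close>)
      then have "contour_integral g (\<lambda>y. F y z) = P (of_real Y) - P 0"
        unfolding g_def by (rule contour_integral_unique)
      then show ?thesis
        by (simp add: P_def q_def mult.commute)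
    qed
    then have "contour_integral g (\<lambda>y. contour_integral h (F y)) =
         contour_integral h (\<lambda>z. exp (of_real Y * (z - 2)) * q z - q z)"
      unfolding swap by (intro contour_integral_cong) auto
    also have "\<dots> = contour_integral h (\<lambda>z. exp (of_real Y * (z - 2)) * q z) - contour_integral h q"
      by (rule contour_integral_diff[OF qe_int q_int])
    finally have eq1: "contour_integral h q = contour_integral h (\<lambda>z. exp (of_real Y * (z - 2)) * q z)
        - contour_integral g (\<lambda>y. contour_integral h (F y))"
      by simp
    have b1: "norm (contour_integral h (\<lambda>z. exp (of_real Y * (z - 2)) * q z)) \<le> exp (- Y) * norm (Complex 1 T - Complex 1 (- T))"
      unfolding h_def
    proof (rule contour_integral_bound_linepath)
      fix z assume "z \<in> closed_segment (Complex 1 (- T)) (Complex 1 T)"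
      then have z: "z \<in> path_image h" by (simp add: h_def)
      have "norm z powr (- 1 - k) \<le> 1 powr (- 1 - k)"
        using h_img'[OF z] k by (intro powr_mono2') auto
      then have "norm (q z) \<le> 1 / 1"
        unfolding nq using h_img'[OF z] by (intro frac_le) auto
      then have "exp (- Y) * norm (q z) \<le> exp (- Y) * 1" by (intro mult_left_mono) auto
      then show "norm (exp (of_real Y * (z - 2)) * q z) \<le> exp (- Y)"
        using h_img[OF z] by (simp add: norm_mult)
    qed (use qe_int in \<open>auto simp: h_def\<close>)
    have b2: "norm (contour_integral g (\<lambda>y. contour_integral h (F y))) \<le> 2 / k * T powr (- k) * norm (of_real Y - 0 :: complex)"
    proof (cases "(\<lambda>y. contour_integral h (F y)) contour_integrable_on g")
      case True
      have e: "contour_integral h (F (of_real r)) = exp (- 2 * of_real r) * perron_int k r 1 T" for r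
      proof -
        have "F (of_real r) = (\<lambda>z. exp (- 2 * of_real r) * perron_fun k r z)"
          by (rule ext) (simp add: F_def perron_fun_def mult_exp_exp algebra_simps)
        then show ?thesis
          unfolding perron_int_def h_def by (simp add: contour_integral_lmul perron_fun_integrable)
      qed
      show ?thesis
        unfolding g_def
      proof (rule contour_integral_bound_linepath[OF True[unfolded g_def]])
        fix y assume "y \<in> closed_segment 0 (complex_of_real Y)"
        then obtain r where r: "y = of_real r" "0 \<le> r" "r \<le> Y"
          using Y by (auto simp: closed_segment_of_real[of 0, simplified] closed_segment_eq_real_ivl split: if_splits)
        \<comment> \<open>If all limits vanish, the truncated integral is nothing but a tail, of
          size \<open>exp r * T powr (- k)\<close>; the weight \<open>exp (- 2 * r)\<close>
          outweighs \<open>exp r\<close>.\<close>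
        have "norm (perron_int k r 1 T) \<le> 2 / k * exp (1 * r) * T powr (- k)"
          using perron_int_perron_lim(2)[OF k, of 1 T r] zero T by simp
        then have "exp (- 2 * r) * norm (perron_int k r 1 T) \<le> exp (- 2 * r) * (2 / k * exp (1 * r) * T powr (- k))"
          by (rule mult_left_mono) simp
        then have "norm (contour_integral h (F y)) \<le> exp (- 2 * r) * (2 / k * exp (1 * r) * T powr (- k))"
          unfolding r e norm_mult by simp
        also have "\<dots> = (exp (- 2 * r) * exp (1 * r)) * (2 / k * T powr (- k))"
          by (simp only: ac_simps)
        also have "exp (- 2 * r) * exp (1 * r) = exp (- r)"
          by (simp add: exp_add[symmetric])
        also have "exp (- r) * (2 / k * T powr (- k)) \<le> 1 * (2 / k * T powr (- k))"
          using r k by (intro mult_right_mono) auto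
        finally show "norm (contour_integral h (F y)) \<le> 2 / k * T powr (- k)" by simp
      qed (use k in auto)
    next
      case False
      \<comment> \<open>\<open>contour_integral\<close> is \<open>0\<close> on non-integrable functions, so continuity in \<open>y\<close> is not needed.\<close>
      then show ?thesis using k by (simp add: not_integrable_contour_integral)
    qed
    have n1: "norm (Complex 1 T - Complex 1 (- T)) = 2 * T"
      using T by (simp add: cmod_def real_sqrt_mult)
    have hq: "norm (contour_integral h q) \<le> exp (- Y) * (2 * T) + 2 / k * T powr (- k) * Y"
      unfolding eq1 using norm_triangle_ineq4 b1 b2 n1 Y
      by (smt (verit) norm_of_real diff_zero)
    \<comment> \<open>A rectangle around \<open>2\<close> whose left side is \<open>h\<close>
      reversed. On the other sides \<open>q\<close> is \<open>O(T powr (- 2 - k))\<close> and the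
      total length is \<open>4 * T\<close>; \<open>T \<ge> 2\<close> ensures
      \<open>T - 1 \<ge> T / 2\<close> on the right side.\<close>
    define a where "a = Complex 1 (- T)"
    define b where "b = Complex (1 + T) (- T)"
    define c where "c = Complex (1 + T) T"
    define d where "d = Complex 1 T"
    have rp: "rectpath a c = linepath a b +++ linepath b c +++ linepath c d +++ linepath d a"
      by (simp add: rectpath_def a_def b_def c_def d_def Let_def)
    have "path_image (rectpath a c) \<subseteq> {z. Re z > 0} - {2}"
    proof -
      have "path_image (rectpath a c) \<subseteq> cbox a c"
        by (rule path_image_rectpath_subset_cbox) (use T in \<open>auto simp: a_def c_def\<close>)
      moreover have "path_image (rectpath a c) \<inter> box a c = {}"
        by (rule path_image_rectpath_inter_box) (use T in \<open>auto simp: a_def c_def\<close>)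
      moreover have "2 \<in> box a c" using T by (auto simp: a_def c_def in_box_complex_iff)
      ultimately show ?thesis by (auto simp: a_def c_def in_cbox_complex_iff)
    qed
    then have "((\<lambda>w. w powr of_real (- 1 - k) / (w - 2)) has_contour_integral
         (2*pi * \<i> * winding_number (rectpath a c) 2 * 2 powr of_real (- 1 - k))) (rectpath a c)"
      by (intro Cauchy_integral_formula_convex_simple[of "{z. Re z > 0}"])
         (auto simp: convex_halfspace_Re_gt interior_open open_halfspace_Re_gt
            intro!: holomorphic_intros dest: Re_pos_nonpos_Reals)
    moreover have "winding_number (rectpath a c) 2 = 1"
      by (rule winding_number_rectpath) (use T in \<open>auto simp: a_def c_def in_box_complex_iff\<close>)
    ultimately have tot: "(q has_contour_integral (2*pi * \<i> * 2 powr of_real (- 1 - k))) (rectpath a c)"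
      by (simp add: q_def)
    have seg: "z \<noteq> 2 \<and> z \<notin> \<real>\<^sub>\<le>\<^sub>0 \<and> T \<le> norm z \<and> T / 2 \<le> norm (z - 2)"
      if "z \<in> closed_segment a b \<or> z \<in> closed_segment b c \<or> z \<in> closed_segment c d" for z
    proof -
      have "\<bar>Im z\<bar> = T \<and> 1 \<le> Re z \<or> Re z = 1 + T"
        using that T closed_segment_same_Re_subset[of "1 + T" "- T" T]
           closed_segment_same_Im_subset[of 1 "-T" "1 + T"] closed_segment_same_Im_subset[of "1 + T" T 1]
        unfolding a_def b_def c_def d_def by force
      then show ?thesis
        using T abs_Re_le_cmod[of z] abs_Im_le_cmod[of z] abs_Re_le_cmod[of "z - 2"] abs_Im_le_cmod[of "z - 2"]
        by (auto simp: complex_nonpos_Reals_iff)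
    qed
    have int: "q contour_integrable_on linepath a b" "q contour_integrable_on linepath b c"
       "q contour_integrable_on linepath c d"
    proof -
      have "continuous_on (- \<real>\<^sub>\<le>\<^sub>0 - {2}) q"
        unfolding q_def by (intro continuous_intros) (auto simp: complex_nonpos_Reals_iff)
      then have *: "q contour_integrable_on linepath u v" if "closed_segment u v \<subseteq> - \<real>\<^sub>\<le>\<^sub>0 - {2}" for u v
        using that by (intro contour_integrable_continuous_linepath) (rule continuous_on_subset)
      show "q contour_integrable_on linepath a b" "q contour_integrable_on linepath b c"
        "q contour_integrable_on linepath c d"
        by (rule *; use seg in blast)+
    qed
    have qb: "norm (q z) \<le> T powr (- 1 - k) / (T / 2)"
      if "z \<in> closed_segment a b \<or> z \<in> closed_segment b c \<or> z \<in> closed_segment c d" for z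
      unfolding nq using seg[OF that] T k by (intro frac_le powr_mono2') auto
    have intda: "q contour_integrable_on linepath d a"
      using q_int unfolding h_def a_def d_def
      by (metis contour_integrable_reversepath_eq reversepath_linepath valid_path_linepath)
    have "contour_integral (linepath d a) q = - contour_integral h q"
      unfolding h_def a_def d_def
      by (metis contour_integral_reversepath reversepath_linepath valid_path_linepath)
    moreover have "contour_integral (rectpath a c) q = contour_integral (linepath a b) q
       + contour_integral (linepath b c) q + contour_integral (linepath c d) q + contour_integral (linepath d a) q"
      unfolding rp using int intda by (simp add: contour_integrable_join)
    moreover have "contour_integral (rectpath a c) q = 2*pi * \<i> * 2 powr of_real (- 1 - k)"
      using tot by (rule contour_integral_unique)
    ultimately have "2*pi * \<i> * 2 powr of_real (- 1 - k) = contour_integral (linepath a b) q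
       + contour_integral (linepath b c) q + contour_integral (linepath c d) q - contour_integral h q"
      by simp
    then have "norm (2*pi * \<i> * 2 powr of_real (- 1 - k) :: complex) = norm (contour_integral (linepath a b) q
       + contour_integral (linepath b c) q + contour_integral (linepath c d) q - contour_integral h q)"
      by simp
    also have "\<dots> \<le> norm (contour_integral (linepath a b) q) + norm (contour_integral (linepath b c) q)
       + norm (contour_integral (linepath c d) q) + norm (contour_integral h q)"
      by (meson add_mono norm_triangle_ineq norm_triangle_ineq4 order_refl order_trans)
    also have "\<dots> \<le> T powr (- 1 - k) / (T / 2) * T + T powr (- 1 - k) / (T / 2) * (2 * T)
         + T powr (- 1 - k) / (T / 2) * T + norm (contour_integral h q)"
    proof -
      have "norm (b - a) = T" "norm (c - b) = 2 * T" "norm (d - c) = T"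
        using T by (simp_all add: a_def b_def c_def d_def cmod_def real_sqrt_mult)
      then show ?thesis
        using contour_integral_bound_linepath[OF int(1) _ qb] contour_integral_bound_linepath[OF int(2) _ qb]
          contour_integral_bound_linepath[OF int(3) _ qb] T by fastforce
    qed
    also have "norm (2*pi * \<i> * 2 powr of_real (- 1 - k) :: complex) = 2 * pi * 2 powr (- 1 - k)"
      using norm_powr_real_powr'[OF Reals_of_real, of 2 "-1-k"] by (simp add: norm_mult)
    finally show ?thesis
      using hq T by (simp add: Y_def mult_ac)
  qed
  have lim: "((\<lambda>T. 2 / k * T powr (- k) * (2 * ln T) + 2 * T * exp (- (2 * ln T)) + 8 * T powr (- 1 - k)) \<longlongrightarrow> 0) at_top"
  proof -
    have 1: "((\<lambda>T. T powr (- k) * ln T) \<longlongrightarrow> 0) at_top"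
      using k by real_asymp
    have 2: "((\<lambda>T::real. 2 * T * exp (- (2 * ln T))) \<longlongrightarrow> 0) at_top"
      by real_asymp
    have 3: "((\<lambda>T. T powr (- 1 - k)) \<longlongrightarrow> 0) at_top"
      by (rule tendsto_neg_powr[OF _ filterlim_ident]) (use k in simp)
    show ?thesis
      using tendsto_add[OF tendsto_add[OF tendsto_mult_right_zero[OF 1, of "4 / k"] 2] tendsto_mult_right_zero[OF 3, of 8]]
      by (simp add: field_simps)
  qed
  have "2 * pi * 2 powr (- 1 - k) \<le> 0"
    by (rule tendsto_lowerbound[OF lim eventually_mono[OF eventually_ge_at_top[of 2] bound]]) auto
  moreover have "2 * pi * 2 powr (- 1 - k) > 0" by simp
  ultimately show False by linarith
qed

section \<open>Dirichlet series over frequencies with large gaps\<close>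

lemma frequency_nonneg: "frequency lam \<Longrightarrow> 0 \<le> lam n"
  by (simp add: frequency_def)

lemma frequency_finite:
  assumes "frequency lam"
  shows "finite {n. lam n < x}"
proof -
  have "eventually (\<lambda>n. x \<le> lam n) sequentially"
    using assms by (simp add: frequency_def filterlim_at_top)
  then obtain N where "\<And>n. n \<ge> N \<Longrightarrow> x \<le> lam n"
    by (auto simp: eventually_sequentially)
  then have "{n. lam n < x} \<subseteq> {..<N}"
    by (metis (mono_tags) lessThan_iff mem_Collect_eq not_le subsetI)
  then show ?thesis by (rule finite_subset) simp
qed

text \<open>The O-condition speaks of large \<open>n\<close>; the finitely many remaining gaps are
  positive and are absorbed into the constant, so that later arguments can start at
  \<open>n = 0\<close>.\<close>

lemma gap_lower_bound:
  assumes "frequency lam" "\<beta> > 0" "(\<lambda>n. 1 / (lam (Suc n) - lam n)) \<in> O(\<lambda>n. exp (\<beta> * lam n))"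
  obtains c where "c > 0" "\<And>n. c * exp (- (\<beta> * lam n)) \<le> lam (Suc n) - lam n"
proof -
  have pos: "lam (Suc n) - lam n > 0" for n
    using assms(1) by (simp add: frequency_def strict_mono_Suc_iff)
  from assms(3) obtain C where C: "C > 0" "eventually (\<lambda>n. norm (1 / (lam (Suc n) - lam n)) \<le> C * norm (exp (\<beta> * lam n))) sequentially"
    by (rule landau_o.bigE)
  then obtain N where N: "\<And>n. n \<ge> N \<Longrightarrow> 1 / (lam (Suc n) - lam n) \<le> C * exp (\<beta> * lam n)"
    using less_imp_le[OF pos] by (auto simp: eventually_sequentially)
  define X where "X = insert (1 / C) ((\<lambda>n. (lam (Suc n) - lam n) * exp (\<beta> * lam n)) ` {..<N})"
  have X: "finite X" "X \<noteq> {}" by (auto simp: X_def)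
  have "Min X > 0"
    unfolding Min_gr_iff[OF X] using C pos by (auto simp: X_def)
  moreover have "Min X \<le> (lam (Suc n) - lam n) * exp (\<beta> * lam n)" for n
  proof (cases "n < N")
    case True
    then show ?thesis using X by (auto simp: X_def intro!: Min_le)
  next
    case False
    then have "1 / C \<le> (lam (Suc n) - lam n) * exp (\<beta> * lam n)"
      using N[of n] C pos[of n] by (simp add: field_simps)
    moreover have "Min X \<le> 1 / C" using X by (auto simp: X_def intro!: Min_le)
    ultimately show ?thesis by linarith
  qed
  ultimately show ?thesis
    by (intro that[of "Min X"]) (auto simp: exp_minus field_simps)
qed

text \<open>By \<open>exp y \<ge> 1 + y\<close> every gap raises
  \<open>exp (\<beta> * lam n)\<close> by at least \<open>\<beta> * c\<close>; the exponent
  \<open>2 * \<beta>\<close> squares this linear growth and makes the terms comparable to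
  \<open>1 / n ^ 2\<close>.\<close>

lemma summable_exp_frequency:
  assumes "frequency lam" "\<beta> > 0" "c > 0" "\<And>n. c * exp (- (\<beta> * lam n)) \<le> lam (Suc n) - lam n"
  shows "summable (\<lambda>n. exp (- (2 * \<beta> * lam n)))"
proof -
  define g where "g = (\<lambda>n. exp (\<beta> * lam n))"
  have step: "g n + \<beta> * c \<le> g (Suc n)" for n
  proof -
    have "g n * (\<beta> * (c * exp (- (\<beta> * lam n)))) \<le> g n * (\<beta> * (lam (Suc n) - lam n))"
      using assms by (intro mult_left_mono) (auto simp: g_def)
    also have "\<dots> \<le> g n * (exp (\<beta> * (lam (Suc n) - lam n)) - 1)"
    proof (rule mult_left_mono)
      show "\<beta> * (lam (Suc n) - lam n) \<le> exp (\<beta> * (lam (Suc n) - lam n)) - 1"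
        using exp_ge_add_one_self[of "\<beta> * (lam (Suc n) - lam n)"] by linarith
    qed (simp add: g_def)
    also have "\<dots> = g (Suc n) - g n"
      by (simp add: g_def right_diff_distrib exp_diff)
    also have "g n * (\<beta> * (c * exp (- (\<beta> * lam n)))) = \<beta> * c"
      by (simp add: g_def exp_minus)
    finally show ?thesis by simp
  qed
  have lin: "\<beta> * c * real n \<le> g n" for n
  proof (induction n)
    case 0
    then show ?case by (simp add: g_def)
  next
    case (Suc n)
    then show ?case using step[of n] by (simp add: algebra_simps)
  qed
  have "summable (\<lambda>n. inverse ((\<beta> * c)\<^sup>2) * inverse (real n ^ 2))"
    by (intro summable_mult inverse_power_summable) auto
  then show ?thesis
  proof (rule summable_comparison_test'[where N = 1])
    fix n :: nat assume n: "n \<ge> 1"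
    have "exp (- (2 * \<beta> * lam n)) = inverse (g n ^ 2)"
      by (simp add: g_def exp_minus exp_double[symmetric] mult.assoc)
    also have "\<dots> \<le> inverse ((\<beta> * c * real n) ^ 2)"
      using lin[of n] n assms by (intro le_imp_inverse_le power_mono) auto
    finally show "norm (exp (- (2 * \<beta> * lam n))) \<le> inverse ((\<beta> * c)\<^sup>2) * inverse (real n ^ 2)"
      by (simp add: power_mult_distrib)
  qed
qed

lemma riesz_weight_bounds:
  fixes lam x k :: real
  assumes "0 \<le> lam" "lam < x" "0 \<le> k"
  shows "0 \<le> (1 - lam / x) powr k" "(1 - lam / x) powr k \<le> 1"
  using assms by (auto intro!: powr_le1 simp: field_simps)

text \<open>Each weight tends to \<open>1\<close> and never exceeds \<open>1\<close>, so Tannery's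
  theorem applies. The index set depending on \<open>x\<close> is encoded by terms that vanish for
  \<open>lam n \<ge> x\<close>.\<close>

lemma riesz_mean_tendsto_suminf:
  assumes freq: "frequency lam" and k: "0 \<le> k"
    and sm: "summable (\<lambda>n. norm (a n) * exp (- (\<sigma> * lam n)))" and s: "\<sigma> \<le> Re s"
  shows "(riesz_mean lam k a s \<longlongrightarrow> (\<Sum>n. a n * exp (- (of_real (lam n) * s)))) at_top"
proof -
  define t where "t = (\<lambda>n x. if lam n < x then a n * exp (- (of_real (lam n) * s)) * of_real ((1 - lam n / x) powr k) else 0)"
  have "eventually (\<lambda>x. summable (\<lambda>n. norm (t n x))) at_top \<and>
        summable (\<lambda>n. norm (a n * exp (- (of_real (lam n) * s)))) \<and>
        ((\<lambda>x. suminf (\<lambda>n. t n x)) \<longlongrightarrow> suminf (\<lambda>n. a n * exp (- (of_real (lam n) * s)))) at_top"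
  proof (rule tannerys_theorem)
    show "(t n \<longlongrightarrow> a n * exp (- (of_real (lam n) * s))) at_top" for n
    proof -
      have "((\<lambda>x. lam n / x) \<longlongrightarrow> 0) at_top"
        by (rule tendsto_divide_0[OF tendsto_const]) (simp add: filterlim_at_top_imp_at_infinity filterlim_ident)
      then have "((\<lambda>x. 1 - lam n / x) \<longlongrightarrow> 1 - 0) at_top"
        by (intro tendsto_diff tendsto_const)
      then have "((\<lambda>x. (1 - lam n / x) powr k) \<longlongrightarrow> (1 - 0) powr k) at_top"
        by (intro tendsto_powr tendsto_const) auto
      then have "((\<lambda>x. a n * exp (- (of_real (lam n) * s)) * of_real ((1 - lam n / x) powr k)) \<longlongrightarrow>
           a n * exp (- (of_real (lam n) * s)) * of_real ((1 - 0) powr k)) at_top"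
        by (intro tendsto_mult tendsto_const tendsto_of_real)
      moreover have "eventually (\<lambda>x. t n x = a n * exp (- (of_real (lam n) * s)) * of_real ((1 - lam n / x) powr k)) at_top"
        using eventually_gt_at_top[of "lam n"] by eventually_elim (simp add: t_def)
      ultimately show ?thesis
        by (simp add: tendsto_cong)
    qed
    show "eventually (\<lambda>(n, x). norm (t n x) \<le> norm (a n) * exp (- (\<sigma> * lam n))) (at_top \<times>\<^sub>F at_top)"
    proof (rule always_eventually, clarify)
      fix n x
      show "norm (t n x) \<le> norm (a n) * exp (- (\<sigma> * lam n))"
      proof (cases "lam n < x")
        case True
        have "norm (t n x) = (norm (a n) * exp (- (lam n * Re s))) * (1 - lam n / x) powr k"
          using True by (simp add: t_def norm_mult)
        also have "\<dots> \<le> (norm (a n) * exp (- (lam n * Re s))) * 1"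
          using riesz_weight_bounds[OF frequency_nonneg[OF freq] True k] by (intro mult_left_mono) auto
        also have "\<dots> \<le> norm (a n) * exp (- (\<sigma> * lam n))"
          using mult_right_mono[OF s frequency_nonneg[OF freq, of n]]
          by (simp add: mult_left_mono mult.commute)
        finally show ?thesis .
      qed (simp add: t_def)
    qed
  qed (use sm in auto)
  moreover have "suminf (\<lambda>n. t n x) = riesz_mean lam k a s x" for x
  proof -
    have "suminf (\<lambda>n. t n x) = (\<Sum>n | lam n < x. t n x)"
      by (rule suminf_finite) (use frequency_finite[OF freq] in \<open>auto simp: t_def\<close>)
    then show ?thesis by (simp add: t_def riesz_mean_def)
  qed
  ultimately show ?thesis by simp
qed

section \<open>Finite differences and bounds for coefficients\<close>

lemma poly_difference:
  fixes c :: "nat \<Rightarrow> complex"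
  shows "\<exists>d. (\<forall>t::complex. (\<Sum>i\<le>Suc k. c i * (t + 1) ^ i) - (\<Sum>i\<le>Suc k. c i * t ^ i) = (\<Sum>i\<le>k. d i * t ^ i))
           \<and> d k = of_nat (Suc k) * c (Suc k)"
proof (induction k)
  case 0
  show ?case by (intro exI[of _ "\<lambda>_. c 1"]) (simp add: algebra_simps)
next
  case (Suc k)
  then obtain d where d: "\<And>t. (\<Sum>i\<le>Suc k. c i * (t + 1) ^ i) - (\<Sum>i\<le>Suc k. c i * t ^ i) = (\<Sum>i\<le>k. d i * t ^ i)"
    by blast
  define e where "e = (\<lambda>i. (if i \<le> k then d i else 0) + c (Suc (Suc k)) * of_nat (Suc (Suc k) choose i))"
  show ?case
  proof (intro exI[of _ e] conjI allI)
    fix t :: complex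
    have "(t + 1) ^ Suc (Suc k) = (\<Sum>i\<le>Suc (Suc k). of_nat (Suc (Suc k) choose i) * t ^ i)"
      by (simp only: binomial_ring[of t 1 "Suc (Suc k)"] power_one mult_1_right)
    then have *: "(t + 1) ^ Suc (Suc k) - t ^ Suc (Suc k) = (\<Sum>i\<le>Suc k. of_nat (Suc (Suc k) choose i) * t ^ i)"
      by (simp only: sum.atMost_Suc[of _ "Suc k"]) simp
    have "(\<Sum>i\<le>Suc (Suc k). c i * (t + 1) ^ i) - (\<Sum>i\<le>Suc (Suc k). c i * t ^ i)
       = (\<Sum>i\<le>k. d i * t ^ i) + c (Suc (Suc k)) * ((t + 1) ^ Suc (Suc k) - t ^ Suc (Suc k))"
      unfolding d[symmetric] sum.atMost_Suc[of _ "Suc k"] by (simp only: algebra_simps)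
    also have "(\<Sum>i\<le>k. d i * t ^ i) = (\<Sum>i\<le>Suc k. (if i \<le> k then d i else 0) * t ^ i)"
      by simp
    finally show "(\<Sum>i\<le>Suc (Suc k). c i * (t + 1) ^ i) - (\<Sum>i\<le>Suc (Suc k). c i * t ^ i) = (\<Sum>i\<le>Suc k. e i * t ^ i)"
      unfolding * e_def ring_distribs sum.distrib sum_distrib_left by (simp only: mult.assoc)
  next
    show "e (Suc k) = of_nat (Suc (Suc k)) * c (Suc (Suc k))"
      by (simp add: e_def)
  qed
qed

text \<open>Each forward difference lowers the degree by one, at most doubles the bound on the
  sampled values, and multiplies the leading coefficient by the degree; the resulting factorial is
  estimated from below by \<open>1\<close>.\<close>

lemma lead_coeff_bound:
  fixes c :: "nat \<Rightarrow> complex"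
  assumes "\<And>j. j \<le> k \<Longrightarrow> norm (\<Sum>i\<le>k. c i * of_nat j ^ i) \<le> M"
  shows "norm (c k) \<le> 2 ^ k * M"
  using assms
proof (induction k arbitrary: c M)
  case 0
  then show ?case by simp
next
  case (Suc k)
  obtain d where d: "\<And>t. (\<Sum>i\<le>Suc k. c i * (t + 1) ^ i) - (\<Sum>i\<le>Suc k. c i * t ^ i) = (\<Sum>i\<le>k. d i * t ^ i)"
    and dk: "d k = of_nat (Suc k) * c (Suc k)"
    using poly_difference[of c k] by blast
  have "norm (d k) \<le> 2 ^ k * (2 * M)"
  proof (rule Suc.IH)
    fix j assume "j \<le> k"
    then have *: "norm (\<Sum>i\<le>Suc k. c i * of_nat (Suc j) ^ i) \<le> M" "norm (\<Sum>i\<le>Suc k. c i * of_nat j ^ i) \<le> M"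
      using Suc.prems[of "Suc j"] Suc.prems[of j] by simp_all
    have "(\<Sum>i\<le>k. d i * of_nat j ^ i) = (\<Sum>i\<le>Suc k. c i * of_nat (Suc j) ^ i) - (\<Sum>i\<le>Suc k. c i * of_nat j ^ i)"
      unfolding d[symmetric] by (simp only: of_nat_Suc add.commute)
    then show "norm (\<Sum>i\<le>k. d i * of_nat j ^ i) \<le> 2 * M"
      using order_trans[OF norm_triangle_ineq4 add_mono[OF *]] by simp
  qed
  moreover have "1 * norm (c (Suc k)) \<le> real (Suc k) * norm (c (Suc k))"
    by (rule mult_right_mono) auto
  ultimately show ?case by (simp add: dk norm_mult del: of_nat_Suc)
qed

text \<open>A Riesz mean without its normalisation by \<open>x powr k\<close> and with the point
  \<open>s\<close> absorbed into the coefficients. In this form it is a polynomial on each gap for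
  integer \<open>k\<close>, and it is what Perron's formula yields directly.\<close>

definition riesz_sum :: "(nat \<Rightarrow> real) \<Rightarrow> real \<Rightarrow> (nat \<Rightarrow> complex) \<Rightarrow> real \<Rightarrow> complex" where
  "riesz_sum lam k a x = (\<Sum>n | lam n < x. a n * of_real ((x - lam n) powr k))"

lemma riesz_sum_eq_riesz_mean:
  assumes "x > 0"
  shows "riesz_sum lam k (\<lambda>n. a n * exp (- (of_real (lam n) * s))) x = of_real (x powr k) * riesz_mean lam k a s x"
  unfolding riesz_sum_def riesz_mean_def sum_distrib_left
proof (rule sum.cong[OF refl])
  fix n assume "n \<in> {n. lam n < x}"
  moreover have "x - lam n = x * (1 - lam n / x)"
    using assms by (simp add: field_simps)
  ultimately have "(x - lam n) powr k = x powr k * (1 - lam n / x) powr k"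
    using assms powr_mult[of x "1 - lam n / x" k] by simp
  then show "a n * exp (- (of_real (lam n) * s)) * of_real ((x - lam n) powr k) =
    of_real (x powr k) * (a n * exp (- (of_real (lam n) * s)) * of_real ((1 - lam n / x) powr k))"
    by simp
qed

text \<open>The nodes lie in the gap from \<open>lam n\<close> (excluded) to
  \<open>lam (Suc n)\<close> (allowed, as the Riesz sum has a strict inequality), where the index
  set is \<open>{..n}\<close> throughout; the binomial theorem then gives a polynomial in
  \<open>j\<close>.\<close>

lemma riesz_sum_nat_expand:
  assumes "strict_mono lam" "lam n < y" "y + of_nat j * h \<le> lam (Suc n)" "h \<ge> 0"
  shows "riesz_sum lam (real k) a (y + of_nat j * h) =
     (\<Sum>i\<le>k. (\<Sum>m\<le>n. a m * of_nat (k choose i) * of_real h ^ i * of_real (y - lam m) ^ (k - i)) * of_nat j ^ i)"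
proof -
  have le: "lam m \<le> lam n" if "m \<le> n" for m
    using assms(1) that by (simp add: strict_mono_less_eq)
  have yj: "y \<le> y + of_nat j * h" using assms by simp
  have "{m. lam m < y + of_nat j * h} = {..n}"
  proof (intro set_eqI iffI; simp)
    fix m assume "lam m < y + real j * h"
    then have "lam m < lam (Suc n)" using assms by simp
    then show "m \<le> n" using assms(1) by (simp add: strict_mono_less)
  next
    fix m assume "m \<le> n"
    then show "lam m < y + real j * h" using le[of m] assms yj by linarith
  qed
  then have "riesz_sum lam (real k) a (y + of_nat j * h) = (\<Sum>m\<le>n. a m * of_real ((y + of_nat j * h - lam m) powr real k))"
    by (simp add: riesz_sum_def)
  also have "\<dots> = (\<Sum>m\<le>n. a m * (\<Sum>i\<le>k. of_nat (k choose i) * of_real h ^ i * of_real (y - lam m) ^ (k - i) * of_nat j ^ i))"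
  proof (intro sum.cong refl arg_cong2[of _ _ _ _ "(*)"])
    fix m assume "m \<in> {..n}"
    then have "lam m < y + of_nat j * h" using le[of m] assms(2) yj by fastforce
    then have "of_real ((y + of_nat j * h - lam m) powr real k) = (of_real (of_nat j * h + (y - lam m)) :: complex) ^ k"
      by (simp add: powr_realpow algebra_simps)
    also have "\<dots> = (of_nat j * of_real h + of_real (y - lam m)) ^ k"
      by simp
    also have "\<dots> = (\<Sum>i\<le>k. of_nat (k choose i) * of_real h ^ i * of_real (y - lam m) ^ (k - i) * of_nat j ^ i)"
      unfolding binomial_ring power_mult_distrib by (intro sum.cong) (auto simp only: ac_simps)
    finally show "of_real ((y + of_nat j * h - lam m) powr real k) = \<dots>" .
  qed
  also have "\<dots> = (\<Sum>i\<le>k. (\<Sum>m\<le>n. a m * of_nat (k choose i) * of_real h ^ i * of_real (y - lam m) ^ (k - i)) * of_nat j ^ i)"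
    unfolding sum_distrib_left sum_distrib_right by (subst sum.swap) (simp only: mult.assoc)
  finally show ?thesis .
qed

text \<open>
  Between \<open>lam n\<close> and \<open>lam (Suc n)\<close> the Riesz sum of integer order \<open>k\<close> is a polynomial in \<open>x\<close> with leading
  coefficient \<open>\<Sum>m\<le>n. a m\<close>, which \<open>k\<close>-th differences recover from \<open>k + 1\<close> values in that gap.
\<close>

lemma coeff_bound_of_riesz_sum_bound:
  assumes freq: "frequency lam" and \<beta>: "\<beta> > 0" and c: "c > 0"
    and gap: "\<And>n. c * exp (- (\<beta> * lam n)) \<le> lam (Suc n) - lam n" and B: "B \<ge> 0"
  shows "\<exists>C B'. C > 0 \<and> (\<forall>a M. (\<forall>x\<ge>0. norm (riesz_sum lam (real k) a x) \<le> M * exp (B * x)) \<longrightarrow>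
           (\<forall>n. norm (a n) \<le> C * M * exp (B' * lam n)))"
proof -
  have mono: "strict_mono lam" using freq by (simp add: frequency_def)
  \<comment> \<open>\<open>c' \<le> 1\<close> keeps all nodes within distance \<open>1\<close> of
    \<open>lam n\<close>, so that the exponential bound costs no more than
    \<open>exp B\<close>.\<close>
  define c' where "c' = min 1 c"
  have c': "c' > 0" "c' \<le> 1" "c' \<le> c" using c by (auto simp: c'_def)
  \<comment> \<open>\<open>2 ^ k\<close> comes from the differences, \<open>exp B\<close> from the
    window of length \<open>1\<close>, and the last factor, with \<open>real k * \<beta>\<close> in
    \<open>B'\<close>, from dividing by \<open>h ^ k\<close>.\<close>
  define K where "K = 2 ^ k * exp B * (real (k + 1) / c') ^ k"
  define B' where "B' = B + real k * \<beta>"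
  have K: "K > 0" using c' by (simp add: K_def)
  have B': "B' \<ge> 0" using B \<beta> by (simp add: B'_def)
  have part: "norm (\<Sum>m\<le>n. a m) \<le> K * M * exp (B' * lam n)"
    if bd: "\<forall>x\<ge>0. norm (riesz_sum lam (real k) a x) \<le> M * exp (B * x)" for a M n
  proof -
    have "M * exp (B * 0) \<ge> 0"
      using bd norm_ge_zero order_trans by blast
    then have M: "M \<ge> 0" by simp
    have ln: "0 \<le> lam n" by (rule frequency_nonneg[OF freq])
    \<comment> \<open>The \<open>k + 1\<close> nodes run from \<open>lam n + h\<close> to
      \<open>lam n + (k + 1) * h\<close>, which is still in the gap; they start to the right of
      \<open>lam n\<close> so that the term \<open>n\<close> is counted.\<close>
    define h where "h = c' * exp (- (\<beta> * lam n)) / real (k + 1)"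
    have h: "h > 0" using c' by (simp add: h_def)
    have hk: "real (k + 1) * h \<le> lam (Suc n) - lam n" "real (k + 1) * h \<le> 1"
    proof -
      have "real (k + 1) * h = c' * exp (- (\<beta> * lam n))" by (simp add: h_def)
      moreover have "\<dots> \<le> c * exp (- (\<beta> * lam n))" using c' by (intro mult_right_mono) auto
      moreover have "c' * exp (- (\<beta> * lam n)) \<le> 1 * 1" using c' \<beta> ln by (intro mult_mono) auto
      ultimately show "real (k + 1) * h \<le> lam (Suc n) - lam n" "real (k + 1) * h \<le> 1"
        using gap[of n] by linarith+
    qed
    define y where "y = lam n + h"
    define d where "d = (\<lambda>i. \<Sum>m\<le>n. a m * of_nat (k choose i) * of_real h ^ i * of_real (y - lam m) ^ (k - i))"
    have "norm (d k) \<le> 2 ^ k * (M * (exp B * exp (B * lam n)))"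
    proof (rule lead_coeff_bound)
      fix j assume j: "j \<le> k"
      have jh: "real j * h + h \<le> real (k + 1) * h"
        using j h by (simp add: distrib_right mult_right_mono)
      have "(\<Sum>i\<le>k. d i * of_nat j ^ i) = riesz_sum lam (real k) a (y + of_nat j * h)"
        unfolding d_def by (rule riesz_sum_nat_expand[symmetric]) (use mono h jh hk in \<open>auto simp: y_def\<close>)
      also have "norm \<dots> \<le> M * exp (B * (y + of_nat j * h))"
        using bd ln h by (simp add: y_def)
      also have "\<dots> \<le> M * exp (B * (1 + lam n))"
        using M B jh hk by (intro mult_left_mono) (auto simp: y_def intro!: mult_left_mono)
      also have "\<dots> = M * (exp B * exp (B * lam n))"
        by (simp add: exp_add[symmetric] algebra_simps)
      finally show "norm (\<Sum>i\<le>k. d i * of_nat j ^ i) \<le> M * (exp B * exp (B * lam n))" .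
    qed
    moreover have "d k = of_real (h ^ k) * (\<Sum>m\<le>n. a m)"
      by (simp add: d_def sum_distrib_right mult.commute)
    ultimately have "h ^ k * norm (\<Sum>m\<le>n. a m) \<le> 2 ^ k * (M * (exp B * exp (B * lam n)))"
      using h by (simp add: norm_mult norm_power)
    then have "norm (\<Sum>m\<le>n. a m) \<le> 2 ^ k * (M * (exp B * exp (B * lam n))) * (1 / h) ^ k"
      using h by (simp add: field_simps power_divide)
    also have "1 / h = real (k + 1) / c' * exp (\<beta> * lam n)"
      using c' by (simp add: h_def exp_minus field_simps)
    also have "2 ^ k * (M * (exp B * exp (B * lam n))) * (real (k + 1) / c' * exp (\<beta> * lam n)) ^ k = K * M * (exp (B * lam n) * exp (real k * (\<beta> * lam n)))"
      unfolding power_mult_distrib K_def exp_of_nat_mult by (simp only: ac_simps)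
    also have "exp (B * lam n) * exp (real k * (\<beta> * lam n)) = exp (B' * lam n)"
      by (simp add: exp_add[symmetric] B'_def algebra_simps)
    finally show ?thesis .
  qed
  show ?thesis
  proof (rule exI[of _ "2 * K"], rule exI[of _ B'], intro conjI allI impI)
    fix a M n
    assume bd: "\<forall>x\<ge>0. norm (riesz_sum lam (real k) a x) \<le> M * exp (B * x)"
    have "M * exp (B * 0) \<ge> 0"
      using bd norm_ge_zero order_trans by blast
    then have M: "M \<ge> 0" by simp
    show "norm (a n) \<le> 2 * K * M * exp (B' * lam n)"
    proof (cases n)
      case 0
      then show ?thesis using part[OF bd, of 0] M K by (simp add: order_trans[OF _ mult_right_mono[of 1 2]] mult.assoc)
    next
      case (Suc p)
      have "a n = (\<Sum>m\<le>n. a m) - (\<Sum>m\<le>p. a m)" by (simp add: Suc)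
      then have "norm (a n) \<le> norm (\<Sum>m\<le>n. a m) + norm (\<Sum>m\<le>p. a m)"
        by (metis norm_triangle_ineq4)
      also have "\<dots> \<le> K * M * exp (B' * lam n) + K * M * exp (B' * lam p)"
        by (intro add_mono part[OF bd])
      also have "\<dots> \<le> K * M * exp (B' * lam n) + K * M * exp (B' * lam n)"
        using K M B' mono Suc by (intro add_mono mult_left_mono) (auto simp: strict_mono_less_eq intro!: mult_left_mono)
      finally show ?thesis by simp
    qed
  qed (use K in auto)
qed

section \<open>Raising the order of Riesz sums, and absolute convergence far to the right\<close>

lemma Beta_real_pos: "Beta a b > 0" if "a > 0" "b > 0" for a b :: real
  using that by (simp add: Beta_def)

lemma riesz_kernel_integral:
  assumes "0 \<le> m" "0 \<le> p" "q < (x::real)"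
  shows "((\<lambda>t. (t - q) powr m * (x - t) powr p) has_integral ((x - q) powr (m + p + 1) * Beta (m + 1) (p + 1))) {q..x}"
proof -
  define d where "d = x - q"
  have d: "d > 0" using assms by (simp add: d_def)
  have "((\<lambda>t. t powr m * (1 - t) powr p) has_integral Beta (m + 1) (p + 1)) (cbox 0 1)"
    using has_integral_Beta_real[of "m + 1" "p + 1"] assms by simp
  moreover have "1 / d > 0" "(0 - - q / d) /\<^sub>R (1 / d) = q" "(1 - - q / d) /\<^sub>R (1 / d) = x"
    using d by (simp_all add: d_def field_simps)
  ultimately have "((\<lambda>t. (t / d - q / d) powr m * (1 - (t / d - q / d)) powr p) has_integral (Beta (m + 1) (p + 1) * d)) {q..x}"
    using has_integral_affinity'[of "\<lambda>t. t powr m * (1 - t) powr p" _ 0 1 "1 / d" "- q / d"] d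
    by (fastforce simp: mult.commute)
  from has_integral_mult_right[OF this, of "d powr (m + p)"]
  have "((\<lambda>t. d powr (m + p) * ((t / d - q / d) powr m * (1 - (t / d - q / d)) powr p)) has_integral (d powr (m + p) * (Beta (m + 1) (p + 1) * d))) {q..x}" .
  moreover have "d powr (m + p) * (Beta (m + 1) (p + 1) * d) = (x - q) powr (m + p + 1) * Beta (m + 1) (p + 1)"
    using d by (simp add: powr_add d_def[symmetric])
  moreover have "d powr (m + p) * ((t / d - q / d) powr m * (1 - (t / d - q / d)) powr p) = (t - q) powr m * (x - t) powr p"
    if "t \<in> {q..x}" for t
  proof -
    have 1: "t / d - q / d = (t - q) / d"
      by (simp add: diff_divide_distrib)
    moreover have "1 - (t - q) / d = (x - t) / d"
      using d by (simp add: diff_divide_eq_iff) (simp add: d_def)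
    ultimately have "t / d - q / d = (t - q) / d" "1 - (t / d - q / d) = (x - t) / d"
      by simp_all
    then show ?thesis using d that by (simp add: powr_divide powr_add)
  qed
  ultimately show ?thesis by (metis (no_types, lifting) has_integral_cong)
qed


text \<open>
  Fractional integration of order \<open>p + 1\<close>; it is used to pass to an integer order.
\<close>

lemma riesz_sum_bound_raise_order:
  assumes freq: "frequency lam" and mp: "0 \<le> m" "0 \<le> p" and K: "K \<ge> 0"
    and bd: "\<And>t. 0 \<le> t \<Longrightarrow> norm (riesz_sum lam m b t) \<le> K * (1 + t) powr m" and x: "0 \<le> x"
  shows "Beta (m + 1) (p + 1) * norm (riesz_sum lam (m + p + 1) b x) \<le> K * (1 + x) powr (m + p + 1)"
proof -
  define N where "N = {n. lam n < x}"
  have N: "finite N" unfolding N_def by (rule frequency_finite[OF freq])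
  define w where "w = (\<lambda>n t. if t \<in> {lam n..x} then (t - lam n) powr m * (x - t) powr p else 0)"
  have "((\<lambda>t. b n * of_real (w n t)) has_integral (b n * of_real ((x - lam n) powr (m + p + 1) * Beta (m + 1) (p + 1)))) {0..x}"
    if "n \<in> N" for n
  proof -
    have "(w n has_integral ((x - lam n) powr (m + p + 1) * Beta (m + 1) (p + 1))) {0..x}"
      unfolding w_def
      by (subst has_integral_restrict)
         (use riesz_kernel_integral[OF mp] that frequency_nonneg[OF freq] in \<open>auto simp: N_def\<close>)
    then show ?thesis
      by (intro has_integral_mult_right has_integral_of_real)
  qed
  then have 1: "((\<lambda>t. \<Sum>n\<in>N. b n * of_real (w n t)) has_integral
      (\<Sum>n\<in>N. b n * of_real ((x - lam n) powr (m + p + 1) * Beta (m + 1) (p + 1)))) {0..x}"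
    using N by (intro has_integral_sum) auto
  have 2: "(\<Sum>n\<in>N. b n * of_real ((x - lam n) powr (m + p + 1) * Beta (m + 1) (p + 1)))
      = of_real (Beta (m + 1) (p + 1)) * riesz_sum lam (m + p + 1) b x"
    by (simp add: riesz_sum_def N_def sum_distrib_left mult_ac)
  \<comment> \<open>At \<open>t = lam n\<close> the index sets differ, but the term vanishes because
    \<open>0 powr m = 0\<close> by the definition of \<open>powr\<close>, also for
    \<open>m = 0\<close>.\<close>
  have 3: "(\<Sum>n\<in>N. b n * of_real (w n t)) = riesz_sum lam m b t * of_real ((x - t) powr p)" if "t \<in> {0..x}" for t
  proof -
    have "(\<Sum>n\<in>N. b n * of_real (w n t)) = (\<Sum>n | lam n < t. b n * of_real (w n t))"
      by (rule sum.mono_neutral_right[OF N]) (use that in \<open>auto simp: N_def w_def\<close>)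
    also have "\<dots> = (\<Sum>n | lam n < t. b n * of_real ((t - lam n) powr m) * of_real ((x - t) powr p))"
      by (rule sum.cong) (use that in \<open>auto simp: w_def\<close>)
    finally show ?thesis by (simp add: riesz_sum_def sum_distrib_right)
  qed
  have int: "((\<lambda>t. riesz_sum lam m b t * of_real ((x - t) powr p)) has_integral
      (of_real (Beta (m + 1) (p + 1)) * riesz_sum lam (m + p + 1) b x)) (cbox 0 x)"
    using has_integral_eq[OF 3 1] unfolding 2 by simp
  have "norm (of_real (Beta (m + 1) (p + 1)) * riesz_sum lam (m + p + 1) b x)
      \<le> (K * (1 + x) powr m * (1 + x) powr p) * measure lborel (cbox 0 x)"
  proof (rule has_integral_bound[OF _ int])
    fix t assume t: "t \<in> cbox 0 x"
    have "norm (riesz_sum lam m b t) * (x - t) powr p \<le> (K * (1 + t) powr m) * (1 + x) powr p"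
      using t mp bd K by (intro mult_mono powr_mono2) auto
    also have "\<dots> \<le> (K * (1 + x) powr m) * (1 + x) powr p"
      using t mp K by (intro mult_mono powr_mono2) auto
    finally show "norm (riesz_sum lam m b t * of_real ((x - t) powr p)) \<le> K * (1 + x) powr m * (1 + x) powr p"
      by (simp add: norm_mult)
  qed (use K in auto)
  also have "\<dots> \<le> (K * (1 + x) powr m * (1 + x) powr p) * (1 + x)"
    using x K by (intro mult_left_mono) auto
  also have "\<dots> = K * (1 + x) powr (m + p + 1)"
    using x by (simp add: powr_add)
  finally show ?thesis
    using Beta_real_pos[of "m + 1" "p + 1"] mp by (simp add: norm_mult)
qed

text \<open>For large \<open>t\<close> convergence bounds the means; below a threshold the sums have
  finitely many terms. The weight \<open>(1 + t) powr m\<close> instead of \<open>t powr m\<close>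
  lets one \<open>K\<close> cover both ranges.\<close>

lemma riesz_sum_bound_of_tendsto:
  assumes freq: "frequency lam" and m: "0 \<le> m" and L: "(riesz_mean lam m a s \<longlongrightarrow> L) at_top"
  obtains K where "K \<ge> 0" "\<And>t. 0 \<le> t \<Longrightarrow>
    norm (riesz_sum lam m (\<lambda>n. a n * exp (- (of_real (lam n) * s))) t) \<le> K * (1 + t) powr m"
proof -
  define b where "b = (\<lambda>n. a n * exp (- (of_real (lam n) * s)))"
  have "eventually (\<lambda>x. norm (riesz_mean lam m a s x) < norm L + 1) at_top"
    by (rule order_tendstoD(2)[OF tendsto_norm[OF L]]) simp
  then obtain X where X: "\<And>x. x \<ge> X \<Longrightarrow> norm (riesz_mean lam m a s x) < norm L + 1"
    by (auto simp: eventually_at_top_linorder)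
  define Y where "Y = max X 1"
  have fin: "finite {n. lam n < Y}" by (rule frequency_finite[OF freq])
  define K where "K = norm L + 1 + (\<Sum>n | lam n < Y. norm (b n))"
  have S: "(\<Sum>n | lam n < Y. norm (b n)) \<ge> 0" by (intro sum_nonneg) auto
  have "norm (riesz_sum lam m b t) \<le> K * (1 + t) powr m" if t: "0 \<le> t" for t
  proof (cases "t \<ge> Y")
    case True
    then have "t > 0" by (simp add: Y_def)
    have "norm (riesz_sum lam m b t) = t powr m * norm (riesz_mean lam m a s t)"
      using riesz_sum_eq_riesz_mean[OF \<open>t > 0\<close>, of lam m a s] by (simp add: b_def norm_mult)
    also have "\<dots> \<le> (1 + t) powr m * K"
      using X[of t] True S t m by (intro mult_mono powr_mono2) (auto simp: Y_def K_def)
    finally show ?thesis by (simp add: mult.commute)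
  next
    case False
    have "norm (riesz_sum lam m b t) \<le> (\<Sum>n | lam n < t. norm (b n) * (1 + t) powr m)"
      unfolding riesz_sum_def
    proof (rule sum_norm_le)
      fix n assume "n \<in> {n. lam n < t}"
      then have "(t - lam n) powr m \<le> (1 + t) powr m"
        using frequency_nonneg[OF freq, of n] m by (intro powr_mono2) auto
      then show "norm (b n * of_real ((t - lam n) powr m)) \<le> norm (b n) * (1 + t) powr m"
        by (simp add: norm_mult mult_left_mono)
    qed
    also have "\<dots> \<le> (\<Sum>n | lam n < Y. norm (b n) * (1 + t) powr m)"
      by (rule sum_mono2[OF fin]) (use False in auto)
    also have "\<dots> \<le> K * (1 + t) powr m"
      unfolding sum_distrib_right[symmetric] K_def by (intro mult_right_mono) auto
    finally show ?thesis .
  qed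
  then show ?thesis using S by (intro that[of K]) (auto simp: K_def b_def)
qed

text \<open>Convergence at one point suffices. The order is raised to an integer because the
  difference argument needs Riesz sums that are polynomials on each gap; the polynomial growth of
  the sums is then weakened to \<open>exp (real k * x)\<close>.\<close>

lemma riesz_tendsto_abs_summable:
  assumes freq: "frequency lam" and \<beta>: "\<beta> > 0" and c: "c > 0"
    and gap: "\<And>n. c * exp (- (\<beta> * lam n)) \<le> lam (Suc n) - lam n"
    and m: "0 \<le> m" and L: "(riesz_mean lam m a s \<longlongrightarrow> L) at_top"
  shows "\<exists>\<sigma>. summable (\<lambda>n. norm (a n) * exp (- (\<sigma> * lam n)))"
proof -
  define b where "b = (\<lambda>n. a n * exp (- (of_real (lam n) * s)))"
  obtain K where K: "K \<ge> 0" "\<And>t. 0 \<le> t \<Longrightarrow> norm (riesz_sum lam m b t) \<le> K * (1 + t) powr m"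
    using riesz_sum_bound_of_tendsto[OF freq m L] unfolding b_def by metis
  \<comment> \<open>\<open>p\<close> is chosen so that \<open>m + p + 1\<close> is the integer
    \<open>k\<close>, one above the ceiling of \<open>m\<close>; this keeps \<open>p \<ge> 0\<close>
    also for integer \<open>m\<close>.\<close>
  define k where "k = Suc (nat \<lceil>m\<rceil>)"
  define p where "p = real (nat \<lceil>m\<rceil>) - m"
  have p: "p \<ge> 0" using m by (simp add: p_def)
  have mpk: "m + p + 1 = real k" by (simp add: k_def p_def)
  define Be where "Be = Beta (m + 1) (p + 1)"
  have Be: "Be > 0" unfolding Be_def using m p by (intro Beta_real_pos) auto
  have "norm (riesz_sum lam (real k) b x) \<le> (K / Be) * exp (real k * x)" if x: "0 \<le> x" for x
  proof -
    have "Be * norm (riesz_sum lam (real k) b x) \<le> K * (1 + x) powr real k"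
      using riesz_sum_bound_raise_order[OF freq m p K x] unfolding mpk Be_def .
    also have "(1 + x) powr real k \<le> exp x powr real k"
      using x by (intro powr_mono2) (auto simp: exp_ge_add_one_self)
    also have "exp x powr real k = exp (real k * x)"
      by (simp add: powr_def)
    finally have "Be * norm (riesz_sum lam (real k) b x) \<le> K * exp (real k * x)"
      using K by (simp add: mult_left_mono)
    then show ?thesis using Be by (simp add: field_simps)
  qed
  moreover obtain C B' where "\<forall>a M. (\<forall>x\<ge>0. norm (riesz_sum lam (real k) a x) \<le> M * exp (real k * x)) \<longrightarrow>
           (\<forall>n. norm (a n) \<le> C * M * exp (B' * lam n))"
    using coeff_bound_of_riesz_sum_bound[OF freq \<beta> c gap, of "real k" k] by auto
  ultimately have bn: "norm (b n) \<le> C * (K / Be) * exp (B' * lam n)" for n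
    by blast
  \<comment> \<open>\<open>Re s\<close> undoes the twist in \<open>b\<close>, \<open>B'\<close> the
    growth of its coefficients, and \<open>2 * \<beta>\<close> leaves the summable majorant.\<close>
  define \<sigma> where "\<sigma> = Re s + B' + 2 * \<beta>"
  have "summable (\<lambda>n. C * (K / Be) * exp (- (2 * \<beta> * lam n)))"
    by (intro summable_mult summable_exp_frequency[OF freq \<beta> c gap])
  then have "summable (\<lambda>n. norm (a n) * exp (- (\<sigma> * lam n)))"
  proof (rule summable_comparison_test'[where N = 0])
    fix n
    have "norm (a n) * exp (- (\<sigma> * lam n)) = norm (b n) * exp (- ((B' + 2 * \<beta>) * lam n))"
      by (simp add: b_def norm_mult \<sigma>_def mult.assoc exp_add[symmetric] algebra_simps)
    also have "\<dots> \<le> C * (K / Be) * exp (B' * lam n) * exp (- ((B' + 2 * \<beta>) * lam n))"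
      by (intro mult_right_mono bn) auto
    also have "\<dots> = C * (K / Be) * exp (- (2 * \<beta> * lam n))"
      by (simp add: mult.assoc exp_add[symmetric] algebra_simps)
    finally show "norm (norm (a n) * exp (- (\<sigma> * lam n))) \<le> C * (K / Be) * exp (- (2 * \<beta> * lam n))"
      by simp
  qed
  then show ?thesis by blast
qed

section \<open>Perron's formula and coefficient bounds\<close>

text \<open>Termwise integration, justified by uniform convergence on the truncated line. The factor
  \<open>exp (- lam n * z)\<close> moves the kernel parameter from \<open>x\<close> to
  \<open>x - lam n\<close>, so the error of the \<open>n\<close>-th term carries
  \<open>exp (- c * lam n)\<close> and the errors sum to a multiple of the absolute series.\<close>

lemma perron_dirichlet:
  assumes freq: "frequency lam" and k: "k > 0" and c: "c > 0" and T: "T > 0"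
    and sm: "summable (\<lambda>n. norm (b n) * exp (- (c * lam n)))"
    and F: "\<And>z. Re z = c \<Longrightarrow> F z = (\<Sum>n. b n * exp (- (of_real (lam n) * z)))"
  shows "norm (contour_integral (linepath (Complex c (- T)) (Complex c T)) (\<lambda>z. F z * perron_fun k x z)
            - perron_lim k 1 * riesz_sum lam k b x)
      \<le> 2 / k * (\<Sum>n. norm (b n) * exp (- (c * lam n))) * exp (c * x) * T powr (- k)"
proof -
  define \<gamma> where "\<gamma> = linepath (Complex c (- T)) (Complex c T)"
  define S where "S = (\<Sum>n. norm (b n) * exp (- (c * lam n)))"
  have img: "Re z = c" if "z \<in> path_image \<gamma>" for z
    using that closed_segment_same_Re_subset by (fastforce simp: \<gamma>_def)
  have shift: "b n * exp (- (of_real (lam n) * z)) * perron_fun k x z = b n * perron_fun k (x - lam n) z" for n z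
    by (simp add: perron_fun_def exp_diff exp_minus left_diff_distrib field_simps)
  have abs: "norm (b n * exp (- (of_real (lam n) * z))) = norm (b n) * exp (- (c * lam n))" if "Re z = c" for n z
    using that by (simp add: norm_mult mult.commute)
  have smz: "summable (\<lambda>n. b n * exp (- (of_real (lam n) * z)))" if "Re z = c" for z
    by (rule summable_norm_cancel) (simp only: abs[OF that] sm)
  have unif: "uniform_limit (path_image \<gamma>) (\<lambda>N z. \<Sum>n<N. b n * perron_fun k (x - lam n) z)
      (\<lambda>z. \<Sum>n. b n * perron_fun k (x - lam n) z) sequentially"
  proof (rule Weierstrass_m_test)
    show "summable (\<lambda>n. norm (b n) * exp (- (c * lam n)) * (exp (c * x) * c powr (- 1 - k)))"
      by (rule summable_mult2[OF sm])
    fix n z assume z: "z \<in> path_image \<gamma>"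
    have "norm (perron_fun k x z) \<le> exp (c * x) * c powr (- 1 - k)"
      unfolding norm_perron_fun using img[OF z] abs_Re_le_cmod[of z] c k
      by (intro mult_mono powr_mono2') (auto simp: mult.commute)
    then show "norm (b n * perron_fun k (x - lam n) z) \<le> norm (b n) * exp (- (c * lam n)) * (exp (c * x) * c powr (- 1 - k))"
      unfolding shift[symmetric] norm_mult[of "b n * _"] abs[OF img[OF z]] by (intro mult_left_mono) auto
  qed
  have int: "(\<lambda>z. \<Sum>n<N. b n * perron_fun k (x - lam n) z) contour_integrable_on \<gamma>" for N
    unfolding \<gamma>_def using c
    by (intro contour_integrable_sum contour_integrable_lmul perron_fun_integrable) auto
  have "(\<lambda>N. contour_integral \<gamma> (\<lambda>z. \<Sum>n<N. b n * perron_fun k (x - lam n) z))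
     \<longlonglongrightarrow> contour_integral \<gamma> (\<lambda>z. \<Sum>n. b n * perron_fun k (x - lam n) z)"
    by (rule contour_integral_uniform_limit(2)[OF always_eventually[OF allI[OF int]] unif, where B = "norm (Complex c T - Complex c (- T))"])
       (auto simp: \<gamma>_def)
  moreover have "contour_integral \<gamma> (\<lambda>z. \<Sum>n<N. b n * perron_fun k (x - lam n) z) = (\<Sum>n<N. b n * perron_int k (x - lam n) c T)" for N
    unfolding \<gamma>_def perron_int_def using c
    by (simp add: contour_integral_sum contour_integrable_lmul contour_integral_lmul perron_fun_integrable)
  moreover have "contour_integral \<gamma> (\<lambda>z. \<Sum>n. b n * perron_fun k (x - lam n) z) = contour_integral \<gamma> (\<lambda>z. F z * perron_fun k x z)"
  proof (rule contour_integral_cong[OF refl])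
    fix z assume "z \<in> path_image \<gamma>"
    then have z: "Re z = c" by (rule img)
    show "(\<Sum>n. b n * perron_fun k (x - lam n) z) = F z * perron_fun k x z"
      unfolding shift[symmetric] F[OF z] by (rule suminf_mult2[OF smz[OF z], symmetric])
  qed
  ultimately have lim1: "(\<lambda>N. \<Sum>n<N. b n * perron_int k (x - lam n) c T) \<longlonglongrightarrow> contour_integral \<gamma> (\<lambda>z. F z * perron_fun k x z)"
    by simp
  \<comment> \<open>Terms with \<open>lam n \<ge> x\<close> have limit \<open>0\<close>, so the
    series of limits is the finite Riesz sum, up to the factor
    \<open>perron_lim k 1\<close>.\<close>
  have "(\<lambda>n. b n * perron_lim k (x - lam n)) sums (\<Sum>n | lam n < x. b n * perron_lim k (x - lam n))"
    by (rule sums_finite[OF frequency_finite[OF freq]]) (simp add: perron_lim_nonpos[OF k])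
  moreover have "(\<Sum>n | lam n < x. b n * perron_lim k (x - lam n)) = perron_lim k 1 * riesz_sum lam k b x"
    unfolding riesz_sum_def sum_distrib_left
  proof (rule sum.cong[OF refl])
    fix n assume "n \<in> {n. lam n < x}"
    then have "perron_lim k (x - lam n) = perron_lim k 1 * of_real ((x - lam n) powr k)"
      by (intro perron_lim_pos k) simp
    then show "b n * perron_lim k (x - lam n) = perron_lim k 1 * (b n * of_real ((x - lam n) powr k))"
      by simp
  qed
  ultimately have lim2: "(\<lambda>N. \<Sum>n<N. b n * perron_lim k (x - lam n)) \<longlonglongrightarrow> perron_lim k 1 * riesz_sum lam k b x"
    by (simp add: sums_def)
  have "norm ((\<Sum>n<N. b n * perron_int k (x - lam n) c T) - (\<Sum>n<N. b n * perron_lim k (x - lam n)))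
       \<le> S * (2 / k * exp (c * x) * T powr (- k))" for N
  proof -
    have "norm (\<Sum>n<N. b n * (perron_int k (x - lam n) c T - perron_lim k (x - lam n)))
       \<le> (\<Sum>n<N. norm (b n) * exp (- (c * lam n)) * (2 / k * exp (c * x) * T powr (- k)))"
    proof (rule sum_norm_le)
      fix n
      have "norm (b n * (perron_int k (x - lam n) c T - perron_lim k (x - lam n)))
         \<le> norm (b n) * (2 / k * exp (c * (x - lam n)) * T powr (- k))"
        unfolding norm_mult by (intro mult_left_mono perron_int_perron_lim(2)[OF k c T]) auto
      also have "exp (c * (x - lam n)) = exp (- (c * lam n)) * exp (c * x)"
        by (simp add: exp_add[symmetric] algebra_simps)
      finally show "norm (b n * (perron_int k (x - lam n) c T - perron_lim k (x - lam n)))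
         \<le> norm (b n) * exp (- (c * lam n)) * (2 / k * exp (c * x) * T powr (- k))"
        by (simp only: ac_simps)
    qed
    also have "\<dots> \<le> S * (2 / k * exp (c * x) * T powr (- k))"
      unfolding sum_distrib_right[symmetric] S_def
      by (intro mult_right_mono sum_le_suminf sm) (use k in auto)
    finally show ?thesis by (simp add: right_diff_distrib sum_subtractf)
  qed
  then have "norm (contour_integral \<gamma> (\<lambda>z. F z * perron_fun k x z) - perron_lim k 1 * riesz_sum lam k b x)
     \<le> S * (2 / k * exp (c * x) * T powr (- k))"
    by (intro tendsto_upperbound[OF tendsto_norm[OF tendsto_diff[OF lim1 lim2]]] always_eventually) auto
  then show ?thesis by (simp add: \<gamma>_def S_def mult_ac)
qed

lemma norm_le_sum_halves:
  assumes "c > 0" shows "(c + \<bar>t\<bar>) / 2 \<le> norm (Complex c t)"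
  using assms abs_Im_le_cmod[of "Complex c t"] abs_Re_le_cmod[of "Complex c t"] by auto

lemma norm_powr_neg_le:
  assumes "c > 0" "p > 0"
  shows "norm (Complex c t) powr (- p) \<le> 2 powr p * (c + \<bar>t\<bar>) powr (- p)"
proof -
  have "norm (Complex c t) powr (- p) \<le> ((c + \<bar>t\<bar>) / 2) powr (- p)"
    using norm_le_sum_halves[OF assms(1)] assms by (intro powr_mono2') auto
  also have "\<dots> = 2 powr p * (c + \<bar>t\<bar>) powr (- p)"
    using assms by (simp add: powr_divide powr_minus field_simps)
  finally show ?thesis .
qed

text \<open>Uniformity is the point: \<open>\<sigma>\<close> and the sum of absolute values vary
  with the series, but they enter through the Perron error and the horizontal sides, which vanish as
  \<open>T\<close> grows. What remains is the integral over \<open>Re z = 1\<close>, controlled by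
  \<open>M\<close>, \<open>k\<close>, \<open>l\<close> and \<open>x\<close>, and absolutely
  convergent because \<open>k > l\<close>.\<close>

lemma riesz_sum_bound_of_growth:
  assumes freq: "frequency lam" and k: "k > 0" "k > l" and l: "l \<ge> 0" and \<sigma>: "\<sigma> \<ge> 1"
    and sm: "summable (\<lambda>n. norm (a n) * exp (- (\<sigma> * lam n)))"
    and f: "\<And>z. Re z \<ge> \<sigma> \<Longrightarrow> f z = (\<Sum>n. a n * exp (- (of_real (lam n) * z)))"
    and hol: "f holomorphic_on halfplane 0"
    and M: "M \<ge> 0" "\<And>z. Re z > 0 \<Longrightarrow> norm (f z) \<le> M * (1 + norm z) powr l"
  shows "norm (perron_lim k 1) * norm (riesz_sum lam k a x) \<le> (4 * 2 powr k / (k - l)) * M * exp x"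
proof -
  define h where "h = (\<lambda>z. f z * perron_fun k x z)"
  define S where "S = (\<Sum>n. norm (a n) * exp (- (\<sigma> * lam n)))"
  have HP: "open (halfplane 0)" "convex (halfplane 0)"
    by (simp_all add: halfplane_def open_halfspace_Re_gt convex_halfspace_Re_gt)
  have "h holomorphic_on halfplane 0"
    unfolding h_def by (intro holomorphic_on_mult hol perron_fun_holomorphic)
      (auto simp: halfplane_def dest: Re_pos_nonpos_Reals)
  from holomorphic_convex_primitive'[OF HP(2,1) this] obtain g where
    "\<And>z. z \<in> halfplane 0 \<Longrightarrow> (g has_field_derivative h z) (at z within halfplane 0)" by blast
  then have g: "\<And>z. z \<in> halfplane 0 \<Longrightarrow> (g has_field_derivative h z) (at z)"
    using HP(1) at_within_open by metis
  have HI: "(h has_contour_integral (g w - g v)) (linepath v w)" if "Re v > 0" "Re w > 0" for v w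
    using contour_integral_primitive_linepath[OF g closed_segment_subset[OF _ _ HP(2)]] that
    by (simp add: halfplane_def)
  then have CI: "contour_integral (linepath v w) h = g w - g v" "h contour_integrable_on linepath v w"
    if "Re v > 0" "Re w > 0" for v w
    using that contour_integral_unique contour_integrable_on_def by blast+
  have nh: "norm (h z) \<le> M * 2 powr l * exp (x * Re z) * norm z powr (- (1 + k - l))"
    if "Re z > 0" "norm z \<ge> 1" for z
  proof -
    have "norm (f z) \<le> M * (2 * norm z) powr l"
      using M(2)[OF that(1)] that l M(1)
      by (elim order_trans) (intro mult_left_mono powr_mono2, auto)
    then have "norm (h z) \<le> M * (2 * norm z) powr l * (exp (x * Re z) * norm z powr (- 1 - k))"
      unfolding h_def norm_mult norm_perron_fun by (intro mult_right_mono) auto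
    also have "\<dots> = M * 2 powr l * exp (x * Re z) * (norm z powr l * norm z powr (- 1 - k))"
      by (simp add: powr_mult)
    also have "norm z powr l * norm z powr (- 1 - k) = norm z powr (- (1 + k - l))"
    proof -
      have e: "- (1 + k - l) = l + (- 1 - k)" by simp
      show ?thesis by (simp only: e powr_add)
    qed
    finally show ?thesis .
  qed
  \<comment> \<open>\<open>1 + norm z \<le> 2 * norm z\<close> contributes \<open>2 powr l\<close>,
    and \<open>norm z \<ge> (1 + \<bar>t\<bar>) / 2\<close> contributes
    \<open>2 powr (1 + k - l)\<close>; the exponent \<open>l\<close> cancels in the final
    constant.\<close>
  define C where "C = M * 2 powr l * exp x * 2 powr (1 + k - l)"
  have vert: "norm (contour_integral (linepath (Complex 1 (- T)) (Complex 1 T)) h) \<le> 2 * (C / (k - l))" if T: "T \<ge> 0" for T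
  proof -
    define G where "G = (\<lambda>t. - C / (k - l) * (1 + t) powr (- (k - l)))"
    have bnd: "norm (h (Complex 1 t)) \<le> C * (1 + \<bar>t\<bar>) powr (- 1 - (k - l))" for t
    proof -
      have "norm (h (Complex 1 t)) \<le> M * 2 powr l * exp x * norm (Complex 1 t) powr (- (1 + k - l))"
        using nh[of "Complex 1 t"] abs_Re_le_cmod[of "Complex 1 t"] by simp
      also have "\<dots> \<le> M * 2 powr l * exp x * (2 powr (1 + k - l) * (1 + \<bar>t\<bar>) powr (- (1 + k - l)))"
        using M k by (intro mult_left_mono norm_powr_neg_le) auto
      also have "- (1 + k - l) = - 1 - (k - l)" by simp
      finally show ?thesis by (simp add: C_def mult.assoc)
    qed
    have der: "(G has_real_derivative C * (1 + t) powr (- 1 - (k - l))) (at t)" if "0 \<le> t" for t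
      unfolding G_def using that k by (intro DERIV_powr_antiderivative) auto
    have ab: "norm (contour_integral (linepath (Complex 1 0) (Complex 1 T)) h) \<le> G T - G 0"
      "norm (contour_integral (linepath (Complex 1 (- T)) (Complex 1 (- 0))) h) \<le> G T - G 0"
      by (rule vertical_integral_bound_sym[where g = "\<lambda>t. C * (1 + t) powr (- 1 - (k - l))"];
          use T bnd der CI in auto)+
    have "contour_integral (linepath (Complex 1 (- T)) (Complex 1 T)) h =
       contour_integral (linepath (Complex 1 0) (Complex 1 T)) h + contour_integral (linepath (Complex 1 (- T)) (Complex 1 (- 0))) h"
      by (simp add: CI)
    then have "norm (contour_integral (linepath (Complex 1 (- T)) (Complex 1 T)) h) \<le> (G T - G 0) + (G T - G 0)"
      using ab norm_triangle_mono by metis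
    also have "G T - G 0 \<le> C / (k - l)"
    proof -
      have "0 \<le> C / (k - l) * (1 + T) powr (- (k - l))"
        using k M by (simp add: C_def)
      then show ?thesis by (simp add: G_def)
    qed
    finally show ?thesis by simp
  qed
  define E where "E = (\<lambda>T. M * 2 powr l * exp (\<bar>x\<bar> * \<sigma>) * T powr (- (1 + k - l)) * (\<sigma> - 1))"
  have horiz: "norm (contour_integral (linepath (Complex \<sigma> t) (Complex 1 t)) h) \<le> E T"
    if t: "\<bar>t\<bar> = T" "T \<ge> 1" for t T
  proof -
    have "norm (contour_integral (linepath (Complex \<sigma> t) (Complex 1 t)) h)
       \<le> (M * 2 powr l * exp (\<bar>x\<bar> * \<sigma>) * T powr (- (1 + k - l))) * norm (Complex 1 t - Complex \<sigma> t)"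
    proof (rule contour_integral_bound_linepath)
      fix z assume "z \<in> closed_segment (Complex \<sigma> t) (Complex 1 t)"
      then have z: "Im z = t" "1 \<le> Re z" "Re z \<le> \<sigma>"
        using closed_segment_same_Im_subset[of \<sigma> t 1] \<sigma> by auto
      then have nz: "norm z \<ge> T" using abs_Im_le_cmod[of z] t by simp
      have "x * Re z \<le> \<bar>x\<bar> * \<sigma>" using z by (intro mult_mono) auto
      then have e1: "exp (x * Re z) \<le> exp (\<bar>x\<bar> * \<sigma>)" by simp
      have e2: "norm z powr (- (1 + k - l)) \<le> T powr (- (1 + k - l))"
        using nz t k by (intro powr_mono2') auto
      have "M * 2 powr l * exp (x * Re z) * norm z powr (- (1 + k - l))
        \<le> M * 2 powr l * exp (\<bar>x\<bar> * \<sigma>) * T powr (- (1 + k - l))"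
        by (rule mult_mono[OF mult_left_mono[OF e1] e2]) (use M in auto)
      then show "norm (h z) \<le> M * 2 powr l * exp (\<bar>x\<bar> * \<sigma>) * T powr (- (1 + k - l))"
        using nh[of z] z nz t by linarith
    qed (use \<sigma> M CI in auto)
    also have "norm (Complex 1 t - Complex \<sigma> t) = \<sigma> - 1"
      using \<sigma> by (simp add: cmod_def)
    finally show ?thesis by (simp add: E_def)
  qed
  define Err where "Err = (\<lambda>T. 2 / k * S * exp (\<sigma> * x) * T powr (- k))"
  have main: "norm (perron_lim k 1 * riesz_sum lam k a x) \<le> Err T + E T + E T + 2 * (C / (k - l))" if T: "T \<ge> 1" for T
  proof -
    let ?I = "\<lambda>u v. contour_integral (linepath u v) h"
    have split: "?I (Complex \<sigma> (- T)) (Complex \<sigma> T) = ?I (Complex \<sigma> (- T)) (Complex 1 (- T))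
       + ?I (Complex 1 (- T)) (Complex 1 T) - ?I (Complex \<sigma> T) (Complex 1 T)"
      using \<sigma> by (simp add: CI)
    have 1: "norm (?I (Complex \<sigma> (- T)) (Complex \<sigma> T)) \<le> E T + 2 * (C / (k - l)) + E T"
      unfolding split by (rule order_trans[OF norm_triangle_ineq4 add_mono[OF order_trans[OF norm_triangle_ineq add_mono]]])
        (use horiz[of "-T" T] horiz[of T T] vert[of T] T in auto)
    have 2: "norm (?I (Complex \<sigma> (- T)) (Complex \<sigma> T) - perron_lim k 1 * riesz_sum lam k a x) \<le> Err T"
      unfolding h_def Err_def S_def
      by (rule perron_dirichlet[OF freq k(1) _ _ sm]) (use \<sigma> T f in auto)
    show ?thesis using 1 2 norm_triangle_sub[of "perron_lim k 1 * riesz_sum lam k a x" "?I (Complex \<sigma> (- T)) (Complex \<sigma> T)"]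
      by (simp add: norm_minus_commute)
  qed
  have "((\<lambda>T. Err T + E T + E T + 2 * (C / (k - l))) \<longlongrightarrow> 0 + 0 + 0 + 2 * (C / (k - l))) at_top"
  proof (intro tendsto_add tendsto_const)
    show "(Err \<longlongrightarrow> 0) at_top" unfolding Err_def
      by (rule tendsto_mult_right_zero, rule tendsto_neg_powr[OF _ filterlim_ident]) (use k in auto)
    show "(E \<longlongrightarrow> 0) at_top" "(E \<longlongrightarrow> 0) at_top" unfolding E_def
      by (rule tendsto_mult_left_zero, rule tendsto_mult_right_zero, rule tendsto_neg_powr[OF _ filterlim_ident], use k in auto)+
  qed
  then have "norm (perron_lim k 1 * riesz_sum lam k a x) \<le> 0 + 0 + 0 + 2 * (C / (k - l))"
    by (rule tendsto_lowerbound[OF _ eventually_mono[OF eventually_ge_at_top[of 1] main]]) auto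
  also have "\<dots> = (4 * 2 powr k / (k - l)) * M * exp x"
    by (simp add: C_def powr_add powr_diff field_simps)
  finally show ?thesis by (simp add: norm_mult)
qed

section \<open>Local boundedness of the Riesz means\<close>

text \<open>Removing the cut destroys convexity, but the set stays starlike about \<open>1\<close>,
  which suffices for a primitive to exist.\<close>

lemma keyhole_domain:
  assumes "u > 0"
  shows "open ({z. Re z > - u} - \<real>\<^sub>\<le>\<^sub>0)" "starlike ({z. Re z > - u} - \<real>\<^sub>\<le>\<^sub>0)"
proof -
  show "open ({z. Re z > - u} - \<real>\<^sub>\<le>\<^sub>0)"
    by (intro open_Diff open_halfspace_Re_gt closed_nonpos_Reals_complex)
  show "starlike ({z. Re z > - u} - \<real>\<^sub>\<le>\<^sub>0)"
    unfolding starlike_def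
  proof (intro bexI[of _ 1] ballI subsetI)
    show "1 \<in> {z. Re z > - u} - \<real>\<^sub>\<le>\<^sub>0" using assms by (simp add: complex_nonpos_Reals_iff)
    fix z w assume z: "z \<in> {z. Re z > - u} - \<real>\<^sub>\<le>\<^sub>0" and "w \<in> closed_segment 1 z"
    then obtain t where t: "0 \<le> t" "t \<le> 1" "w = (1 - t) *\<^sub>R 1 + t *\<^sub>R z"
      by (auto simp: in_segment)
    have Re: "Re w = (1 - t) + t * Re z" and Im: "Im w = t * Im z" by (simp_all add: t)
    have "Re w > - u"
    proof (cases "t = 0")
      case True
      then show ?thesis using Re assms by simp
    next
      case False
      then have "t * (- u) < t * Re z" using z t by (intro mult_strict_left_mono) auto
      moreover have "t * u \<le> 1 * u" using t assms by (intro mult_right_mono) auto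
      ultimately show ?thesis unfolding Re using t by simp
    qed
    moreover have "w \<notin> \<real>\<^sub>\<le>\<^sub>0"
    proof
      assume "w \<in> \<real>\<^sub>\<le>\<^sub>0"
      then have w: "Re w \<le> 0" "Im w = 0" by (auto simp: complex_nonpos_Reals_iff)
      then have "t \<noteq> 0" using Re by auto
      then have "Im z = 0" using w Im by auto
      then have "Re z > 0" using z by (auto simp: complex_nonpos_Reals_iff)
      then have "t * Re z > 0" using t \<open>t \<noteq> 0\<close> by (intro mult_pos_pos) auto
      then show False using w Re t by linarith
    qed
    ultimately show "w \<in> {z. Re z > - u} - \<real>\<^sub>\<le>\<^sub>0" by simp
  qed
qed

text \<open>The four terms of the bound come from the far horizontal sides, the verticals on
  \<open>Re z = - v\<close>, the horizontals at heights \<open>1\<close> and \<open>- 1\<close>, and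
  the vertical piece next to the origin. The hypotheses \<open>far\<close> and \<open>near\<close>
  are separate because away from \<open>0\<close> the growth of \<open>F\<close> has to be measured
  by a pure power that cancels against the kernel, and near \<open>0\<close> by a constant.\<close>

lemma keyhole_integral_bound:
  fixes F :: "complex \<Rightarrow> complex"
  assumes l: "l > 0" and v: "v > 0" and x: "x \<ge> 1" and c: "c \<ge> 1" and T: "T \<ge> 1"
    and hol: "F holomorphic_on {z. Re z > - (2 * v)}" and P: "P \<ge> 0" "P' \<ge> 0"
    and far: "\<And>z. Re z > - (2 * v) \<Longrightarrow> norm z \<ge> 1 \<Longrightarrow> norm (F z) \<le> P * norm z powr l"
    and near: "\<And>z. Re z > - (2 * v) \<Longrightarrow> norm z \<le> 2 \<Longrightarrow> norm (F z) \<le> P'"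
  shows "norm (contour_integral (linepath (Complex c (- T)) (Complex c T)) (\<lambda>z. F z * perron_fun l x z))
    \<le> 2 * (P * exp (c * x) / T * (c + v)) + 2 * (P * exp (- (v * x)) * ln T)
      + 2 * (P * exp 1 * (v + 1)) + 2 * (P' * exp 1 * 2 powr (1 + l) / l * x powr l)"
proof -
  define D where "D = {z. Re z > - (2 * v)} - \<real>\<^sub>\<le>\<^sub>0"
  define h where "h = (\<lambda>z. F z * perron_fun l x z)"
  have D: "open D" "starlike D"
    using keyhole_domain[of "2 * v"] v by (simp_all add: D_def)
  have "h holomorphic_on D"
    unfolding h_def D_def
    by (intro holomorphic_on_mult holomorphic_on_subset[OF hol] perron_fun_holomorphic) auto
  then obtain g where g: "\<And>z. z \<in> D \<Longrightarrow> (g has_field_derivative h z) (at z)"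
    using holomorphic_starlike_primitive[of D h "{}"] D holomorphic_on_imp_continuous_on holomorphic_on_imp_differentiable_at
    by (metis Diff_empty finite.emptyI)
  have HI: "(h has_contour_integral (g b - g a)) (linepath a b)" if "closed_segment a b \<subseteq> D" for a b
    using contour_integral_primitive_linepath[OF g that] .
  then have CI: "contour_integral (linepath a b) h = g b - g a" "h contour_integrable_on linepath a b"
    if "closed_segment a b \<subseteq> D" for a b
    using that contour_integral_unique contour_integrable_on_def by blast+
  \<comment> \<open>On \<open>Re z = \<epsilon>\<close> the factor \<open>exp (x * z)\<close> has
    modulus \<open>exp 1\<close>, and the integral of \<open>\<bar>z\<bar> powr (- 1 - l)\<close> is
    of size \<open>\<epsilon> powr (- l) = x powr l\<close>, the normalisation of the Riesz
    mean.\<close>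
  define \<epsilon> where "\<epsilon> = 1 / x"
  have \<epsilon>: "0 < \<epsilon>" "\<epsilon> \<le> 1" "x * \<epsilon> = 1" using x by (auto simp: \<epsilon>_def)
  have vs: "closed_segment (Complex r s) (Complex r t) \<subseteq> D"
    if "r > - (2 * v)" "r > 0 \<or> (s > 0 \<and> t > 0) \<or> (s < 0 \<and> t < 0)" for r s t
    using closed_segment_same_Re_subset[of r s t] that
    by (fastforce simp: D_def complex_nonpos_Reals_iff)
  have hs: "closed_segment (Complex r t) (Complex s t) \<subseteq> D"
    if "r > - (2 * v)" "s > - (2 * v)" "t \<noteq> 0" for r s t
    using closed_segment_same_Im_subset[of r t s] that
    by (fastforce simp: D_def complex_nonpos_Reals_iff)
  have nh: "norm (h z) \<le> P * exp (x * Re z) / norm z" if "Re z > - (2 * v)" "norm z \<ge> 1" for z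
  proof -
    have "norm (h z) \<le> P * norm z powr l * (exp (x * Re z) * norm z powr (- 1 - l))"
      unfolding h_def norm_mult norm_perron_fun by (intro mult_right_mono far that) auto
    also have "\<dots> = P * exp (x * Re z) * (norm z powr l * norm z powr (- 1 - l))"
      by (simp only: ac_simps)
    also have "norm z powr l * norm z powr (- 1 - l) = norm z powr (- 1)"
      unfolding powr_add[symmetric] by simp
    also have "\<dots> = 1 / norm z"
      using that by (simp add: powr_minus_divide)
    finally show ?thesis by simp
  qed
  let ?I = "\<lambda>a b. contour_integral (linepath a b) h"
  have T0: "T > 0" using T by simp
  \<comment> \<open>The path goes left along \<open>Im z = - T\<close>, up along
    \<open>Re z = - v\<close>, in to \<open>Re z = \<epsilon>\<close> at height \<open>- 1\<close>,
    across the real axis to the right of the cut, and back symmetrically. Horizontal pieces are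
    written from left to right, hence the minus signs; the piece on \<open>Re z = \<epsilon>\<close>
    is split at height \<open>0\<close>, once written \<open>- 0\<close> to match
    \<open>vertical_integral_bound_sym\<close>.\<close>
  have split: "?I (Complex c (- T)) (Complex c T) =
      - ?I (Complex (- v) (- T)) (Complex c (- T)) + ?I (Complex (- v) (- T)) (Complex (- v) (- 1))
      + ?I (Complex (- v) (- 1)) (Complex \<epsilon> (- 1)) + ?I (Complex \<epsilon> (- 1)) (Complex \<epsilon> (- 0)) + ?I (Complex \<epsilon> 0) (Complex \<epsilon> 1)
      - ?I (Complex (- v) 1) (Complex \<epsilon> 1) + ?I (Complex (- v) 1) (Complex (- v) T)
      + ?I (Complex (- v) T) (Complex c T)"
    using v c T0 \<epsilon> by (simp add: CI hs vs)
  have far_h: "norm (?I (Complex (- v) t) (Complex c t)) \<le> P * exp (c * x) / T * (c + v)" if "\<bar>t\<bar> = T" for t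
  proof -
    have "norm (?I (Complex (- v) t) (Complex c t)) \<le> P * exp (c * x) / T * norm (Complex c t - Complex (- v) t)"
    proof (rule contour_integral_bound_linepath)
      fix z assume "z \<in> closed_segment (Complex (- v) t) (Complex c t)"
      then have z: "Im z = t" "- v \<le> Re z" "Re z \<le> c"
        using closed_segment_same_Im_subset[of "- v" t c] v c by auto
      have nz: "norm z \<ge> T" using abs_Im_le_cmod[of z] z that by simp
      have "norm (h z) \<le> P * exp (x * Re z) / norm z"
        by (rule nh) (use z nz v T in auto)
      also have "\<dots> \<le> P * exp (c * x) / T"
        using nz P z x T0 by (intro frac_le mult_left_mono) (auto simp: mult.commute)
      finally show "norm (h z) \<le> P * exp (c * x) / T" .
    qed (use P T0 v c that in \<open>auto intro!: CI(2)[OF hs]\<close>)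
    also have "norm (Complex c t - Complex (- v) t) = c + v"
      using c v by (simp add: cmod_def)
    finally show ?thesis .
  qed
  have near_h: "norm (?I (Complex (- v) t) (Complex \<epsilon> t)) \<le> P * exp 1 * (v + 1)" if "\<bar>t\<bar> = 1" for t
  proof -
    have "norm (?I (Complex (- v) t) (Complex \<epsilon> t)) \<le> P * exp 1 * norm (Complex \<epsilon> t - Complex (- v) t)"
    proof (rule contour_integral_bound_linepath)
      fix z assume "z \<in> closed_segment (Complex (- v) t) (Complex \<epsilon> t)"
      then have z: "Im z = t" "- v \<le> Re z" "Re z \<le> \<epsilon>"
        using closed_segment_same_Im_subset[of "- v" t \<epsilon>] v \<epsilon> by auto
      have nz: "norm z \<ge> 1" using abs_Im_le_cmod[of z] z that by simp
      have xz: "x * Re z \<le> 1" using mult_left_mono[OF z(3), of x] x \<epsilon> by simp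
      have "norm (h z) \<le> P * exp (x * Re z) / norm z"
        by (rule nh) (use z nz v in auto)
      also have "\<dots> \<le> P * exp 1 / 1"
        using nz P xz by (intro frac_le mult_left_mono) auto
      finally show "norm (h z) \<le> P * exp 1" by simp
    qed (use P v \<epsilon> that in \<open>auto intro!: CI(2)[OF hs]\<close>)
    also have "norm (Complex \<epsilon> t - Complex (- v) t) = v + \<epsilon>"
      using \<epsilon> v by (simp add: cmod_def)
    also have "P * exp 1 * (v + \<epsilon>) \<le> P * exp 1 * (v + 1)"
      using P \<epsilon> by (intro mult_left_mono) auto
    finally show ?thesis .
  qed
  have vert: "norm (?I (Complex (- v) 1) (Complex (- v) T)) \<le> P * exp (- (v * x)) * ln T"
    "norm (?I (Complex (- v) (- T)) (Complex (- v) (- 1))) \<le> P * exp (- (v * x)) * ln T"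
  proof -
    define E where "E = P * exp (- (v * x))"
    define G where "G = (\<lambda>t. E * ln t)"
    have bnd: "norm (h (Complex (- v) t)) \<le> E / \<bar>t\<bar>" if "1 \<le> \<bar>t\<bar>" for t
    proof -
      have nz: "norm (Complex (- v) t) \<ge> \<bar>t\<bar>" using abs_Im_le_cmod[of "Complex (- v) t"] by simp
      have "norm (h (Complex (- v) t)) \<le> P * exp (x * Re (Complex (- v) t)) / norm (Complex (- v) t)"
        by (rule nh) (use nz that v in auto)
      also have "\<dots> \<le> E / \<bar>t\<bar>"
        using nz that P by (intro frac_le) (auto simp: E_def mult.commute)
      finally show ?thesis .
    qed
    have der: "(G has_real_derivative E / t) (at t)" if "1 \<le> t" for t
      unfolding G_def using that by (auto intro!: derivative_eq_intros)
    have "norm (?I (Complex (- v) 1) (Complex (- v) T)) \<le> G T - G 1"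
      "norm (?I (Complex (- v) (- T)) (Complex (- v) (- 1))) \<le> G T - G 1"
      by (rule vertical_integral_bound_sym[where g = "\<lambda>t. E / t"]; use T bnd der v in \<open>auto intro!: CI(2)[OF vs]\<close>)+
    then show "norm (?I (Complex (- v) 1) (Complex (- v) T)) \<le> P * exp (- (v * x)) * ln T"
      "norm (?I (Complex (- v) (- T)) (Complex (- v) (- 1))) \<le> P * exp (- (v * x)) * ln T"
      by (simp_all add: G_def E_def)
  qed
  have mid: "norm (?I (Complex \<epsilon> 0) (Complex \<epsilon> 1)) \<le> P' * exp 1 * 2 powr (1 + l) / l * x powr l"
    "norm (?I (Complex \<epsilon> (- 1)) (Complex \<epsilon> (- 0))) \<le> P' * exp 1 * 2 powr (1 + l) / l * x powr l"
  proof -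
    define E where "E = P' * exp 1 * 2 powr (1 + l)"
    have E: "E \<ge> 0" using P by (simp add: E_def)
    define G where "G = (\<lambda>t. - E / l * (\<epsilon> + t) powr (- l))"
    have bnd: "norm (h (Complex \<epsilon> t)) \<le> E * (\<epsilon> + \<bar>t\<bar>) powr (- 1 - l)" if "\<bar>t\<bar> \<le> 1" for t
    proof -
      have e: "- (1 + l) = - 1 - l" by simp
      have "norm (Complex \<epsilon> t) \<le> 2" using cmod_le[of "Complex \<epsilon> t"] that \<epsilon> by simp
      then have "norm (F (Complex \<epsilon> t)) \<le> P'"
        using v \<epsilon> by (intro near) auto
      moreover have "norm (Complex \<epsilon> t) powr (- (1 + l)) \<le> 2 powr (1 + l) * (\<epsilon> + \<bar>t\<bar>) powr (- (1 + l))"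
        by (rule norm_powr_neg_le) (use \<epsilon> l in auto)
      ultimately have "norm (h (Complex \<epsilon> t)) \<le> P' * (exp 1 * (2 powr (1 + l) * (\<epsilon> + \<bar>t\<bar>) powr (- 1 - l)))"
        unfolding h_def norm_mult norm_perron_fun e using \<epsilon> P by (intro mult_mono) auto
      then show ?thesis by (simp only: E_def mult.assoc)
    qed
    have der: "(G has_real_derivative E * (\<epsilon> + t) powr (- 1 - l)) (at t)" if "0 \<le> t" for t
      unfolding G_def using that \<epsilon> l by (intro DERIV_powr_antiderivative) auto
    have ab: "norm (?I (Complex \<epsilon> 0) (Complex \<epsilon> 1)) \<le> G 1 - G 0"
      "norm (?I (Complex \<epsilon> (- 1)) (Complex \<epsilon> (- 0))) \<le> G 1 - G 0"
      by (rule vertical_integral_bound_sym[where g = "\<lambda>t. E * (\<epsilon> + t) powr (- 1 - l)"];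
         use bnd der v \<epsilon> in \<open>auto intro!: CI(2)[OF vs]\<close>)+
    have "0 \<le> E / l * (\<epsilon> + 1) powr (- l)" using E l by simp
    moreover have "\<epsilon> powr (- l) = x powr l"
      using x by (simp add: \<epsilon>_def powr_divide powr_minus_divide)
    ultimately have "G 1 - G 0 \<le> E / l * x powr l"
      by (simp add: G_def)
    then show "norm (?I (Complex \<epsilon> 0) (Complex \<epsilon> 1)) \<le> P' * exp 1 * 2 powr (1 + l) / l * x powr l"
      "norm (?I (Complex \<epsilon> (- 1)) (Complex \<epsilon> (- 0))) \<le> P' * exp 1 * 2 powr (1 + l) / l * x powr l"
      using ab unfolding E_def by linarith+
  qed
  have tri: "norm (- a + b + c + d + e - f + g + h) \<le> norm a + norm b + norm c + norm d + norm e + norm f + norm g + norm h"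
    for a b c d e f g h :: complex
    using norm_triangle_le[of "- a + b + c + d + e - f + g" h] norm_triangle_le[of "- a + b + c + d + e - f" g]
      norm_triangle_ineq4[of "- a + b + c + d + e" f] norm_triangle_ineq[of "- a + b + c + d" e]
      norm_triangle_ineq[of "- a + b + c" d] norm_triangle_ineq[of "- a + b" c] norm_triangle_ineq[of "- a" b]
      norm_triangle_ineq[of "- a + b + c + d + e - f + g" h] norm_triangle_ineq[of "- a + b + c + d + e - f" g]
    unfolding norm_minus_cancel by linarith
  have "norm (?I (Complex c (- T)) (Complex c T)) \<le> P * exp (c * x) / T * (c + v) + P * exp (- (v * x)) * ln T
     + P * exp 1 * (v + 1) + P' * exp 1 * 2 powr (1 + l) / l * x powr l + P' * exp 1 * 2 powr (1 + l) / l * x powr l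
     + P * exp 1 * (v + 1) + P * exp (- (v * x)) * ln T + P * exp (c * x) / T * (c + v)"
    unfolding split
    by (rule order_trans[OF tri]) (intro add_mono far_h near_h vert mid; use T0 in simp)
  then show ?thesis unfolding h_def by linarith
qed

lemma halfplane_open_convex:
  "open (halfplane \<sigma>)" "convex (halfplane \<sigma>)"
  by (simp_all add: halfplane_def open_halfspace_Re_gt convex_halfspace_Re_gt)

text \<open>Recentring at \<open>s\<close> reduces to Perron's formula at \<open>0\<close>:
  \<open>F z = f (s + z)\<close> has the coefficients \<open>b n\<close> and is controlled on
  \<open>Re z > - u\<close>. Each piece of the keyhole estimate is at most a constant times
  \<open>x powr l\<close>, and this constant depends on \<open>u\<close> and \<open>\<rho>\<close>
  but not on \<open>x\<close> or \<open>s\<close>.\<close>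

lemma norm_riesz_mean_bounded:
  assumes freq: "frequency lam" and l: "l > 0" and \<sigma>: "\<sigma> \<ge> 1"
    and sm: "summable (\<lambda>n. norm (a n) * exp (- (\<sigma> * lam n)))"
    and f: "\<And>z. Re z \<ge> \<sigma> \<Longrightarrow> f z = (\<Sum>n. a n * exp (- (of_real (lam n) * z)))"
    and hol: "f holomorphic_on halfplane 0"
    and M: "M \<ge> 0" "\<And>z. Re z > 0 \<Longrightarrow> norm (f z) \<le> M * (1 + norm z) powr l"
    and u: "u > 0" and \<rho>: "\<rho> \<ge> 0"
  shows "\<exists>K. \<forall>x s. 1 \<le> x \<longrightarrow> u \<le> Re s \<longrightarrow> norm s \<le> \<rho> \<longrightarrow> norm (riesz_mean lam l a s x) \<le> K"
proof -
  \<comment> \<open>Half of the available room \<open>u\<close>: the contour runs on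
    \<open>Re z = - v\<close>, inside the domain \<open>Re z > - 2 * v\<close> of
    \<open>F\<close>.\<close>
  define v where "v = u / 2"
  have v: "v > 0" using u by (simp add: v_def)
  \<comment> \<open>\<open>1 + \<rho> + norm z \<le> (2 + \<rho>) * norm z\<close> for
    \<open>norm z \<ge> 1\<close> gives \<open>P\<close>, and \<open>norm z \<le> 2\<close> gives
    \<open>P'\<close>.\<close>
  define P where "P = M * (2 + \<rho>) powr l"
  define P' where "P' = M * (3 + \<rho>) powr l"
  have P: "P \<ge> 0" "P' \<ge> 0" using M by (simp_all add: P_def P'_def)
  define S where "S = (\<Sum>n. norm (a n) * exp (- (\<sigma> * lam n)))"
  have S: "S \<ge> 0" unfolding S_def by (intro suminf_nonneg sm) auto
  define \<kappa> where "\<kappa> = norm (perron_lim l 1)"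
  have \<kappa>: "\<kappa> > 0" unfolding \<kappa>_def using perron_lim_1_nonzero[OF l] by simp
  define Q where "Q = 2 * (P * (\<sigma> + v)) + 2 * (P * (\<sigma> * (1 + 1 / l) / v)) + 2 * (P * exp 1 * (v + 1)) + 2 * (P' * exp 1 * 2 powr (1 + l) / l) + 2 / l * S"
  have "norm (riesz_mean lam l a s x) \<le> Q / \<kappa>" if x: "1 \<le> x" and s: "u \<le> Re s" "norm s \<le> \<rho>" for x s
  proof -
    define F where "F = (\<lambda>z. f (s + z))"
    define b where "b = (\<lambda>n. a n * exp (- (of_real (lam n) * s)))"
    \<comment> \<open>so large that both \<open>exp (\<sigma> * x) / T\<close> and \<open>exp (\<sigma> * x) * T powr (- l)\<close> are at most \<open>1\<close>\<close>
    define T where "T = exp (\<sigma> * x * (1 + 1 / l))"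
    have T: "T \<ge> 1" using \<sigma> x l by (simp add: T_def)
    have lnT: "ln T = \<sigma> * x * (1 + 1 / l)" by (simp add: T_def)
    have nb: "norm (b n) \<le> norm (a n)" for n
      using s u frequency_nonneg[OF freq, of n] by (simp add: b_def norm_mult mult_left_le)
    have nb': "norm (b n) * exp (- (\<sigma> * lam n)) \<le> norm (a n) * exp (- (\<sigma> * lam n))" for n
      by (intro mult_right_mono nb) auto
    have smb: "summable (\<lambda>n. norm (b n) * exp (- (\<sigma> * lam n)))"
      by (rule summable_comparison_test'[OF sm, of 0]) (use nb' in auto)
    have Sb: "(\<Sum>n. norm (b n) * exp (- (\<sigma> * lam n))) \<le> S"
      unfolding S_def by (intro suminf_le nb' smb sm)
    have Fs: "F z = (\<Sum>n. b n * exp (- (of_real (lam n) * z)))" if "Re z = \<sigma>" for z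
    proof -
      have "F z = (\<Sum>n. a n * exp (- (of_real (lam n) * (s + z))))"
        unfolding F_def using that s u by (intro f) auto
      then show ?thesis by (simp add: b_def distrib_left exp_diff exp_minus field_simps)
    qed
    have sz: "norm (F z) \<le> M * (1 + \<rho> + norm z) powr l" if "Re z > - (2 * v)" for z
    proof -
      have "norm (F z) \<le> M * (1 + norm (s + z)) powr l"
        unfolding F_def using that s by (intro M) (auto simp: v_def)
      also have "\<dots> \<le> M * (1 + \<rho> + norm z) powr l"
        using norm_triangle_ineq[of s z] s l M by (intro mult_left_mono powr_mono2) auto
      finally show ?thesis .
    qed
    have far: "norm (F z) \<le> P * norm z powr l" if "Re z > - (2 * v)" "norm z \<ge> 1" for z
    proof -
      have "1 + \<rho> \<le> (1 + \<rho>) * norm z" using that \<rho> by simp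
      then have "1 + \<rho> + norm z \<le> (2 + \<rho>) * norm z" by (simp add: algebra_simps)
      then have "M * (1 + \<rho> + norm z) powr l \<le> M * ((2 + \<rho>) * norm z) powr l"
        using M l \<rho> by (intro mult_left_mono powr_mono2) auto
      then show ?thesis using sz[OF that(1)] \<rho> by (simp add: P_def powr_mult mult.assoc)
    qed
    have near: "norm (F z) \<le> P'" if "Re z > - (2 * v)" "norm z \<le> 2" for z
    proof -
      have "M * (1 + \<rho> + norm z) powr l \<le> M * (3 + \<rho>) powr l"
        using M l \<rho> that by (intro mult_left_mono powr_mono2) auto
      then show ?thesis using sz[OF that(1)] by (simp add: P'_def)
    qed
    have holF: "F holomorphic_on {z. Re z > - (2 * v)}"
      unfolding F_def
      by (rule holomorphic_on_compose_gen[OF _ hol, unfolded o_def])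
         (use s in \<open>auto intro!: holomorphic_intros simp: halfplane_def v_def\<close>)
    let ?I = "contour_integral (linepath (Complex \<sigma> (- T)) (Complex \<sigma> T)) (\<lambda>z. F z * perron_fun l x z)"
    have key: "norm ?I \<le> 2 * (P * exp (\<sigma> * x) / T * (\<sigma> + v)) + 2 * (P * exp (- (v * x)) * ln T)
      + 2 * (P * exp 1 * (v + 1)) + 2 * (P' * exp 1 * 2 powr (1 + l) / l * x powr l)"
      by (rule keyhole_integral_bound[OF l v x \<sigma> T holF P far near])
    have per: "norm (?I - perron_lim l 1 * riesz_sum lam l b x)
      \<le> 2 / l * (\<Sum>n. norm (b n) * exp (- (\<sigma> * lam n))) * exp (\<sigma> * x) * T powr (- l)"
      by (rule perron_dirichlet[OF freq l _ _ smb Fs]) (use \<sigma> T in auto)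
    have e1: "exp (\<sigma> * x) / T \<le> 1"
      using \<sigma> x l by (simp add: T_def algebra_simps)
    have e2: "exp (\<sigma> * x) * T powr (- l) \<le> 1"
    proof -
      have "exp (\<sigma> * x) * T powr (- l) = exp (\<sigma> * x - l * (\<sigma> * x * (1 + 1 / l)))"
        by (simp add: T_def powr_def exp_add[symmetric])
      also have "\<sigma> * x - l * (\<sigma> * x * (1 + 1 / l)) = - (l * \<sigma> * x)"
        using l by (simp add: field_simps)
      finally show ?thesis using l \<sigma> x by simp
    qed
    have e3: "exp (- (v * x)) * ln T \<le> \<sigma> * (1 + 1 / l) / v"
    proof -
      have "v * x \<le> exp (v * x)" using exp_ge_add_one_self[of "v * x"] by linarith
      then have "exp (- (v * x)) * x \<le> 1 / v"
        using v by (simp add: exp_minus field_simps)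
      then have "exp (- (v * x)) * x * (\<sigma> * (1 + 1 / l)) \<le> 1 / v * (\<sigma> * (1 + 1 / l))"
        using \<sigma> l by (intro mult_right_mono) auto
      then show ?thesis unfolding lnT by (simp add: mult_ac)
    qed
    have xl: "x powr l \<ge> 1" using x l by (simp add: ge_one_powr_ge_zero)
    have "\<kappa> * norm (riesz_sum lam l b x) \<le> norm ?I + norm (?I - perron_lim l 1 * riesz_sum lam l b x)"
      unfolding \<kappa>_def norm_mult[symmetric]
      using norm_triangle_sub[of "perron_lim l 1 * riesz_sum lam l b x" ?I] by (simp add: norm_minus_commute)
    also have "\<dots> \<le> (2 * (P * 1 * (\<sigma> + v)) + 2 * (P * (\<sigma> * (1 + 1 / l) / v))
      + 2 * (P * exp 1 * (v + 1)) + 2 * (P' * exp 1 * 2 powr (1 + l) / l * x powr l)) + 2 / l * S * 1"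
    proof (intro add_mono order_trans[OF key] order_trans[OF per])
      have "2 * (P * (exp (\<sigma> * x) / T) * (\<sigma> + v)) \<le> 2 * (P * 1 * (\<sigma> + v))"
        by (intro mult_left_mono mult_right_mono e1) (use P \<sigma> v in auto)
      then show "2 * (P * exp (\<sigma> * x) / T * (\<sigma> + v)) \<le> 2 * (P * 1 * (\<sigma> + v))"
        by (simp only: times_divide_eq_right)
      show "2 * (P * exp (- (v * x)) * ln T) \<le> 2 * (P * (\<sigma> * (1 + 1 / l) / v))"
        using mult_left_mono[OF e3 P(1)] by (simp add: mult.assoc)
      have "2 / l * (\<Sum>n. norm (b n) * exp (- (\<sigma> * lam n))) * (exp (\<sigma> * x) * T powr (- l)) \<le> 2 / l * S * 1"
        by (rule mult_mono[OF mult_left_mono[OF Sb] e2]) (use l S in auto)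
      then show "2 / l * (\<Sum>n. norm (b n) * exp (- (\<sigma> * lam n))) * exp (\<sigma> * x) * T powr (- l) \<le> 2 / l * S * 1"
        by (simp only: mult.assoc)
    qed auto
    also have "\<dots> \<le> Q * x powr l"
    proof -
      have nn: "0 \<le> 2 * (P * (\<sigma> + v)) + 2 * (P * (\<sigma> * (1 + 1 / l) / v)) + 2 * (P * exp 1 * (v + 1)) + 2 / l * S"
        using P S \<sigma> v l by (intro add_nonneg_nonneg mult_nonneg_nonneg) auto
      from mult_left_mono[OF xl nn] show ?thesis
        unfolding Q_def by (simp add: algebra_simps)
    qed
    also have "norm (riesz_sum lam l b x) = x powr l * norm (riesz_mean lam l a s x)"
      using riesz_sum_eq_riesz_mean[of x lam l a s] x by (simp add: b_def norm_mult)
    finally have "\<kappa> * norm (riesz_mean lam l a s x) * x powr l \<le> Q * x powr l"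
      by (simp only: ac_simps)
    then have "\<kappa> * norm (riesz_mean lam l a s x) \<le> Q"
      by (rule mult_right_le_imp_le) (use x in simp)
    then show ?thesis using \<kappa> by (simp add: field_simps)
  qed
  then show ?thesis by blast
qed

lemma riesz_mean_holomorphic: "(\<lambda>s. riesz_mean lam k a s x) holomorphic_on A"
  unfolding riesz_mean_def by (intro holomorphic_intros)

text \<open>Vitali's argument: if the means stayed away from \<open>f s\<close> along some sequence
  of \<open>x\<close>, local boundedness would give a subsequence converging on the whole half-plane
  to a holomorphic function, which equals \<open>f\<close> where the series converges absolutely and
  hence everywhere.\<close>

lemma riesz_mean_tendsto_of_growth:
  assumes freq: "frequency lam" and l: "l > 0" and \<sigma>: "\<sigma> \<ge> 1"
    and sm: "summable (\<lambda>n. norm (a n) * exp (- (\<sigma> * lam n)))"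
    and f: "\<And>z. Re z \<ge> \<sigma> \<Longrightarrow> f z = (\<Sum>n. a n * exp (- (of_real (lam n) * z)))"
    and hol: "f holomorphic_on halfplane 0"
    and M: "M \<ge> 0" "\<And>z. Re z > 0 \<Longrightarrow> norm (f z) \<le> M * (1 + norm z) powr l"
    and s: "Re s > 0"
  shows "(riesz_mean lam l a s \<longlongrightarrow> f s) at_top"
proof (rule ccontr)
  assume "\<not> (riesz_mean lam l a s \<longlongrightarrow> f s) at_top"
  then obtain e where e: "e > 0" "\<And>y. \<exists>x\<ge>y. \<not> dist (riesz_mean lam l a s x) (f s) < e"
    unfolding tendsto_iff eventually_at_top_linorder by blast
  from e(2) obtain X where X: "\<And>y. X y \<ge> y" "\<And>y. \<not> dist (riesz_mean lam l a s (X y)) (f s) < e"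
    by metis
  \<comment> \<open>The shift by \<open>1\<close> keeps \<open>X (1 + real n) \<ge> 1\<close>, the
    range in which the means are known to be bounded.\<close>
  define R where "R = (\<lambda>n z. riesz_mean lam l a z (X (1 + real n)))"
  define H where "H = (\<lambda>x z. riesz_mean lam l a z x) ` {1..}"
  obtain g r where g: "g holomorphic_on halfplane 0" "strict_mono (r :: nat \<Rightarrow> nat)"
    "\<And>z. z \<in> halfplane 0 \<Longrightarrow> (\<lambda>n. R (r n) z) \<longlonglongrightarrow> g z"
  proof (rule Montel[of "halfplane 0" H R])
    show "open (halfplane 0)" by (rule halfplane_open_convex)
    show "h holomorphic_on halfplane 0" if "h \<in> H" for h
      using that by (auto simp: H_def intro: riesz_mean_holomorphic)
    have "X (1 + real n) \<ge> 1" for n using X(1)[of "1 + real n"] by simp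
    then show "range R \<subseteq> H" by (auto simp: H_def R_def)
    show "\<exists>B. \<forall>h\<in>H. \<forall>z\<in>K. norm (h z) \<le> B" if K: "compact K" "K \<subseteq> halfplane 0" for K
    proof (cases "K = {}")
      case False
      obtain z0 where z0: "z0 \<in> K" "\<And>z. z \<in> K \<Longrightarrow> Re z0 \<le> Re z"
        using continuous_attains_inf[OF K(1) False continuous_on_Re[OF continuous_on_id]] by blast
      obtain \<rho> where \<rho>: "\<And>z. z \<in> K \<Longrightarrow> norm z \<le> \<rho>"
        using compact_imp_bounded[OF K(1)] by (auto simp: bounded_iff)
      have "\<rho> \<ge> 0" using \<rho>[OF z0(1)] norm_ge_zero order_trans by blast
      moreover have "Re z0 > 0" using z0(1) K(2) by (auto simp: halfplane_def)
      ultimately obtain B where "\<forall>x s. 1 \<le> x \<longrightarrow> Re z0 \<le> Re s \<longrightarrow> norm s \<le> \<rho> \<longrightarrow> norm (riesz_mean lam l a s x) \<le> B"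
        using norm_riesz_mean_bounded[OF freq l \<sigma> sm f hol M, of "Re z0" \<rho>] by blast
      then show ?thesis using z0 \<rho> by (intro exI[of _ B]) (auto simp: H_def)
    qed auto
  qed blast
  have lim: "filterlim (\<lambda>n. X (1 + real (r n))) at_top sequentially"
  proof (rule filterlim_at_top_mono[OF filterlim_real_sequentially always_eventually], rule allI)
    fix n
    show "real n \<le> X (1 + real (r n))"
      using X(1)[of "1 + real (r n)"] seq_suble[OF g(2), of n] by linarith
  qed
  have eq: "g z = f z" if "z \<in> halfplane \<sigma>" for z
  proof -
    have z: "Re z \<ge> \<sigma>" using that by (simp add: halfplane_def)
    have "(riesz_mean lam l a z \<longlongrightarrow> f z) at_top"
      unfolding f[OF z] by (rule riesz_mean_tendsto_suminf[OF freq _ sm z]) (use l in simp)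
    from filterlim_compose[OF this lim] have "(\<lambda>n. R (r n) z) \<longlonglongrightarrow> f z"
      by (simp add: R_def)
    moreover have "(\<lambda>n. R (r n) z) \<longlonglongrightarrow> g z"
      using z \<sigma> by (intro g) (simp add: halfplane_def)
    ultimately show ?thesis using LIMSEQ_unique by blast
  qed
  have "g s = f s"
  proof (rule analytic_continuation_open[of "halfplane \<sigma>" "halfplane 0" g f])
    have "of_real (\<sigma> + 1) \<in> halfplane \<sigma>" by (simp add: halfplane_def)
    then show "halfplane \<sigma> \<noteq> {}" by blast
    show "connected (halfplane 0)" using halfplane_open_convex convex_connected by blast
    show "halfplane \<sigma> \<subseteq> halfplane 0" using \<sigma> by (auto simp: halfplane_def)
  qed (use halfplane_open_convex g(1) hol eq s in \<open>auto simp: halfplane_def\<close>)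
  then have "(\<lambda>n. R (r n) s) \<longlonglongrightarrow> f s"
    using g(3)[of s] s by (simp add: halfplane_def)
  then have "eventually (\<lambda>n. dist (R (r n) s) (f s) < e) sequentially"
    using e(1) by (rule tendstoD)
  then show False using X(2) by (auto simp: R_def)
qed

section \<open>Uniqueness of coefficients and a three lines argument\<close>

text \<open>After multiplication by \<open>exp (lam n * s)\<close>, with \<open>s\<close> real
  tending to infinity, the terms beyond \<open>n\<close> die out and the earlier ones vanish by
  induction; so the sum tends to \<open>a n\<close>, although it is \<open>0\<close> for
  \<open>s \<ge> \<sigma>\<close>.\<close>

lemma dirichlet_coeffs_zero:
  assumes freq: "frequency lam"
    and sm: "summable (\<lambda>n. norm (a n) * exp (- (\<sigma> * lam n)))"
    and zero: "\<And>z. Re z \<ge> \<sigma> \<Longrightarrow> (\<Sum>n. a n * exp (- (of_real (lam n) * z))) = 0"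
  shows "a n = 0"
proof (induction n rule: less_induct)
  case (less n)
  have mono: "strict_mono lam" using freq by (simp add: frequency_def)
  define t where "t = (\<lambda>m s. a m * exp (- (of_real (lam m - lam n) * of_real s)))"
  have "eventually (\<lambda>s. summable (\<lambda>m. norm (t m s))) at_top \<and>
        summable (\<lambda>m. norm (if m = n then a n else 0)) \<and>
        ((\<lambda>s. suminf (\<lambda>m. t m s)) \<longlongrightarrow> suminf (\<lambda>m. if m = n then a n else 0)) (at_top :: real filter)"
  proof (rule tannerys_theorem)
    fix m
    show "(t m \<longlongrightarrow> (if m = n then a n else 0)) at_top"
    proof (cases m n rule: linorder_cases)
      case less
      then show ?thesis using less.IH by (simp add: t_def)
    next
      case equal
      then show ?thesis by (simp add: t_def)
    next
      case greater
      then have "lam m - lam n > 0" using mono by (simp add: strict_mono_less)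
      then have "((\<lambda>s. exp (- ((lam m - lam n) * s))) \<longlongrightarrow> 0) at_top"
        by real_asymp
      then have "((\<lambda>s. a m * of_real (exp (- ((lam m - lam n) * s)))) \<longlongrightarrow> a m * of_real 0) at_top"
        by (intro tendsto_mult tendsto_of_real tendsto_const)
      then show ?thesis using greater by (simp add: t_def exp_of_real[symmetric])
    qed
  next
    have "eventually (\<lambda>s. s \<ge> \<sigma>) (at_top :: real filter)" by (rule eventually_ge_at_top)
    then show "eventually (\<lambda>(m, s). norm (t m s) \<le> norm (a m) * exp (- (\<sigma> * lam m)) * exp (\<sigma> * lam n)) (at_top \<times>\<^sub>F at_top)"
    proof (intro eventually_prodI[OF eventually_True, THEN eventually_mono], assumption, clarsimp)
      fix m s assume s: "\<sigma> \<le> s"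
      show "norm (t m s) \<le> norm (a m) * exp (- (\<sigma> * lam m)) * exp (\<sigma> * lam n)"
      proof (cases "m < n")
        case True
        then show ?thesis using less.IH by (simp add: t_def)
      next
        case False
        then have "lam m - lam n \<ge> 0" using mono by (simp add: strict_mono_less_eq)
        then have "(lam m - lam n) * \<sigma> \<le> (lam m - lam n) * s" using s by (rule mult_left_mono[rotated])
        then have "exp (- ((lam m - lam n) * s)) \<le> exp (- (\<sigma> * lam m)) * exp (\<sigma> * lam n)"
          by (simp add: exp_add[symmetric] algebra_simps)
        then have "norm (a m) * exp (- ((lam m - lam n) * s)) \<le> norm (a m) * (exp (- (\<sigma> * lam m)) * exp (\<sigma> * lam n))"
          by (rule mult_left_mono) simp
        then show ?thesis by (simp add: t_def norm_mult mult.assoc)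
      qed
    qed
  next
    show "summable (\<lambda>m. norm (a m) * exp (- (\<sigma> * lam m)) * exp (\<sigma> * lam n))"
      by (rule summable_mult2[OF sm])
  qed auto
  moreover have "suminf (\<lambda>m. if m = n then a n else 0) = a n"
    using suminf_finite[of "{n}" "\<lambda>m. if m = n then a n else 0"] by simp
  ultimately have lim: "((\<lambda>s. suminf (\<lambda>m. t m s)) \<longlongrightarrow> a n) at_top" by simp
  have "suminf (\<lambda>m. t m s) = 0" if s: "s \<ge> \<sigma>" for s
  proof -
    have abs: "summable (\<lambda>m. a m * exp (- (of_real (lam m) * of_real s)))"
    proof (rule summable_comparison_test'[OF sm, of 0])
      fix m
      show "norm (a m * exp (- (of_real (lam m) * of_real s))) \<le> norm (a m) * exp (- (\<sigma> * lam m))"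
        using mult_left_mono[OF s frequency_nonneg[OF freq, of m]]
        by (simp add: norm_mult mult_left_mono mult.commute)
    qed
    have "t m s = exp (of_real (lam n) * of_real s) * (a m * exp (- (of_real (lam m) * of_real s)))" for m
      by (simp add: t_def exp_diff exp_minus left_diff_distrib field_simps)
    then have "suminf (\<lambda>m. t m s) = exp (of_real (lam n) * of_real s) * suminf (\<lambda>m. a m * exp (- (of_real (lam m) * of_real s)))"
      by (simp add: suminf_mult[OF abs])
    then show ?thesis using zero[of "of_real s"] s by simp
  qed
  then have "((\<lambda>s. suminf (\<lambda>m. t m s)) \<longlongrightarrow> 0) at_top"
    by (intro tendsto_eventually eventually_mono[OF eventually_ge_at_top[of \<sigma>]])
  then show ?case using lim tendsto_unique[OF trivial_limit_at_top_linorder] by blast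
qed

text \<open>\<open>h s * exp (A * (s - d))\<close> is at most \<open>M\<close> in modulus on both
  lines \<open>Re s = d\<close> and \<open>Re s = \<sigma>\<close>; the Phragmen-Lindelof divisor
  \<open>q\<close> carries this over to the unbounded strip. The left line is at
  \<open>d > 0\<close> because nothing is known about \<open>h\<close> on the imaginary
  axis.\<close>

lemma strip_decay_interior:
  assumes hol: "h holomorphic_on halfplane 0"
    and M: "M > 0" "\<And>s. Re s > 0 \<Longrightarrow> norm (h s) \<le> M"
    and A: "A \<ge> 0" and line: "\<And>s. Re s = \<sigma> \<Longrightarrow> norm (h s) \<le> M * exp (- (A * \<sigma>))"
    and d: "0 < d" "d < Re z" "Re z < \<sigma>"
  shows "norm (h z) \<le> M * exp (- (A * (Re z - d)))"
proof -
  define H where "H = (\<lambda>s::complex. h s * exp (of_real A * (s - of_real d)))"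
  have bound: "norm (H z) \<le> M * norm (1 + of_real \<eta> * (z - of_real d))" if \<eta>: "\<eta> > 0" for \<eta>
  proof -
    define q where "q = (\<lambda>s::complex. 1 + of_real \<eta> * (s - of_real d))"
    \<comment> \<open>\<open>\<eta> * Y \<ge> exp (A * \<sigma>)\<close>, so on the horizontal sides
      \<open>q\<close> alone outweighs the crude bound
      \<open>M * exp (A * \<sigma>)\<close>.\<close>
    define Y where "Y = \<bar>Im z\<bar> + exp (A * \<sigma>) / \<eta>"
    define S where "S = cbox (Complex d (- Y)) (Complex \<sigma> Y)"
    have Y: "Y > \<bar>Im z\<bar>" using \<eta> by (simp add: Y_def)
    have q1: "norm (q s) \<ge> 1" if "Re s \<ge> d" for s
    proof -
      have "0 \<le> \<eta> * (Re s - d)" using that \<eta> by simp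
      then have "1 \<le> \<bar>Re (q s)\<bar>" by (simp add: q_def)
      then show ?thesis using abs_Re_le_cmod[of "q s"] by linarith
    qed
    have q2: "norm (q s) \<ge> \<eta> * \<bar>Im s\<bar>" for s
      using abs_Im_le_cmod[of "q s"] \<eta> by (simp add: q_def abs_mult)
    have S_half: "S \<subseteq> halfplane 0"
      using d by (auto simp: S_def in_cbox_complex_iff halfplane_def)
    have hS: "(\<lambda>s. H s / q s) holomorphic_on S"
      unfolding H_def q_def
      by (intro holomorphic_intros holomorphic_on_subset[OF hol S_half])
         (use q1 in \<open>force simp: S_def in_cbox_complex_iff q_def\<close>)
    have "norm (H z / q z) \<le> M"
    proof (rule maximum_modulus_frontier[of "\<lambda>s. H s / q s" S M z])
      show "(\<lambda>s. H s / q s) holomorphic_on interior S"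
        using hS interior_subset holomorphic_on_subset by blast
      show "continuous_on (closure S) (\<lambda>s. H s / q s)"
        using holomorphic_on_imp_continuous_on[OF hS] by (simp add: S_def)
      show "bounded S" by (simp add: S_def)
      show "z \<in> S" using d Y by (auto simp: S_def in_cbox_complex_iff)
      fix s assume "s \<in> frontier S"
      then have s: "d \<le> Re s" "Re s \<le> \<sigma>" "\<bar>Im s\<bar> \<le> Y" "Re s = d \<or> Re s = \<sigma> \<or> \<bar>Im s\<bar> = Y"
        using d Y by (auto simp: S_def frontier_def in_cbox_complex_iff in_box_complex_iff interior_cbox abs_if split: if_splits)
      have nH: "norm (H s) = norm (h s) * exp (A * (Re s - d))"
        by (simp add: H_def norm_mult)
      have nh: "norm (h s) \<le> M" using s d by (intro M) auto
      show "norm (H s / q s) \<le> M"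
      proof (cases "\<bar>Im s\<bar> = Y")
        case True
        have "norm (H s) \<le> M * exp (A * \<sigma>)"
          unfolding nH using nh s A d M by (intro mult_mono) (auto intro!: mult_left_mono)
        moreover have "exp (A * \<sigma>) \<le> norm (q s)"
        proof -
          have "exp (A * \<sigma>) \<le> \<eta> * Y" using \<eta> by (simp add: Y_def algebra_simps)
          then show ?thesis using q2[of s] True by simp
        qed
        ultimately have "norm (H s) \<le> M * norm (q s)"
          using M by (meson less_imp_le mult_left_mono order_trans)
        then show ?thesis using q1[OF s(1)] M(1) by (simp add: norm_divide divide_le_eq)
      next
        case False
        then consider "Re s = d" | "Re s = \<sigma>" using s by blast
        then have "norm (H s) \<le> M"
        proof cases
          case 1
          then show ?thesis using nH nh by simp
        next
          case 2
          have "norm (H s) \<le> M * exp (- (A * \<sigma>)) * exp (A * (\<sigma> - d))"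
            unfolding nH 2 by (intro mult_right_mono line 2) auto
          also have "\<dots> = M * exp (- (A * d))"
            by (simp add: mult.assoc exp_add[symmetric] algebra_simps)
          also have "\<dots> \<le> M" using A d M by simp
          finally show ?thesis .
        qed
        then have "norm (H s) / norm (q s) \<le> M / 1"
          using q1[OF s(1)] M by (intro frac_le) auto
        then show ?thesis by (simp add: norm_divide)
      qed
    qed
    then show ?thesis
      using q1[of z] d M(1) by (simp add: norm_divide q_def divide_le_eq split: if_splits)
  qed
  have "((\<lambda>\<eta>. M * norm (1 + of_real \<eta> * (z - of_real d))) \<longlongrightarrow> M * norm (1 + of_real 0 * (z - of_real d))) (at_right 0)"
    by (intro tendsto_intros)
  then have "norm (H z) \<le> M * norm (1 + of_real 0 * (z - of_real d))"
    by (rule tendsto_lowerbound) (use bound eventually_at_right_less[of "0::real"] in \<open>auto elim: eventually_mono\<close>)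
  then have "norm (h z) * exp (A * (Re z - d)) \<le> M"
    by (simp add: H_def norm_mult)
  moreover have "norm (h z) \<le> M * exp (- X)" if "norm (h z) * exp X \<le> M" for X
    using that by (simp add: exp_minus field_simps)
  ultimately show ?thesis by blast
qed

lemma strip_decay:
  assumes hol: "h holomorphic_on halfplane 0"
    and M: "M > 0" "\<And>s. Re s > 0 \<Longrightarrow> norm (h s) \<le> M"
    and A: "A \<ge> 0" and line: "\<And>s. Re s = \<sigma> \<Longrightarrow> norm (h s) \<le> M * exp (- (A * \<sigma>))"
    and z: "0 < Re z" "Re z \<le> \<sigma>"
  shows "norm (h z) \<le> M * exp (- (A * Re z))"
proof (cases "Re z = \<sigma>")
  case True
  then show ?thesis using line by simp
next
  case False
  have "((\<lambda>d. M * exp (- (A * (Re z - d)))) \<longlongrightarrow> M * exp (- (A * (Re z - 0)))) (at_right 0)"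
    by (intro tendsto_intros)
  moreover have "eventually (\<lambda>d. norm (h z) \<le> M * exp (- (A * (Re z - d)))) (at_right 0)"
  proof -
    have "eventually (\<lambda>d. d \<in> {0<..<Re z}) (at_right 0)"
      using z by (intro eventually_at_right_real)
    then show ?thesis
    proof eventually_elim
      case (elim d)
      show ?case
        by (rule strip_decay_interior[OF hol M A line]) (use elim z False in auto)
    qed
  qed
  ultimately have "norm (h z) \<le> M * exp (- (A * (Re z - 0)))"
    by (rule tendsto_lowerbound) simp
  then show ?thesis by simp
qed

text \<open>\<open>\<eta>\<close> is chosen before \<open>g\<close>, so that the statement applies
  to a whole sequence at once. Division by \<open>(1 + s) powr l\<close> yields a bounded function,
  to which \<open>strip_decay\<close> applies with a rate \<open>A\<close> so large that its bound
  at \<open>Re s = u\<close> is at most \<open>e\<close>.\<close>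

lemma growth_small_of_small_far_right:
  fixes l K u e \<sigma> :: real
  assumes l: "l > 0" and K: "K \<ge> 0" and u: "u > 0" and e: "e > 0"
  shows "\<exists>\<eta>>0. \<forall>g. g holomorphic_on halfplane 0 \<longrightarrow> (\<forall>s. Re s > 0 \<longrightarrow> norm (g s) \<le> K * (1 + norm s) powr l)
      \<longrightarrow> (\<forall>s. Re s \<ge> \<sigma> \<longrightarrow> norm (g s) \<le> \<eta>) \<longrightarrow> (\<forall>s. Re s \<ge> u \<longrightarrow> norm (g s) \<le> e * (1 + norm s) powr l)"
proof -
  \<comment> \<open>\<open>2 powr l\<close> comes from
    \<open>1 + norm s \<le> 2 * norm (1 + s)\<close> on the half-plane; \<open>K + 1\<close> keeps
    \<open>M\<close> positive when \<open>K = 0\<close>.\<close>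
  define M where "M = (K + 1) * 2 powr l"
  have M: "M > 0" using K by (simp add: M_def)
  define A where "A = max 0 (ln (M / e) / u)"
  have A: "A \<ge> 0" by (simp add: A_def)
  have MA: "M * exp (- (A * u)) \<le> e"
  proof -
    have "ln (M / e) \<le> A * u" using u by (simp add: A_def field_simps max_def)
    then have "exp (ln (M / e)) \<le> exp (A * u)" by simp
    then show ?thesis using M e by (simp add: exp_minus field_simps)
  qed
  \<comment> \<open>The entries serve two regions: \<open>e\<close> to the right of
    \<open>\<sigma>\<close>, the other as the bound on the line \<open>Re s = \<sigma>\<close> that
    closes the strip.\<close>
  define \<eta> where "\<eta> = min e (M * exp (- (A * \<sigma>)))"
  show ?thesis
  proof (intro exI[of _ \<eta>] conjI allI impI)
    show "\<eta> > 0" using M e by (simp add: \<eta>_def)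
    fix g s
    assume hol: "g holomorphic_on halfplane 0" and bd: "\<forall>s. Re s > 0 \<longrightarrow> norm (g s) \<le> K * (1 + norm s) powr l"
      and far: "\<forall>s. Re s \<ge> \<sigma> \<longrightarrow> norm (g s) \<le> \<eta>" and s: "Re s \<ge> u"
    define h where "h = (\<lambda>s::complex. g s * (1 + s) powr of_real (- l))"
    have nh: "norm (h s) = norm (g s) * norm (1 + s) powr (- l)" for s
      using norm_powr_real_powr'[OF Reals_of_real, of "1 + s" "- l"] unfolding h_def norm_mult by simp
    have n1: "1 \<le> norm (1 + s)" "norm s \<le> norm (1 + s)" if "Re s > 0" for s
    proof -
      show "1 \<le> norm (1 + s)" using abs_Re_le_cmod[of "1 + s"] that by simp
      show "norm s \<le> norm (1 + s)"
        using that unfolding cmod_def by (intro real_sqrt_le_mono add_right_mono) (auto simp: power2_eq_square intro!: mult_mono)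
    qed
    have holh: "h holomorphic_on halfplane 0"
      unfolding h_def using hol
      by (intro holomorphic_intros) (auto simp: halfplane_def complex_nonpos_Reals_iff)
    have hM: "norm (h s) \<le> M" if "Re s > 0" for s
    proof -
      have "norm (g s) \<le> K * (2 * norm (1 + s)) powr l"
        using bd that n1[OF that] l K by (elim allE[of _ s] impE order_trans) (auto intro!: mult_left_mono powr_mono2)
      then have "norm (h s) \<le> K * (2 * norm (1 + s)) powr l * norm (1 + s) powr (- l)"
        unfolding nh by (intro mult_right_mono) auto
      also have "\<dots> = K * 2 powr l"
      proof -
        have "norm (1 + s) \<noteq> 0" using n1[OF that] by linarith
        then show ?thesis by (simp add: powr_mult powr_minus)
      qed
      also have "\<dots> \<le> M" using K by (simp add: M_def)
      finally show ?thesis .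
    qed
    have line: "norm (h s) \<le> M * exp (- (A * \<sigma>))" if "Re s = \<sigma>" "Re s > 0" for s
    proof -
      have "norm (1 + s) powr (- l) \<le> 1"
        using n1[OF that(2)] l powr_mono2'[of "- l" 1 "norm (1 + s)"] by simp
      then have "norm (h s) \<le> \<eta> * 1"
        unfolding nh using far that by (intro mult_mono) (auto intro: order_trans[OF norm_ge_zero])
      then show ?thesis by (simp add: \<eta>_def)
    qed
    have s0: "Re s > 0" using s u by simp
    show "norm (g s) \<le> e * (1 + norm s) powr l"
    proof (cases "Re s \<le> \<sigma>")
      case True
      have "norm (h s) \<le> M * exp (- (A * Re s))"
        by (rule strip_decay[OF holh M hM A line]) (use True s0 in auto)
      also have "\<dots> \<le> M * exp (- (A * u))"
        using s A M by (auto intro!: mult_left_mono)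
      finally have he: "norm (h s) \<le> e" using MA by linarith
      have "norm (g s) = norm (h s) * norm (1 + s) powr l"
      proof -
        have "norm (1 + s) \<noteq> 0" using n1[OF s0] by linarith
        then show ?thesis by (simp add: nh powr_minus)
      qed
      also have "\<dots> \<le> e * (1 + norm s) powr l"
        using he e l norm_triangle_ineq[of 1 s] by (intro mult_mono powr_mono2) auto
      finally show ?thesis .
    next
      case False
      then have "norm (g s) \<le> e * 1" using far by (auto simp: \<eta>_def)
      also have "\<dots> \<le> e * (1 + norm s) powr l"
        using e l by (intro mult_left_mono ge_one_powr_ge_zero) auto
      finally show ?thesis .
    qed
  qed
qed

section \<open>The spaces of Dirichlet series and of limit functions\<close>

lemma bound_le_H_norm:
  assumes "f \<in> H_space lam l" "Re s > 0"
  shows "norm (f s) \<le> H_norm l f * (1 + norm s) powr l"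
proof -
  have "norm (f s) / (1 + norm s) powr l \<le> H_norm l f"
    unfolding H_norm_def using assms by (intro cSUP_upper) (auto simp: H_space_def halfplane_def)
  moreover have "1 + norm s > 0" by (simp add: add_pos_nonneg)
  ultimately show ?thesis by (simp add: divide_le_eq)
qed

lemma H_norm_le:
  assumes "\<And>s. Re s > 0 \<Longrightarrow> norm (f s) \<le> M * (1 + norm s) powr l"
  shows "H_norm l f \<le> M"
  unfolding H_norm_def
proof (rule cSUP_least)
  have "1 \<in> halfplane 0" by (simp add: halfplane_def)
  then show "halfplane 0 \<noteq> {}" by blast
  fix s assume "s \<in> halfplane 0"
  moreover have "1 + norm s > 0" by (simp add: add_pos_nonneg)
  ultimately show "norm (f s) / (1 + norm s) powr l \<le> M"
    using assms by (simp add: halfplane_def divide_le_eq)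
qed

lemma H_norm_nonneg: "f \<in> H_space lam l \<Longrightarrow> 0 \<le> H_norm l f"
proof -
  assume f: "f \<in> H_space lam l"
  have "0 \<le> H_norm l f * (1 + norm (1::complex)) powr l"
    by (rule order_trans[OF norm_ge_zero bound_le_H_norm[OF f]]) simp
  then show ?thesis by (simp add: zero_le_mult_iff)
qed

definition dirichlet_rep :: "(nat \<Rightarrow> real) \<Rightarrow> real \<Rightarrow> (nat \<Rightarrow> complex) \<Rightarrow> (complex \<Rightarrow> complex) \<Rightarrow> bool" where
  "dirichlet_rep lam \<sigma> a f \<longleftrightarrow> summable (\<lambda>n. norm (a n) * exp (- (\<sigma> * lam n))) \<and>
     (\<forall>z. Re z \<ge> \<sigma> \<longrightarrow> f z = (\<Sum>n. a n * exp (- (of_real (lam n) * z))))"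

locale gap_frequency =
  fixes lam :: "nat \<Rightarrow> real" and l \<beta> c :: real
  assumes freq: "frequency lam" and l: "l > 0" and \<beta>: "\<beta> > 0" and c: "c > 0"
    and gap: "\<And>n. c * exp (- (\<beta> * lam n)) \<le> lam (Suc n) - lam n"
begin

section \<open>Dirichlet expansions of germs and their uniqueness\<close>

lemma summable_norm_mono:
  assumes "summable (\<lambda>n. norm (a n :: complex) * exp (- (\<sigma> * lam n)))" "\<sigma> \<le> \<sigma>'"
  shows "summable (\<lambda>n. norm (a n) * exp (- (\<sigma>' * lam n)))"
  by (rule summable_comparison_test'[OF assms(1), of 0])
     (use assms(2) frequency_nonneg[OF freq] in \<open>auto intro!: mult_left_mono mult_right_mono\<close>)

lemma dirichlet_rep_mono: "dirichlet_rep lam \<sigma> a f \<Longrightarrow> \<sigma> \<le> \<sigma>' \<Longrightarrow> dirichlet_rep lam \<sigma>' a f"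
  unfolding dirichlet_rep_def using summable_norm_mono by auto

lemma germ_dirichlet_rep:
  assumes "riesz_germ lam a f"
  obtains \<sigma> where "\<sigma> \<ge> 1" "dirichlet_rep lam \<sigma> a f"
proof -
  obtain m \<tau> where m: "m \<ge> 0" "\<And>s. s \<in> halfplane \<tau> \<Longrightarrow> (riesz_mean lam m a s \<longlongrightarrow> f s) at_top"
    using assms by (auto simp: riesz_germ_def)
  have "(riesz_mean lam m a (of_real (\<tau> + 1)) \<longlongrightarrow> f (of_real (\<tau> + 1))) at_top"
    by (rule m) (simp add: halfplane_def)
  from riesz_tendsto_abs_summable[OF freq \<beta> c gap m(1) this] obtain \<sigma>1
    where \<sigma>1: "summable (\<lambda>n. norm (a n) * exp (- (\<sigma>1 * lam n)))" by blast
  define \<sigma> where "\<sigma> = max 1 (max \<sigma>1 (\<tau> + 1))"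
  have sm: "summable (\<lambda>n. norm (a n) * exp (- (\<sigma> * lam n)))"
    by (rule summable_norm_mono[OF \<sigma>1]) (simp add: \<sigma>_def)
  have "f z = (\<Sum>n. a n * exp (- (of_real (lam n) * z)))" if "Re z \<ge> \<sigma>" for z
  proof (rule tendsto_unique[OF trivial_limit_at_top_linorder])
    show "(riesz_mean lam m a z \<longlongrightarrow> f z) at_top"
      using that by (intro m) (simp add: halfplane_def \<sigma>_def)
    show "(riesz_mean lam m a z \<longlongrightarrow> (\<Sum>n. a n * exp (- (of_real (lam n) * z)))) at_top"
      by (rule riesz_mean_tendsto_suminf[OF freq m(1) sm that])
  qed
  with sm show ?thesis by (intro that[of \<sigma>]) (auto simp: dirichlet_rep_def \<sigma>_def)
qed

text \<open>The two germs may come with different orders and abscissas; absolute convergence far to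
  the right removes the orders and reduces the claim to \<open>dirichlet_coeffs_zero\<close>. This
  makes the description in \<open>riesz_coeff\<close> well defined.\<close>

lemma germ_unique:
  assumes "riesz_germ lam a f" "riesz_germ lam b f"
  shows "a = b"
proof
  fix n
  obtain \<sigma>1 where 1: "\<sigma>1 \<ge> 1" "dirichlet_rep lam \<sigma>1 a f" by (rule germ_dirichlet_rep[OF assms(1)])
  obtain \<sigma>2 where 2: "\<sigma>2 \<ge> 1" "dirichlet_rep lam \<sigma>2 b f" by (rule germ_dirichlet_rep[OF assms(2)])
  define \<sigma> where "\<sigma> = max \<sigma>1 \<sigma>2"
  have ab: "dirichlet_rep lam \<sigma> a f" "dirichlet_rep lam \<sigma> b f"
    using 1 2 dirichlet_rep_mono by (auto simp: \<sigma>_def)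
  have abs: "summable (\<lambda>n. d n * exp (- (of_real (lam n) * z)))"
    if "summable (\<lambda>n. norm (d n :: complex) * exp (- (\<sigma> * lam n)))" "Re z \<ge> \<sigma>" for d z
    by (rule summable_comparison_test'[OF that(1), of 0])
       (use that(2) frequency_nonneg[OF freq] in \<open>auto simp: norm_mult mult.commute intro!: mult_left_mono mult_right_mono\<close>)
  have "a n - b n = 0"
  proof (rule dirichlet_coeffs_zero[OF freq, of "\<lambda>n. a n - b n" \<sigma>])
    have "summable (\<lambda>n. norm (a n) * exp (- (\<sigma> * lam n)) + norm (b n) * exp (- (\<sigma> * lam n)))"
      using ab by (intro summable_add) (auto simp: dirichlet_rep_def)
    then show "summable (\<lambda>n. norm (a n - b n) * exp (- (\<sigma> * lam n)))"
      by (rule summable_comparison_test'[of _ 0])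
         (auto simp: distrib_right[symmetric] intro!: mult_right_mono norm_triangle_ineq4)
    fix z :: complex assume z: "\<sigma> \<le> Re z"
    have "(\<Sum>n. (a n - b n) * exp (- (of_real (lam n) * z))) =
       (\<Sum>n. a n * exp (- (of_real (lam n) * z))) - (\<Sum>n. b n * exp (- (of_real (lam n) * z)))"
      using suminf_diff[OF abs[of a z] abs[of b z]] ab z
      by (simp add: dirichlet_rep_def left_diff_distrib)
    also have "\<dots> = f z - f z" using ab z by (simp add: dirichlet_rep_def)
    finally show "(\<Sum>n. (a n - b n) * exp (- (of_real (lam n) * z))) = 0" by simp
  qed
  then show "a n = b n" by simp
qed

lemma D_space_intro:
  assumes hol: "f holomorphic_on halfplane 0" and zero: "\<And>s. s \<notin> halfplane 0 \<Longrightarrow> f s = 0"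
    and bd: "\<And>s. Re s > 0 \<Longrightarrow> norm (f s) \<le> M * (1 + norm s) powr l"
    and lim: "\<And>s. Re s > 0 \<Longrightarrow> (riesz_mean lam l a s \<longlongrightarrow> f s) at_top"
  shows "f \<in> H_space lam l" "a \<in> D_space lam l" "riesz_limit lam l a = f"
proof -
  show eq: "riesz_limit lam l a = f"
  proof
    fix s show "riesz_limit lam l a s = f s"
      using zero lim tendsto_Lim[OF trivial_limit_at_top_linorder lim]
      by (simp add: riesz_limit_def halfplane_def)
  qed
  have "riesz_germ lam a f"
    unfolding riesz_germ_def using l lim by (intro exI[of _ l] conjI exI[of _ 0]) (auto simp: halfplane_def)
  moreover have "bdd_above ((\<lambda>s. norm (f s) / (1 + norm s) powr l) ` halfplane 0)"
  proof (rule bdd_aboveI2)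
    fix s assume "s \<in> halfplane 0"
    moreover have "1 + norm s > 0" by (simp add: add_pos_nonneg)
    ultimately show "norm (f s) / (1 + norm s) powr l \<le> M"
      using bd by (simp add: halfplane_def divide_le_eq)
  qed
  ultimately show H: "f \<in> H_space lam l"
    using hol zero by (auto simp: H_space_def)
  then show "a \<in> D_space lam l"
    using lim eq by (auto simp: D_space_def riesz_summable_on_def riesz_summable_at_def halfplane_def)
qed

text \<open>The source of summability on the whole half-plane: a function of the right growth with a
  Dirichlet expansion far to the right is the limit of its Riesz means of order
  \<open>l\<close>.\<close>

lemma D_space_intro_rep:
  assumes hol: "f holomorphic_on halfplane 0" and zero: "\<And>s. s \<notin> halfplane 0 \<Longrightarrow> f s = 0"
    and M: "M \<ge> 0" and bd: "\<And>s. Re s > 0 \<Longrightarrow> norm (f s) \<le> M * (1 + norm s) powr l"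
    and \<sigma>: "\<sigma> \<ge> 1" and rep: "dirichlet_rep lam \<sigma> a f"
  shows "a \<in> D_space lam l" "riesz_limit lam l a = f"
proof -
  have "(riesz_mean lam l a s \<longlongrightarrow> f s) at_top" if "Re s > 0" for s
    by (rule riesz_mean_tendsto_of_growth[OF freq l \<sigma> _ _ hol M bd that])
       (use rep in \<open>auto simp: dirichlet_rep_def\<close>)
  from D_space_intro[OF hol zero bd this] show "a \<in> D_space lam l" "riesz_limit lam l a = f" by auto
qed

lemma H_space_germ:
  assumes f: "f \<in> H_space lam l" and germ: "riesz_germ lam a f"
  shows "a \<in> D_space lam l" "riesz_limit lam l a = f"
proof -
  obtain \<sigma> where \<sigma>: "\<sigma> \<ge> 1" "dirichlet_rep lam \<sigma> a f" by (rule germ_dirichlet_rep[OF germ])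
  show "a \<in> D_space lam l" "riesz_limit lam l a = f"
    by (rule D_space_intro_rep[OF _ _ H_norm_nonneg[OF f] bound_le_H_norm[OF f] \<sigma>];
        use f in \<open>simp add: H_space_def\<close>)+
qed

lemma D_spaceD:
  assumes "a \<in> D_space lam l"
  shows "riesz_limit lam l a \<in> H_space lam l" "Re s > 0 \<Longrightarrow> (riesz_mean lam l a s \<longlongrightarrow> riesz_limit lam l a s) at_top"
    "riesz_germ lam a (riesz_limit lam l a)" "riesz_limit lam l a holomorphic_on halfplane 0"
    "Re s \<le> 0 \<Longrightarrow> riesz_limit lam l a s = 0"
    "Re s > 0 \<Longrightarrow> norm (riesz_limit lam l a s) \<le> D_norm lam l a * (1 + norm s) powr l" "0 \<le> D_norm lam l a"
proof -
  show H: "riesz_limit lam l a \<in> H_space lam l" using assms by (simp add: D_space_def)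
  have lim: "(riesz_mean lam l a s \<longlongrightarrow> riesz_limit lam l a s) at_top" if s: "Re s > 0" for s
  proof -
    have "\<exists>L. (riesz_mean lam l a s \<longlongrightarrow> L) at_top"
      using assms s by (auto simp: D_space_def riesz_summable_on_def riesz_summable_at_def halfplane_def)
    then show ?thesis
      using s tendsto_Lim[OF trivial_limit_at_top_linorder] by (force simp: riesz_limit_def halfplane_def)
  qed
  then show "Re s > 0 \<Longrightarrow> (riesz_mean lam l a s \<longlongrightarrow> riesz_limit lam l a s) at_top" .
  show "riesz_germ lam a (riesz_limit lam l a)"
    unfolding riesz_germ_def using l lim by (intro exI[of _ l] conjI exI[of _ 0]) (auto simp: halfplane_def)
  show "riesz_limit lam l a holomorphic_on halfplane 0" using H by (simp add: H_space_def)
  show "Re s \<le> 0 \<Longrightarrow> riesz_limit lam l a s = 0" by (simp add: riesz_limit_def halfplane_def)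
  show "Re s > 0 \<Longrightarrow> norm (riesz_limit lam l a s) \<le> D_norm lam l a * (1 + norm s) powr l"
    unfolding D_norm_def by (rule bound_le_H_norm[OF H])
  show "0 \<le> D_norm lam l a" unfolding D_norm_def by (rule H_norm_nonneg[OF H])
qed

section \<open>Linear structure and norm of the space of Dirichlet series\<close>

lemma D_space_lincomb:
  assumes a: "a \<in> D_space lam l" and b: "b \<in> D_space lam l"
  shows "(\<lambda>n. w * a n + v * b n) \<in> D_space lam l"
    "riesz_limit lam l (\<lambda>n. w * a n + v * b n) = (\<lambda>s. w * riesz_limit lam l a s + v * riesz_limit lam l b s)"
    "D_norm lam l (\<lambda>n. w * a n + v * b n) \<le> norm w * D_norm lam l a + norm v * D_norm lam l b"
proof -
  let ?f = "\<lambda>s. w * riesz_limit lam l a s + v * riesz_limit lam l b s"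
  have bd: "norm (?f s) \<le> (norm w * D_norm lam l a + norm v * D_norm lam l b) * (1 + norm s) powr l"
    if "Re s > 0" for s
  proof -
    have "norm (?f s) \<le> norm w * norm (riesz_limit lam l a s) + norm v * norm (riesz_limit lam l b s)"
      by (metis norm_mult norm_triangle_ineq)
    also have "\<dots> \<le> norm w * (D_norm lam l a * (1 + norm s) powr l) + norm v * (D_norm lam l b * (1 + norm s) powr l)"
      by (intro add_mono mult_left_mono D_spaceD(6) a b that) auto
    finally show ?thesis by (simp add: algebra_simps)
  qed
  have lim: "(riesz_mean lam l (\<lambda>n. w * a n + v * b n) s \<longlongrightarrow> ?f s) at_top" if "Re s > 0" for s
  proof -
    have "riesz_mean lam l (\<lambda>n. w * a n + v * b n) s = (\<lambda>x. w * riesz_mean lam l a s x + v * riesz_mean lam l b s x)"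
      by (rule ext) (simp add: riesz_mean_def sum_distrib_left sum.distrib[symmetric] algebra_simps)
    then show ?thesis
      by (simp only:) (intro tendsto_intros D_spaceD(2) a b that)
  qed
  have hol: "?f holomorphic_on halfplane 0" by (intro holomorphic_intros D_spaceD(4) a b)
  have zero: "?f s = 0" if "s \<notin> halfplane 0" for s
    using that D_spaceD(5)[OF a, of s] D_spaceD(5)[OF b, of s] by (simp add: halfplane_def)
  note I = D_space_intro[OF hol zero bd lim]
  show "(\<lambda>n. w * a n + v * b n) \<in> D_space lam l" by (rule I)
  show eq: "riesz_limit lam l (\<lambda>n. w * a n + v * b n) = ?f" by (rule I)
  show "D_norm lam l (\<lambda>n. w * a n + v * b n) \<le> norm w * D_norm lam l a + norm v * D_norm lam l b"
    unfolding D_norm_def[of _ _ "\<lambda>n. w * a n + v * b n"] eq by (rule H_norm_le[OF bd])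
qed

lemma D_space_diff:
  assumes "a \<in> D_space lam l" "b \<in> D_space lam l"
  shows "(\<lambda>n. a n - b n) \<in> D_space lam l"
    "riesz_limit lam l (\<lambda>n. a n - b n) = (\<lambda>s. riesz_limit lam l a s - riesz_limit lam l b s)"
    "D_norm lam l (\<lambda>n. a n - b n) \<le> D_norm lam l a + D_norm lam l b"
  using D_space_lincomb[OF assms, of 1 "-1"] by simp_all

lemma D_space_zero: "(\<lambda>n. 0) \<in> D_space lam l" "riesz_limit lam l (\<lambda>n. 0) = (\<lambda>s. 0)"
proof -
  have "riesz_mean lam l (\<lambda>n. 0) s = (\<lambda>x. 0)" for s
    by (rule ext) (simp add: riesz_mean_def)
  then have "(riesz_mean lam l (\<lambda>n. 0) s \<longlongrightarrow> 0) at_top" for s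
    by simp
  from D_space_intro[OF holomorphic_on_const _ _ this, of 0]
  show "(\<lambda>n. 0) \<in> D_space lam l" "riesz_limit lam l (\<lambda>n. 0) = (\<lambda>s. 0)" by auto
qed

lemma D_norm_zero: "D_norm lam l (\<lambda>n. 0) = 0"
proof (rule antisym)
  show "D_norm lam l (\<lambda>n. 0) \<le> 0"
    unfolding D_norm_def D_space_zero(2) by (rule H_norm_le) simp
qed (rule D_spaceD(7)[OF D_space_zero(1)])

lemma D_norm_eq_0:
  assumes a: "a \<in> D_space lam l" and "D_norm lam l a = 0"
  shows "a = (\<lambda>n. 0)"
proof -
  have "riesz_limit lam l a s = 0" for s
    using D_spaceD(5,6)[OF a, of s] assms(2) by (cases "Re s > 0") auto
  then have "riesz_limit lam l a = riesz_limit lam l (\<lambda>n. 0)"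
    by (simp add: D_space_zero(2) fun_eq_iff)
  then show ?thesis
    using germ_unique D_spaceD(3)[OF a] D_spaceD(3)[OF D_space_zero(1)] by metis
qed

lemma D_space_scale:
  assumes a: "a \<in> D_space lam l"
  shows "(\<lambda>n. w * a n) \<in> D_space lam l"
    "riesz_limit lam l (\<lambda>n. w * a n) = (\<lambda>s. w * riesz_limit lam l a s)"
    "D_norm lam l (\<lambda>n. w * a n) = norm w * D_norm lam l a"
proof -
  show 1: "(\<lambda>n. w * a n) \<in> D_space lam l" for w
    using D_space_lincomb(1)[OF a a, of w 0] by simp
  show "riesz_limit lam l (\<lambda>n. w * a n) = (\<lambda>s. w * riesz_limit lam l a s)"
    using D_space_lincomb(2)[OF a a, of w 0] by simp
  have le: "D_norm lam l (\<lambda>n. w * b n) \<le> norm w * D_norm lam l b" if "b \<in> D_space lam l" for w b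
    using D_space_lincomb(3)[OF that that, of w 0] by simp
  show "D_norm lam l (\<lambda>n. w * a n) = norm w * D_norm lam l a"
  proof (cases "w = 0")
    case True
    then show ?thesis by (simp add: D_norm_zero)
  next
    case False
    \<comment> \<open>Equality follows from the inequality applied to the inverse scalar.\<close>
    then have "D_norm lam l a \<le> norm (1 / w) * D_norm lam l (\<lambda>n. w * a n)"
      using le[OF 1, of "1 / w" w] by simp
    then have "norm w * D_norm lam l a \<le> D_norm lam l (\<lambda>n. w * a n)"
      using False by (simp add: norm_divide field_simps)
    then show ?thesis using le[OF a, of w] by simp
  qed
qed

lemma D_space_normed: "complex_normed_space (D_space lam l) (D_norm lam l)"
  unfolding complex_normed_space_def
proof (intro conjI ballI allI)
  fix a b assume ab: "a \<in> D_space lam l" "b \<in> D_space lam l"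
  show "(\<lambda>i. a i + b i) \<in> D_space lam l" "D_norm lam l (\<lambda>i. a i + b i) \<le> D_norm lam l a + D_norm lam l b"
    using D_space_lincomb(1,3)[OF ab, of 1 1] by simp_all
next
  fix a assume "a \<in> D_space lam l"
  then show "(D_norm lam l a = 0) = (a = (\<lambda>i. 0))"
    using D_norm_eq_0 D_norm_zero by blast
qed (auto simp: D_space_zero D_space_scale D_spaceD)

section \<open>Translation of Dirichlet series\<close>

lemma riesz_mean_translate: "riesz_mean lam k (translate lam u a) s x = riesz_mean lam k a (s + of_real u) x"
proof -
  have "translate lam u a n * exp (- (of_real (lam n) * s)) = a n * exp (- (of_real (lam n) * (s + of_real u)))" for n
    by (simp add: translate_def exp_of_real[symmetric] distrib_left exp_add[symmetric] mult.assoc algebra_simps)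
  then show ?thesis by (simp add: riesz_mean_def)
qed

text \<open>By \<open>1 + norm (s + u) \<le> (1 + u) * (1 + norm s)\<close>, translating costs a
  factor that is constant for fixed \<open>u\<close>.\<close>

lemma translate_growth:
  assumes "Re s > 0" "u > 0" "norm y \<le> M * (1 + norm (s + of_real u)) powr l" "M \<ge> 0"
  shows "norm y \<le> (M * (1 + u) powr l) * (1 + norm s) powr l"
proof -
  have "norm (s + of_real u) \<le> norm s + u"
    using norm_triangle_ineq[of s "of_real u"] assms by simp
  moreover have "0 \<le> u * norm s" using assms by simp
  moreover have "(1 + u) * (1 + norm s) = 1 + u + norm s + u * norm s"
    by (simp add: algebra_simps)
  ultimately have "1 + norm (s + of_real u) \<le> (1 + u) * (1 + norm s)"
    by linarith
  then have "(1 + norm (s + of_real u)) powr l \<le> ((1 + u) * (1 + norm s)) powr l"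
    using l by (intro powr_mono2) auto
  then have "M * (1 + norm (s + of_real u)) powr l \<le> M * ((1 + u) powr l * (1 + norm s) powr l)"
    using assms by (intro mult_left_mono) (auto simp: powr_mult)
  then show ?thesis using assms(3) by (simp add: mult.assoc)
qed

lemma D_space_translate:
  assumes a: "a \<in> D_space lam l" and u: "u > 0"
  shows "translate lam u a \<in> D_space lam l"
    "Re s > 0 \<Longrightarrow> riesz_limit lam l (translate lam u a) s = riesz_limit lam l a (s + of_real u)"
proof -
  define f where "f = (\<lambda>s. if Re s > 0 then riesz_limit lam l a (s + of_real u) else 0)"
  have "(\<lambda>s. riesz_limit lam l a (s + of_real u)) holomorphic_on halfplane 0"
    by (rule holomorphic_on_compose_gen[OF _ D_spaceD(4)[OF a], unfolded o_def])
       (use u in \<open>auto intro!: holomorphic_intros simp: halfplane_def\<close>)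
  then have hol: "f holomorphic_on halfplane 0"
    by (rule holomorphic_transform) (simp add: f_def halfplane_def)
  have bd: "norm (f s) \<le> (D_norm lam l a * (1 + u) powr l) * (1 + norm s) powr l" if "Re s > 0" for s
    using that u D_spaceD(6)[OF a, of "s + of_real u"] D_spaceD(7)[OF a]
    by (intro translate_growth) (auto simp: f_def)
  have lim: "(riesz_mean lam l (translate lam u a) s \<longlongrightarrow> f s) at_top" if "Re s > 0" for s
    unfolding riesz_mean_translate f_def using that D_spaceD(2)[OF a, of "s + of_real u"] u by simp
  note I = D_space_intro[OF hol _ bd lim]
  show "translate lam u a \<in> D_space lam l"
    by (rule I) (auto simp: f_def halfplane_def)
  show "Re s > 0 \<Longrightarrow> riesz_limit lam l (translate lam u a) s = riesz_limit lam l a (s + of_real u)"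
    using I(3) by (simp add: f_def halfplane_def)
qed

text \<open>The uniform version of absolute convergence: \<open>\<sigma>\<close>, \<open>K\<close>
  and \<open>w\<close> do not depend on the series. The norm bounds the Riesz sums of an integer
  order \<open>k > l\<close> by \<open>riesz_sum_bound_of_growth\<close>, and finite differences
  pass from these to the coefficients.\<close>

lemma D_space_uniform_abs_convergence:
  obtains \<sigma> K w where "\<sigma> \<ge> 1" "K \<ge> 0" "summable w" "\<And>n. 0 \<le> w n" "\<And>n. w n \<le> 1"
    "\<And>a n. a \<in> D_space lam l \<Longrightarrow> norm (a n) * exp (- (\<sigma> * lam n)) \<le> K * D_norm lam l a * w n"
    "\<And>a. a \<in> D_space lam l \<Longrightarrow> dirichlet_rep lam \<sigma> a (riesz_limit lam l a)"
proof -
  define k where "k = Suc (nat \<lceil>l\<rceil>)"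
  have k: "real k > 0" "real k > l" unfolding k_def using l by linarith+
  define \<kappa> where "\<kappa> = norm (perron_lim (real k) 1)"
  have \<kappa>: "\<kappa> > 0" unfolding \<kappa>_def using perron_lim_1_nonzero[OF k(1)] by simp
  define R where "R = 4 * 2 powr real k / (real k - l)"
  define Q where "Q = R / \<kappa>"
  have Q: "Q \<ge> 0" using k \<kappa> by (simp add: Q_def R_def)
  have "(1::real) \<ge> 0" by simp
  from coeff_bound_of_riesz_sum_bound[OF freq \<beta> c gap this, of k]
  obtain C B where C: "C > 0" and CB: "\<And>a M n. (\<And>x. x \<ge> 0 \<Longrightarrow> norm (riesz_sum lam (real k) a x) \<le> M * exp (1 * x)) \<Longrightarrow>
      norm (a n) \<le> C * M * exp (B * lam n)" by blast
  \<comment> \<open>\<open>B\<close> absorbs the growth of the coefficients,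
    \<open>2 * \<beta>\<close> leaves the summable \<open>w\<close>, and \<open>1\<close> meets the
    requirement \<open>\<sigma> \<ge> 1\<close> of the Perron estimates.\<close>
  define \<sigma> where "\<sigma> = max 1 (B + 2 * \<beta>)"
  define w where "w = (\<lambda>n. exp (- (2 * \<beta> * lam n)))"
  have w: "0 \<le> w n" "w n \<le> 1" for n
    using \<beta> frequency_nonneg[OF freq, of n] by (auto simp: w_def)
  have sw: "summable w" unfolding w_def by (rule summable_exp_frequency[OF freq \<beta> c gap])
  have dom: "norm (a n) * exp (- (\<sigma> * lam n)) \<le> (C * Q) * D_norm lam l a * w n" if a: "a \<in> D_space lam l" for a n
  proof -
    \<comment> \<open>\<open>\<sigma>'\<close> depends on \<open>a\<close>, but it does not appear
      in the resulting bound on the Riesz sums.\<close>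
    obtain \<sigma>' where \<sigma>': "\<sigma>' \<ge> 1" "dirichlet_rep lam \<sigma>' a (riesz_limit lam l a)"
      by (rule germ_dirichlet_rep[OF D_spaceD(3)[OF a]])
    have "norm (riesz_sum lam (real k) a x) \<le> (Q * D_norm lam l a) * exp (1 * x)" for x
    proof -
      have "\<kappa> * norm (riesz_sum lam (real k) a x) \<le> R * D_norm lam l a * exp x"
        unfolding \<kappa>_def R_def
        by (rule riesz_sum_bound_of_growth[OF freq k _ \<sigma>'(1) _ _ D_spaceD(4)[OF a] D_spaceD(7)[OF a] D_spaceD(6)[OF a]])
           (use \<sigma>' l in \<open>auto simp: dirichlet_rep_def\<close>)
      then show ?thesis using \<kappa> by (simp add: Q_def field_simps)
    qed
    from CB[OF this] have "norm (a n) * exp (- (\<sigma> * lam n)) \<le> C * (Q * D_norm lam l a) * exp (B * lam n) * exp (- (\<sigma> * lam n))"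
      by (intro mult_right_mono) auto
    also have "\<dots> = C * (Q * D_norm lam l a) * exp ((B - \<sigma>) * lam n)"
      by (simp add: mult.assoc exp_add[symmetric] algebra_simps)
    also have "\<dots> \<le> C * (Q * D_norm lam l a) * w n"
    proof -
      have "(B - \<sigma>) * lam n \<le> (- (2 * \<beta>)) * lam n"
        by (intro mult_right_mono frequency_nonneg[OF freq]) (simp add: \<sigma>_def)
      then show ?thesis
        using C Q D_spaceD(7)[OF a] by (intro mult_left_mono) (auto simp: w_def)
    qed
    finally show ?thesis by (simp add: mult.assoc)
  qed
  have rep: "dirichlet_rep lam \<sigma> a (riesz_limit lam l a)" if a: "a \<in> D_space lam l" for a
  proof -
    have sm: "summable (\<lambda>n. norm (a n) * exp (- (\<sigma> * lam n)))"
      by (rule summable_comparison_test'[OF summable_mult[OF sw], of 0]) (use dom[OF a] in auto)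
    have "riesz_limit lam l a z = (\<Sum>n. a n * exp (- (of_real (lam n) * z)))" if z: "Re z \<ge> \<sigma>" for z
    proof (rule tendsto_unique[OF trivial_limit_at_top_linorder])
      show "(riesz_mean lam l a z \<longlongrightarrow> riesz_limit lam l a z) at_top"
        using z by (intro D_spaceD(2)[OF a]) (simp add: \<sigma>_def)
      show "(riesz_mean lam l a z \<longlongrightarrow> (\<Sum>n. a n * exp (- (of_real (lam n) * z)))) at_top"
        by (rule riesz_mean_tendsto_suminf[OF freq _ sm z]) (use l in simp)
    qed
    with sm show ?thesis by (simp add: dirichlet_rep_def)
  qed
  show ?thesis
    by (rule that[of \<sigma> "C * Q" w]) (use C Q sw w dom rep in \<open>auto simp: \<sigma>_def\<close>)
qed

text \<open>Tannery's theorem twice, with one summable majorant: the expansion survives the limit,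
  and the weighted sum of coefficient distances tends to \<open>0\<close>, which controls the
  difference of the functions uniformly on \<open>Re z \<ge> \<sigma>\<close>.\<close>

lemma dirichlet_rep_dominated_limit:
  assumes \<sigma>: "\<sigma> \<ge> 1" and sw: "summable w"
    and rep: "\<And>j. dirichlet_rep lam \<sigma> (a j) (f j)"
    and dom: "\<And>j n. norm (a j n) * exp (- (\<sigma> * lam n)) \<le> w n"
    and lim: "\<And>n. (\<lambda>j. a j n) \<longlonglongrightarrow> b n"
    and flim: "\<And>z. Re z > 0 \<Longrightarrow> (\<lambda>j. f j z) \<longlonglongrightarrow> g z"
  shows "dirichlet_rep lam \<sigma> b g" "(\<lambda>j. \<Sum>n. norm (a j n - b n) * exp (- (\<sigma> * lam n))) \<longlonglongrightarrow> 0"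
proof -
  have bdom: "norm (b n) * exp (- (\<sigma> * lam n)) \<le> w n" for n
    by (rule tendsto_upperbound[OF tendsto_mult_right[OF tendsto_norm[OF lim]] always_eventually]) (use dom in auto)
  have "summable (\<lambda>n. norm (b n) * exp (- (\<sigma> * lam n)))"
    by (rule summable_comparison_test'[OF sw, of 0]) (use bdom in auto)
  moreover have "g z = (\<Sum>n. b n * exp (- (of_real (lam n) * z)))" if z: "Re z \<ge> \<sigma>" for z
  proof (rule LIMSEQ_unique)
    show "(\<lambda>j. f j z) \<longlonglongrightarrow> g z" using z \<sigma> by (intro flim) simp
    have "eventually (\<lambda>j. summable (\<lambda>n. norm (a j n * exp (- (of_real (lam n) * z))))) sequentially \<and>
        summable (\<lambda>n. norm (b n * exp (- (of_real (lam n) * z)))) \<and>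
        ((\<lambda>j. suminf (\<lambda>n. a j n * exp (- (of_real (lam n) * z)))) \<longlonglongrightarrow> suminf (\<lambda>n. b n * exp (- (of_real (lam n) * z))))"
    proof (rule tannerys_theorem[OF _ always_eventually sw])
      show "(\<lambda>j. a j n * exp (- (of_real (lam n) * z))) \<longlonglongrightarrow> b n * exp (- (of_real (lam n) * z))" for n
        by (intro tendsto_mult lim tendsto_const)
      have "norm (a j n * exp (- (of_real (lam n) * z))) \<le> w n" for j n
      proof -
        have "norm (a j n * exp (- (of_real (lam n) * z))) \<le> norm (a j n) * exp (- (\<sigma> * lam n))"
          using mult_right_mono[OF z frequency_nonneg[OF freq, of n]]
          by (simp add: norm_mult mult_left_mono mult.commute)
        then show ?thesis using dom[of j n] by linarith
      qed
      then show "\<forall>x. case x of (n, j) \<Rightarrow> norm (a j n * exp (- (of_real (lam n) * z))) \<le> w n" by auto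
    qed simp
    then show "(\<lambda>j. f j z) \<longlonglongrightarrow> (\<Sum>n. b n * exp (- (of_real (lam n) * z)))"
      using rep z by (simp add: dirichlet_rep_def)
  qed
  ultimately show "dirichlet_rep lam \<sigma> b g" by (simp add: dirichlet_rep_def)
  have "eventually (\<lambda>j. summable (\<lambda>n. norm (norm (a j n - b n) * exp (- (\<sigma> * lam n))))) sequentially \<and>
      summable (\<lambda>n::nat. norm (0::real)) \<and>
      ((\<lambda>j. suminf (\<lambda>n. norm (a j n - b n) * exp (- (\<sigma> * lam n)))) \<longlonglongrightarrow> suminf (\<lambda>n::nat. 0::real))"
  proof (rule tannerys_theorem[OF _ always_eventually summable_mult[OF sw, of 2]])
    show "(\<lambda>j. norm (a j n - b n) * exp (- (\<sigma> * lam n))) \<longlonglongrightarrow> 0" for n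
      using tendsto_mult_left_zero[OF tendsto_norm_zero[OF LIM_zero[OF lim[of n]]]] .
    have "norm (norm (a j n - b n) * exp (- (\<sigma> * lam n))) \<le> 2 * w n" for j n
    proof -
      have "norm (a j n - b n) * exp (- (\<sigma> * lam n)) \<le> (norm (a j n) + norm (b n)) * exp (- (\<sigma> * lam n))"
        by (intro mult_right_mono norm_triangle_ineq4) auto
      then show ?thesis using dom[of j n] bdom[of n] by (simp add: distrib_right)
    qed
    then show "\<forall>x. case x of (n, j) \<Rightarrow> norm (norm (a j n - b n) * exp (- (\<sigma> * lam n))) \<le> 2 * w n" by auto
  qed simp
  then show "(\<lambda>j. \<Sum>n. norm (a j n - b n) * exp (- (\<sigma> * lam n))) \<longlonglongrightarrow> 0" by simp
qed

lemma montel_D_space: "satisfies_montel lam l"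
  unfolding satisfies_montel_def
proof (intro allI impI, elim conjE exE)
  fix X :: "nat \<Rightarrow> nat \<Rightarrow> complex" and C assume X: "\<forall>N. X N \<in> D_space lam l" and C: "\<forall>N. D_norm lam l (X N) \<le> C"
  have XD: "X N \<in> D_space lam l" for N using X by blast
  define f where "f = (\<lambda>N. riesz_limit lam l (X N))"
  have C0: "C \<ge> 0" using C D_spaceD(7)[OF XD] order_trans by blast
  obtain \<sigma> K w where \<sigma>: "\<sigma> \<ge> 1" and K: "K \<ge> 0" and sw: "summable w" and w: "\<And>n. 0 \<le> w n" "\<And>n. w n \<le> 1"
    and dom: "\<And>a n. a \<in> D_space lam l \<Longrightarrow> norm (a n) * exp (- (\<sigma> * lam n)) \<le> K * D_norm lam l a * w n"
    and rep: "\<And>a. a \<in> D_space lam l \<Longrightarrow> dirichlet_rep lam \<sigma> a (riesz_limit lam l a)"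
    using D_space_uniform_abs_convergence by metis
  have domX: "norm (X N n) * exp (- (\<sigma> * lam n)) \<le> K * C * w n" for N n
  proof -
    have "K * D_norm lam l (X N) * w n \<le> K * C * w n"
      using C K w[of n] by (intro mult_right_mono mult_left_mono) auto
    then show ?thesis using dom[OF XD, of N n] by linarith
  qed
  \<comment> \<open>Weighting by \<open>exp (- (\<sigma> * lam n))\<close> gives one bound for all
    \<open>n\<close>, as the diagonal extraction demands.\<close>
  have bnd: "norm (X N n * of_real (exp (- (\<sigma> * lam n)))) \<le> K * C" for N n
  proof -
    have "norm (X N n * of_real (exp (- (\<sigma> * lam n)))) \<le> K * C * w n"
      using domX[of N n] by (simp add: norm_mult)
    also have "\<dots> \<le> K * C" using w[of n] K C0 by (intro mult_left_le) auto
    finally show ?thesis .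
  qed
  obtain k where k: "strict_mono (k :: nat \<Rightarrow> nat)"
      "\<And>n. n \<in> UNIV \<Longrightarrow> \<exists>L. (\<lambda>N. X (k N) n * of_real (exp (- (\<sigma> * lam n)))) \<longlonglongrightarrow> L"
    by (rule function_convergent_subsequence[OF countableI_type[of "UNIV :: nat set"],
          of "\<lambda>N n. X N n * of_real (exp (- (\<sigma> * lam n)))" "K * C"]) (rule bnd, blast)
  have "\<exists>L. (\<lambda>N. X (k N) n) \<longlonglongrightarrow> L" for n
  proof -
    obtain L where "(\<lambda>N. X (k N) n * of_real (exp (- (\<sigma> * lam n)))) \<longlonglongrightarrow> L" using k by blast
    then have "(\<lambda>N. X (k N) n * of_real (exp (- (\<sigma> * lam n))) * of_real (exp (\<sigma> * lam n))) \<longlonglongrightarrow> L * of_real (exp (\<sigma> * lam n))"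
      by (intro tendsto_intros)
    then show ?thesis
      by (auto simp: mult.assoc of_real_mult[symmetric] exp_add[symmetric] simp del: of_real_mult)
  qed
  then obtain a where a: "\<And>n. (\<lambda>N. X (k N) n) \<longlonglongrightarrow> a n" by metis
  \<comment> \<open>Norm boundedness makes the limit functions a normal family. After this second
    extraction, \<open>dirichlet_rep_dominated_limit\<close> identifies \<open>a\<close> as the
    coefficients of the limit.\<close>
  obtain g r' where g: "g holomorphic_on halfplane 0" "strict_mono (r' :: nat \<Rightarrow> nat)"
    "\<And>z. z \<in> halfplane 0 \<Longrightarrow> (\<lambda>n. f (k (r' n)) z) \<longlonglongrightarrow> g z"
  proof (rule Montel[of "halfplane 0" "range f" "\<lambda>n. f (k n)"])
    show "open (halfplane 0)" by (rule halfplane_open_convex)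
    show "h holomorphic_on halfplane 0" if "h \<in> range f" for h
      using that D_spaceD(4)[OF XD] by (auto simp: f_def)
    show "\<exists>B. \<forall>h\<in>range f. \<forall>z\<in>S. norm (h z) \<le> B" if S: "compact S" "S \<subseteq> halfplane 0" for S
    proof -
      obtain \<rho> where \<rho>: "\<And>z. z \<in> S \<Longrightarrow> norm z \<le> \<rho>"
        using compact_imp_bounded[OF S(1)] by (auto simp: bounded_iff)
      have "norm (f N z) \<le> C * (1 + \<rho>) powr l" if z: "z \<in> S" for N z
      proof -
        have "norm (f N z) \<le> D_norm lam l (X N) * (1 + norm z) powr l"
          unfolding f_def using z S by (intro D_spaceD(6) XD) (auto simp: halfplane_def)
        also have "\<dots> \<le> C * (1 + \<rho>) powr l"
          using C C0 \<rho>[OF z] l by (intro mult_mono powr_mono2) auto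
        finally show ?thesis .
      qed
      then show ?thesis by (intro exI[of _ "C * (1 + \<rho>) powr l"]) auto
    qed
  qed auto
  define r where "r = k \<circ> r'"
  have r: "strict_mono r" unfolding r_def using k(1) g(2) by (rule strict_mono_o)
  define F where "F = (\<lambda>s. if s \<in> halfplane 0 then g s else 0)"
  have Fhol: "F holomorphic_on halfplane 0"
    by (rule holomorphic_transform[OF g(1)]) (simp add: F_def)
  have Flim: "(\<lambda>j. f (r j) z) \<longlonglongrightarrow> F z" if "Re z > 0" for z
    using g(3)[of z] that by (simp add: r_def F_def halfplane_def)
  have Fbd: "norm (F z) \<le> C * (1 + norm z) powr l" if "Re z > 0" for z
  proof (rule tendsto_upperbound[OF tendsto_norm[OF Flim[OF that]] always_eventually], intro allI)
    fix j
    have "norm (f (r j) z) \<le> D_norm lam l (X (r j)) * (1 + norm z) powr l"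
      unfolding f_def by (intro D_spaceD(6) XD that)
    also have "\<dots> \<le> C * (1 + norm z) powr l" using C by (intro mult_right_mono) auto
    finally show "norm (f (r j) z) \<le> C * (1 + norm z) powr l" .
  qed simp
  have alim: "(\<lambda>j. X (r j) n) \<longlonglongrightarrow> a n" for n
    using LIMSEQ_subseq_LIMSEQ[OF a g(2), of n] by (simp add: r_def o_def)
  have repf: "dirichlet_rep lam \<sigma> (X N) (f N)" for N
    unfolding f_def by (rule rep[OF XD])
  note lims = dirichlet_rep_dominated_limit[OF \<sigma> summable_mult[OF sw, of "K * C"], of "\<lambda>j. X (r j)" "\<lambda>j. f (r j)",
      OF repf domX alim Flim]
  have aD: "a \<in> D_space lam l" and aF: "riesz_limit lam l a = F"
    using D_space_intro_rep[OF Fhol _ C0 Fbd \<sigma> lims(1)] by (auto simp: F_def)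
  have an: "D_norm lam l a \<le> C" unfolding D_norm_def aF by (rule H_norm_le[OF Fbd])
  \<comment> \<open>The differences stay in a ball of radius \<open>2 * C\<close> and become small
    on \<open>Re s \<ge> \<sigma>\<close>, the input of
    \<open>growth_small_of_small_far_right\<close>.\<close>
  define d where "d = (\<lambda>j n. X (r j) n - a n)"
  have dD: "d j \<in> D_space lam l" for j unfolding d_def by (rule D_space_diff(1)[OF XD aD])
  have dn: "D_norm lam l (d j) \<le> 2 * C" for j
    using D_space_diff(3)[OF XD aD, of "r j"] C[rule_format, of "r j"] an unfolding d_def by linarith
  have far: "norm (riesz_limit lam l (d j) s) \<le> (\<Sum>n. norm (d j n) * exp (- (\<sigma> * lam n)))" if s: "Re s \<ge> \<sigma>" for j s
  proof -
    have sm: "summable (\<lambda>n. norm (d j n) * exp (- (\<sigma> * lam n)))" using rep[OF dD] by (simp add: dirichlet_rep_def)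
    have le: "norm (d j n * exp (- (of_real (lam n) * s))) \<le> norm (d j n) * exp (- (\<sigma> * lam n))" for n
      using mult_right_mono[OF s frequency_nonneg[OF freq, of n]]
      by (simp add: norm_mult mult_left_mono mult.commute)
    have sm': "summable (\<lambda>n. norm (d j n * exp (- (of_real (lam n) * s))))"
      by (rule summable_comparison_test'[OF sm, of 0]) (use le in auto)
    have "norm (riesz_limit lam l (d j) s) = norm (\<Sum>n. d j n * exp (- (of_real (lam n) * s)))"
      using rep[OF dD] s by (simp add: dirichlet_rep_def)
    also have "\<dots> \<le> (\<Sum>n. norm (d j n * exp (- (of_real (lam n) * s))))"
      by (rule summable_norm[OF sm'])
    also have "\<dots> \<le> (\<Sum>n. norm (d j n) * exp (- (\<sigma> * lam n)))"
      by (rule suminf_le[OF le sm' sm])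
    finally show ?thesis .
  qed
  have conv: "converges_in (D_space lam l) (D_norm lam l) (\<lambda>j. translate lam u (X (r j))) (translate lam u a)"
    if u: "u > 0" for u
    unfolding converges_in_def
  proof (intro conjI allI)
    show "translate lam u (X (r j)) \<in> D_space lam l" for j by (rule D_space_translate(1)[OF XD u])
    show "translate lam u a \<in> D_space lam l" by (rule D_space_translate(1)[OF aD u])
    have tr: "(\<lambda>i. translate lam u (X (r j)) i - translate lam u a i) = translate lam u (d j)" for j
      by (rule ext) (simp add: translate_def d_def left_diff_distrib)
    have "(\<lambda>j. D_norm lam l (translate lam u (d j))) \<longlonglongrightarrow> 0"
    proof (rule LIMSEQ_I)
      fix e :: real assume e: "e > 0"
      \<comment> \<open>The factor \<open>(1 + u) powr l\<close> pays for comparing the weights at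
        \<open>s + u\<close> and at \<open>s\<close>; the half makes the final inequality
        strict.\<close>
      define e' where "e' = e / 2 / (1 + u) powr l"
      have e': "e' > 0" "e' * (1 + u) powr l = e / 2" using e u by (auto simp: e'_def)
      obtain \<eta> where \<eta>: "\<eta> > 0" "\<And>g s. g holomorphic_on halfplane 0 \<Longrightarrow> (\<forall>s. Re s > 0 \<longrightarrow> norm (g s) \<le> (2 * C) * (1 + norm s) powr l)
         \<Longrightarrow> (\<forall>s. Re s \<ge> \<sigma> \<longrightarrow> norm (g s) \<le> \<eta>) \<Longrightarrow> Re s \<ge> u \<Longrightarrow> norm (g s) \<le> e' * (1 + norm s) powr l"
        using growth_small_of_small_far_right[OF l, of "2 * C" u e' \<sigma>] C0 u e' by auto
      have "(\<lambda>j. \<Sum>n. norm (d j n) * exp (- (\<sigma> * lam n))) \<longlonglongrightarrow> 0"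
        using lims(2) by (simp add: d_def)
      from LIMSEQ_D[OF this \<eta>(1)] obtain N where N: "\<And>j. j \<ge> N \<Longrightarrow> norm (\<Sum>n. norm (d j n) * exp (- (\<sigma> * lam n))) < \<eta>"
        by auto
      show "\<exists>N. \<forall>j\<ge>N. norm (D_norm lam l (translate lam u (d j)) - 0) < e"
      proof (intro exI[of _ N] allI impI)
        fix j assume j: "j \<ge> N"
        have bd: "\<forall>s. Re s > 0 \<longrightarrow> norm (riesz_limit lam l (d j) s) \<le> (2 * C) * (1 + norm s) powr l"
        proof (intro allI impI)
          fix s :: complex assume "Re s > 0"
          then have "norm (riesz_limit lam l (d j) s) \<le> D_norm lam l (d j) * (1 + norm s) powr l"
            by (rule D_spaceD(6)[OF dD])
          also have "\<dots> \<le> (2 * C) * (1 + norm s) powr l" using dn by (intro mult_right_mono) auto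
          finally show "norm (riesz_limit lam l (d j) s) \<le> (2 * C) * (1 + norm s) powr l" .
        qed
        have sm: "\<forall>s. Re s \<ge> \<sigma> \<longrightarrow> norm (riesz_limit lam l (d j) s) \<le> \<eta>"
          using far[of _ j] N[OF j] by fastforce
        have "D_norm lam l (translate lam u (d j)) \<le> e' * (1 + u) powr l"
          unfolding D_norm_def
        proof (rule H_norm_le)
          fix s :: complex assume s: "Re s > 0"
          show "norm (riesz_limit lam l (translate lam u (d j)) s) \<le> e' * (1 + u) powr l * (1 + norm s) powr l"
            unfolding D_space_translate(2)[OF dD u s]
            by (rule translate_growth[OF s u \<eta>(2)[OF D_spaceD(4)[OF dD] bd sm]]) (use s e' in auto)
        qed
        then have "D_norm lam l (translate lam u (d j)) < e" using e e' by simp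
        then show "norm (D_norm lam l (translate lam u (d j)) - 0) < e"
          using D_spaceD(7)[OF D_space_translate(1)[OF dD u, of j]] by simp
      qed
    qed
    then show "(\<lambda>j. D_norm lam l (\<lambda>i. translate lam u (X (r j)) i - translate lam u a i)) \<longlonglongrightarrow> 0"
      unfolding tr .
  qed
  show "\<exists>r :: nat \<Rightarrow> nat. strict_mono r \<and> (\<exists>a\<in>D_space lam l. \<forall>u>0.
      converges_in (D_space lam l) (D_norm lam l) (\<lambda>j. translate lam u (X (r j))) (translate lam u a))"
    using r aD conv by blast
qed

text \<open>A point \<open>s\<close> is reached from \<open>s - Re s / 2\<close>, still in the
  half-plane, by the translation about \<open>Re s / 2\<close>; norm convergence of these translates
  controls the value there.\<close>

lemma tendsto_riesz_limit_of_translates: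
  assumes conv: "\<And>u. u > 0 \<Longrightarrow> converges_in (D_space lam l) (D_norm lam l) (\<lambda>j. translate lam u (X j)) (translate lam u a)"
    and X: "\<And>j. X j \<in> D_space lam l" and a: "a \<in> D_space lam l" and s: "Re s > 0"
  shows "(\<lambda>j. riesz_limit lam l (X j) s) \<longlonglongrightarrow> riesz_limit lam l a s"
proof -
  define u where "u = Re s / 2"
  define t where "t = s - of_real u"
  have u: "u > 0" and t: "Re t > 0" "t + of_real u = s" using s by (auto simp: u_def t_def)
  define E where "E = (\<lambda>j. D_norm lam l (\<lambda>i. translate lam u (X j) i - translate lam u a i) * (1 + norm t) powr l)"
  have "(\<lambda>j. D_norm lam l (\<lambda>i. translate lam u (X j) i - translate lam u a i)) \<longlonglongrightarrow> 0"
    using conv[OF u] by (simp add: converges_in_def)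
  then have E0: "E \<longlonglongrightarrow> 0" unfolding E_def by (rule tendsto_mult_left_zero)
  have le: "norm (riesz_limit lam l (X j) s - riesz_limit lam l a s) \<le> E j" for j
  proof -
    note D = D_space_translate(1)[OF X u] D_space_translate(1)[OF a u]
    have "riesz_limit lam l (X j) s - riesz_limit lam l a s = riesz_limit lam l (\<lambda>i. translate lam u (X j) i - translate lam u a i) t"
      unfolding D_space_diff(2)[OF D] using D_space_translate(2)[OF X u t(1)] D_space_translate(2)[OF a u t(1)] t by simp
    then show ?thesis
      unfolding E_def using D_spaceD(6)[OF D_space_diff(1)[OF D] t(1)] by simp
  qed
  have "(\<lambda>j. riesz_limit lam l (X j) s - riesz_limit lam l a s) \<longlonglongrightarrow> 0"
    by (rule Lim_null_comparison[OF always_eventually[OF allI[OF le]] E0])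
  then show ?thesis by (simp add: LIM_zero_iff)
qed

text \<open>Montel's theorem supplies a candidate limit in the space, but with convergence of
  translates, hence pointwise. The Cauchy condition upgrades this to the norm: its pointwise form is
  passed to the limit along the subsequence.\<close>

lemma D_space_banach: "complex_banach_space (D_space lam l) (D_norm lam l)"
  unfolding complex_banach_space_def
proof (intro conjI D_space_normed allI impI, elim conjE)
  fix X :: "nat \<Rightarrow> nat \<Rightarrow> complex" assume "\<forall>j. X j \<in> D_space lam l" and Cau: "\<forall>e>0. \<exists>M. \<forall>j\<ge>M. \<forall>k\<ge>M. D_norm lam l (\<lambda>i. X j i - X k i) < e"
  then have X: "X j \<in> D_space lam l" for j by blast
  obtain M where M: "\<And>j k. j \<ge> M \<Longrightarrow> k \<ge> M \<Longrightarrow> D_norm lam l (\<lambda>i. X j i - X k i) < 1"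
    using Cau zero_less_one by blast
  \<comment> \<open>Dropping the terms before \<open>M\<close> leaves every member within distance
    \<open>1\<close> of \<open>X M\<close>, hence a bounded sequence.\<close>
  define Y where "Y = (\<lambda>j. X (M + j))"
  have Y: "Y j \<in> D_space lam l" for j by (simp add: Y_def X)
  have "D_norm lam l (Y j) \<le> D_norm lam l (X M) + 1" for j
  proof -
    have "D_norm lam l (\<lambda>i. 1 * (Y j i - X M i) + 1 * X M i) \<le> norm (1::complex) * D_norm lam l (\<lambda>i. Y j i - X M i) + norm (1::complex) * D_norm lam l (X M)"
      by (rule D_space_lincomb(3)[OF D_space_diff(1)[OF Y X] X])
    then show ?thesis using M[of "M + j" M] by (simp add: Y_def)
  qed
  then obtain r a where r: "strict_mono (r :: nat \<Rightarrow> nat)" and a: "a \<in> D_space lam l"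
    and conv: "\<And>u. u > 0 \<Longrightarrow> converges_in (D_space lam l) (D_norm lam l) (\<lambda>j. translate lam u (Y (r j))) (translate lam u a)"
    using montel_D_space Y unfolding satisfies_montel_def by metis
  have ptw: "(\<lambda>j. riesz_limit lam l (Y (r j)) s) \<longlonglongrightarrow> riesz_limit lam l a s" if "Re s > 0" for s
    by (rule tendsto_riesz_limit_of_translates[OF conv Y a that])
  have "(\<lambda>j. D_norm lam l (\<lambda>i. X j i - a i)) \<longlonglongrightarrow> 0"
  proof (rule LIMSEQ_I)
    fix e :: real assume e: "e > 0"
    have "\<exists>N. \<forall>j\<ge>N. \<forall>k\<ge>N. D_norm lam l (\<lambda>i. X j i - X k i) < e / 2"
      using Cau[THEN spec, of "e / 2"] e by simp
    then obtain N where N: "\<And>j k. j \<ge> N \<Longrightarrow> k \<ge> N \<Longrightarrow> D_norm lam l (\<lambda>i. X j i - X k i) < e / 2"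
      by blast
    show "\<exists>N. \<forall>j\<ge>N. norm (D_norm lam l (\<lambda>i. X j i - a i) - 0) < e"
    proof (intro exI[of _ N] allI impI)
      fix j assume j: "j \<ge> N"
      have "D_norm lam l (\<lambda>i. X j i - a i) \<le> e / 2"
        unfolding D_norm_def
      proof (rule H_norm_le)
        fix s :: complex assume s: "Re s > 0"
        show "norm (riesz_limit lam l (\<lambda>i. X j i - a i) s) \<le> e / 2 * (1 + norm s) powr l"
          unfolding D_space_diff(2)[OF X a]
        proof (rule tendsto_upperbound[OF tendsto_norm[OF tendsto_diff[OF tendsto_const ptw[OF s]]]])
          have "norm (riesz_limit lam l (X j) s - riesz_limit lam l (Y (r k)) s) \<le> e / 2 * (1 + norm s) powr l" if k: "k \<ge> N" for k
          proof -
            have "N \<le> M + r k" using seq_suble[OF r, of k] k by linarith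
            then have "D_norm lam l (\<lambda>i. X j i - Y (r k) i) \<le> e / 2"
              using N[OF j] by (simp add: Y_def less_imp_le)
            moreover have "norm (riesz_limit lam l (\<lambda>i. X j i - Y (r k) i) s) \<le> D_norm lam l (\<lambda>i. X j i - Y (r k) i) * (1 + norm s) powr l"
              by (rule D_spaceD(6)[OF D_space_diff(1)[OF X Y] s])
            ultimately show ?thesis
              unfolding D_space_diff(2)[OF X Y] by (meson mult_right_mono order_trans powr_ge_zero)
          qed
          then show "\<forall>\<^sub>F k in sequentially. norm (riesz_limit lam l (X j) s - riesz_limit lam l (Y (r k)) s) \<le> e / 2 * (1 + norm s) powr l"
            by (rule eventually_sequentiallyI)
        qed simp
      qed
      then show "norm (D_norm lam l (\<lambda>i. X j i - a i) - 0) < e"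
        using D_spaceD(7)[OF D_space_diff(1)[OF X a], of j] e by simp
    qed
  qed
  then show "\<exists>a. converges_in (D_space lam l) (D_norm lam l) X a"
    using X a by (auto simp: converges_in_def)
qed

text \<open>Injectivity is uniqueness of germs, surjectivity is \<open>H_space_germ\<close>, and the
  norm identity holds because \<open>D_norm\<close> is defined through the limit function.\<close>

lemma riesz_limit_isometry:
  "isometric_linear_bijection (D_space lam l) (D_norm lam l) (H_space lam l) (H_norm l) (riesz_limit lam l)"
  unfolding isometric_linear_bijection_def
proof (intro conjI ballI allI)
  show "bij_betw (riesz_limit lam l) (D_space lam l) (H_space lam l)"
    unfolding bij_betw_def
  proof
    show "inj_on (riesz_limit lam l) (D_space lam l)"
      by (rule inj_onI) (metis D_spaceD(3) germ_unique)
    have "f \<in> riesz_limit lam l ` D_space lam l" if f: "f \<in> H_space lam l" for f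
    proof -
      obtain a where "riesz_germ lam a f" using f by (auto simp: H_space_def)
      from H_space_germ[OF f this] show ?thesis by auto
    qed
    then show "riesz_limit lam l ` D_space lam l = H_space lam l"
      using D_spaceD(1) by blast
  qed
  fix a b assume "a \<in> D_space lam l" "b \<in> D_space lam l"
  from D_space_lincomb(2)[OF this, of 1 1]
  show "riesz_limit lam l (\<lambda>i. a i + b i) = (\<lambda>j. riesz_limit lam l a j + riesz_limit lam l b j)" by simp
next
  fix w a assume "a \<in> D_space lam l"
  then show "riesz_limit lam l (\<lambda>i. w * a i) = (\<lambda>j. w * riesz_limit lam l a j)"
    by (rule D_space_scale(2))
qed (simp add: D_norm_def)

lemma riesz_coeff_riesz_limit:
  assumes "a \<in> D_space lam l"
  shows "riesz_coeff lam (riesz_limit lam l a) = a"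
  unfolding riesz_coeff_def using D_spaceD(3)[OF assms] germ_unique by blast

end

theorem theorem3p26:
  fixes lam :: "nat \<Rightarrow> real" and l :: real
  assumes "l > 0"
    and "frequency lam"
    and "\<exists>\<beta>>0. (\<lambda>n. 1 / (lam (Suc n) - lam n)) \<in> O(\<lambda>n. exp (\<beta> * lam n))"
  shows "(\<forall>f\<in>H_space lam l. \<forall>a. riesz_germ lam a f \<longrightarrow> riesz_summable_on lam l a (halfplane 0))
    \<and> satisfies_montel lam l
    \<and> complex_banach_space (D_space lam l) (D_norm lam l)
    \<and> isometric_linear_bijection (D_space lam l) (D_norm lam l) (H_space lam l) (H_norm l)
        (riesz_limit lam l)
    \<and> (\<forall>a\<in>D_space lam l. \<forall>n. riesz_coeff lam (riesz_limit lam l a) n = a n)"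
proof -
  obtain \<beta> where \<beta>: "\<beta> > 0" "(\<lambda>n. 1 / (lam (Suc n) - lam n)) \<in> O(\<lambda>n. exp (\<beta> * lam n))"
    using assms(3) by blast
  obtain c where c: "c > 0" "\<And>n. c * exp (- (\<beta> * lam n)) \<le> lam (Suc n) - lam n"
    using gap_lower_bound[OF assms(2) \<beta>] by blast
  interpret gap_frequency lam l \<beta> c
    by unfold_locales (use assms \<beta> c in auto)
  have "riesz_summable_on lam l a (halfplane 0)" if "f \<in> H_space lam l" "riesz_germ lam a f" for f a
    using H_space_germ(1)[OF that] by (simp add: D_space_def)
  then show ?thesis
    using montel_D_space D_space_banach riesz_limit_isometry riesz_coeff_riesz_limit by simp
qed

end
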